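(* Let $q\in L_1[0,1]$ be complex-valued with $\int_0^1 q(x)\,dx=0$, let $\beta\in\mathbb{C}$, $\beta\neq\pm1$, and let $T_1$ be the operator in $L_2[0,1]$ generated by $-y''+q(x)y$ and the boundary conditions $y'(0)+\beta y'(1)=0$, $y(0)-y(1)=0$. Let $\lambda_{n,1},\lambda_{n,2}$ be its eigenvalues, satisfying $\lambda_{n,j}=(2\pi n)^2+O(n^{1/2})$. For $j=1,2$ the following statements hold. (a) Any normalized eigenfunction $\Psi_{n,j}$ of $T_1$ corresponding to the eigenvalue $\lambda_{n,j}$ satisfies (up to multiplication by a constant of modulus one) $$\Psi_{n,j}(x)=\sqrt{2}\cos 2\pi nx+O(n^{-1/2})\qquad (n\to\infty).$$ Moreover there exists $N$ such that for all $n>N$ the geometric multiplicity of the eigenvalue $\lambda_{n,j}$ is $1$. (b) For all sufficiently large $n$: a complex number $\lambda\in U(n):=\{\lambda\in\mathbb{C}:|\lambda-(2\pi n)^2|\le n\}$ is an eigenvalue of $T_1$ if and only if it is a root of the equation $$\bigl[\lambda-(2\pi n)^2-Q_n-A(\lambda)\bigr]\bigl[\lambda-(2\pi n)^2-P_n^{*}-A'(\lambda)\bigr]-\bigl[P_n+B(\lambda)\bigr]\bigl[\gamma_1 n+Q_n^{*}+B'(\lambda)\bigr]=0,\qquad(\star)$$ where $\gamma_1,P_n,Q_n,P_n^*,Q_n^*$ and the functions $A,B,A',B'$ (depending on $n$) are those defined in the context. Moreover $\lambda\in U(n)$ is a double eigenvalue of $T_1$ if and only if it is a double root of $(\star)$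.
   Context: $(f,g)=\int_0^1 f(x)\overline{g(x)}\,dx$ is the inner product of $L_2[0,1]$; the same notation is used whenever the integral makes sense. The eigenvalues of $T_1$ consist of two sequences $\{\lambda_{n,1}\},\{\lambda_{n,2}\}$ (counted with algebraic multiplicity) with $\lambda_{n,j}=(2\pi n)^2+O(n^{1/2})$, $j=1,2$. Eigenfunctions $\Psi_{n,j}$ are normalized: $\|\Psi_{n,j}\|_{L_2[0,1]}=1$. The $O$-term in (a) is uniform in $x\in[0,1]$. A double eigenvalue is an eigenvalue of algebraic multiplicity two. The prime in $A',B',\alpha_m',\beta_m'$ does not denote differentiation. Functions: for $n\ge 0$, $$\varphi_n(x)=\frac{4(\beta+1)}{\beta-1}\Bigl(\frac{\beta}{1+\beta}-x\Bigr)\sin 2\pi nx,$$ and for $n\ge 1$ $$\varphi_n^{*}(x)=\frac{4(\overline\beta+1)}{\overline\beta-1}\Bigl(x-\frac{1}{1+\overline\beta}\Bigr)\cos 2\pi nx,$$ while $$\varphi_0^{*}(x)=\frac{2(\overline\beta+1)}{\overline\beta-1}\Bigl(x-\frac{1}{1+\overline\beta}\Bigr),$$ so that the systems $\{\sin 2\pi nx\}_{n\ge1}\cup\{\varphi_n^*\}_{n\ge0}$ and $\{\varphi_n\}_{n\ge1}\cup\{\cos 2\pi nx\}_{n\ge0}$ are biorthogonal in $L_2[0,1]$. Constants: $$\gamma_1=\frac{16\pi(\beta+1)}{\beta-1},\quad P_n=(q\cos 2\pi nx,\sin 2\pi nx),\quad Q_n=(q\varphi_n,\sin 2\pi nx),$$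 $$P_n^*=(q\cos 2\pi nx,\varphi_n^* ),\quad Q_n^*=(q\varphi_n,\varphi_n^* ).$$ Fix $n$ large and put $n_0=n$. All summations over $n_1,n_2,\ldots$ below are over nonnegative integers $n_i\neq n$. For $k\ge 0$ and $\lambda\in U(n)$ define (functions of $\lambda$, depending on $n_k,n_{k+1}$) $$a_{k+1}=\frac{(q\varphi_{n_{k+1}},\sin 2\pi n_kx)}{\lambda-(2\pi n_{k+1})^2}+\frac{\gamma_1n_{k+1}(q\cos 2\pi n_{k+1}x,\sin 2\pi n_kx)}{(\lambda-(2\pi n_{k+1})^2)^2},\qquad b_{k+1}=\frac{(q\cos 2\pi n_{k+1}x,\sin 2\pi n_kx)}{\lambda-(2\pi n_{k+1})^2},$$ $$A_{k+1}=\frac{(q\varphi_{n_{k+1}},\varphi_{n_k}^* )}{\lambda-(2\pi n_{k+1})^2}+\frac{\gamma_1n_{k+1}(q\cos 2\pi n_{k+1}x,\varphi_{n_k}^* )}{(\lambda-(2\pi n_{k+1})^2)^2},\qquad B_{k+1}=\frac{(q\cos 2\pi n_{k+1}x,\varphi_{n_k}^* )}{\lambda-(2\pi n_{k+1})^2}.$$ Set $C_1=a_1$, $M_1=b_1$, $\widetilde C_1=A_1$, $\widetilde M_1=B_1$, and for $k\ge1$ $$C_{k+1}=C_ka_{k+1}+M_kA_{k+1},\quad M_{k+1}=C_kb_{k+1}+M_kB_{k+1},$$ $$\widetilde C_{k+1}=\widetilde C_ka_{k+1}+\widetilde M_kA_{k+1},\quad \widetilde M_{k+1}=\widetilde C_kb_{k+1}+\widetilde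 M_kB_{k+1}.$$ For $m\ge1$ let $$\alpha_m(\lambda)=\sum_{n_1,\ldots,n_m}\bigl[C_m(q\varphi_n,\sin 2\pi n_mx)+M_m(q\varphi_n,\varphi_{n_m}^* )\bigr],$$ $$\beta_m(\lambda)=\sum_{n_1,\ldots,n_m}\bigl[C_m(q\cos 2\pi nx,\sin 2\pi n_mx)+M_m(q\cos 2\pi nx,\varphi_{n_m}^* )\bigr],$$ $$\alpha_m'(\lambda)=\sum_{n_1,\ldots,n_m}\bigl[\widetilde C_m(q\cos 2\pi nx,\sin 2\pi n_mx)+\widetilde M_m(q\cos 2\pi nx,\varphi_{n_m}^* )\bigr],$$ $$\beta_m'(\lambda)=\sum_{n_1,\ldots,n_m}\bigl[\widetilde C_m(q\varphi_n,\sin 2\pi n_mx)+\widetilde M_m(q\varphi_n,\varphi_{n_m}^* )\bigr].$$ Finally $$A(\lambda)=\sum_{m=1}^\infty\alpha_m(\lambda),\quad B(\lambda)=\sum_{m=1}^\infty\beta_m(\lambda),\quad A'(\lambda)=\sum_{m=1}^\infty\alpha_m'(\lambda),\quad B'(\lambda)=\sum_{m=1}^\infty\beta_m'(\lambda).$$ *)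

theory Defs
  imports
    "HOL-Complex_Analysis.Complex_Analysis"
    "HOL-Library.Function_Algebras"
    "HOL-Library.Landau_Symbols"
begin

definition inner01 :: "(real \<Rightarrow> complex) \<Rightarrow> (real \<Rightarrow> complex) \<Rightarrow> complex" where
  "inner01 f g = (LINT x:{0..1}|lebesgue. f x * cnj (g x))"

definition in_L2 :: "(real \<Rightarrow> complex) \<Rightarrow> bool" where
  "in_L2 f \<longleftrightarrow> set_borel_measurable lebesgue {0..1} f \<and>
     set_integrable lebesgue {0..1} (\<lambda>x. (cmod (f x))\<^sup>2)"

definition L2_norm :: "(real \<Rightarrow> complex) \<Rightarrow> real" where
  "L2_norm f = sqrt (LINT x:{0..1}|lebesgue. (cmod (f x))\<^sup>2)"


text \<open>Absolute continuity on the unit interval, in the form \<open>g\<close> is an indefinite Lebesgue integral;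
  \<open>g'\<close> is then its derivative almost everywhere.\<close>

definition abs_cont_with_deriv :: "(real \<Rightarrow> complex) \<Rightarrow> (real \<Rightarrow> complex) \<Rightarrow> bool" where
  "abs_cont_with_deriv g g' \<longleftrightarrow> g' absolutely_integrable_on {0..1} \<and>
     (\<forall>x\<in>{0..1}. g x = g 0 + (LINT t:{0..x}|lebesgue. g' t))"

text \<open>The graph of the operator generated in \<open>L\<^sub>2\<close> by \<open>-y'' + q y\<close> with the boundary conditions
  \<open>y'(0) + \<beta> y'(1) = 0\<close> and \<open>y(0) - y(1) = 0\<close>: \<open>T1_op q \<beta> y f\<close> says that \<open>y\<close> belongs to the domain
  and is mapped to (the almost everywhere class of) \<open>f\<close>. Only values on the unit interval matter.
  Since \<open>y\<close> is continuous there, its membership in \<open>L\<^sub>2\<close> is automatic.\<close>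

definition T1_op :: "(real \<Rightarrow> complex) \<Rightarrow> complex \<Rightarrow> (real \<Rightarrow> complex) \<Rightarrow> (real \<Rightarrow> complex) \<Rightarrow> bool" where
  "T1_op q \<beta> y f \<longleftrightarrow> in_L2 f \<and>
     (\<exists>y' y''. (\<forall>x\<in>{0..1}. (y has_vector_derivative y' x) (at x within {0..1})) \<and>
        abs_cont_with_deriv y' y'' \<and>
        (AE x in lebesgue. x \<in> {0..1} \<longrightarrow> f x = - y'' x + q x * y x) \<and>
        y' 0 + \<beta> * y' 1 = 0 \<and> y 0 - y 1 = 0)"

definition T1_eigenfunction :: "(real \<Rightarrow> complex) \<Rightarrow> complex \<Rightarrow> complex \<Rightarrow> (real \<Rightarrow> complex) \<Rightarrow> bool" where
  "T1_eigenfunction q \<beta> z y \<longleftrightarrow> T1_op q \<beta> y (\<lambda>x. z * y x) \<and> (\<exists>x\<in>{0..1}. y x \<noteq> 0)"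

definition T1_eigenvalue :: "(real \<Rightarrow> complex) \<Rightarrow> complex \<Rightarrow> complex \<Rightarrow> bool" where
  "T1_eigenvalue q \<beta> z \<longleftrightarrow> (\<exists>y. T1_eigenfunction q \<beta> z y)"

text \<open>\<open>T1_ker_power q \<beta> z k\<close> is the kernel of the \<open>k\<close>-th power of \<open>T1 - z\<close>. Its elements are
  represented by functions that vanish off the unit interval, so that a function on the interval
  has exactly one representative and dimensions are those of the actual kernels.\<close>

primrec T1_ker_power :: "(real \<Rightarrow> complex) \<Rightarrow> complex \<Rightarrow> complex \<Rightarrow> nat \<Rightarrow> (real \<Rightarrow> complex) set" where
  "T1_ker_power q \<beta> z 0 = {\<lambda>x. 0}"
| "T1_ker_power q \<beta> z (Suc k) =
     {y. (\<forall>x. x \<notin> {0..1} \<longrightarrow> y x = 0) \<and>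
         (\<exists>w\<in>T1_ker_power q \<beta> z k. T1_op q \<beta> y (\<lambda>x. z * y x + w x))}"

definition fun_scale :: "complex \<Rightarrow> (real \<Rightarrow> complex) \<Rightarrow> (real \<Rightarrow> complex)" where
  "fun_scale c f = (\<lambda>x. c * f x)"

lemma vector_space_fun_scale: "vector_space fun_scale"
  by unfold_locales (auto simp: fun_scale_def algebra_simps fun_eq_iff)

definition geometric_multiplicity :: "(real \<Rightarrow> complex) \<Rightarrow> complex \<Rightarrow> complex \<Rightarrow> nat" where
  "geometric_multiplicity q \<beta> z = vector_space.dim fun_scale (T1_ker_power q \<beta> z 1)"

definition algebraic_multiplicity :: "(real \<Rightarrow> complex) \<Rightarrow> complex \<Rightarrow> complex \<Rightarrow> nat" where
  "algebraic_multiplicity q \<beta> z = vector_space.dim fun_scale (\<Union>k. T1_ker_power q \<beta> z k)"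

definition T1_double_eigenvalue :: "(real \<Rightarrow> complex) \<Rightarrow> complex \<Rightarrow> complex \<Rightarrow> bool" where
  "T1_double_eigenvalue q \<beta> z \<longleftrightarrow> T1_eigenvalue q \<beta> z \<and> algebraic_multiplicity q \<beta> z = 2"

text \<open>The sequences \<open>\<lambda>n. ev n j\<close>, for \<open>j = 1, 2\<close> and \<open>n \<ge> s j\<close>, together list the eigenvalues, each
  one as often as its algebraic multiplicity. The first indices \<open>s 1\<close> and \<open>s 2\<close> are left open: there is
  an odd number of small eigenvalues (for \<open>q = 0\<close>, the eigenvalue \<open>0\<close> is simple and all the others
  are double), so the two sequences cannot both start at the same index.\<close>

definition T1_eigenvalue_sequences ::
    "(real \<Rightarrow> complex) \<Rightarrow> complex \<Rightarrow> (nat \<Rightarrow> nat) \<Rightarrow> (nat \<Rightarrow> nat \<Rightarrow> complex) \<Rightarrow> bool" where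
  "T1_eigenvalue_sequences q \<beta> s ev \<longleftrightarrow>
     (\<forall>j\<in>{1, 2}. \<forall>n\<ge>s j. T1_eigenvalue q \<beta> (ev n j)) \<and>
     (\<forall>z. T1_eigenvalue q \<beta> z \<longrightarrow>
        finite {(n, j). j \<in> {1, 2} \<and> s j \<le> n \<and> ev n j = z} \<and>
        card {(n, j). j \<in> {1, 2} \<and> s j \<le> n \<and> ev n j = z} = algebraic_multiplicity q \<beta> z)"


definition sn :: "nat \<Rightarrow> real \<Rightarrow> complex" where
  "sn n x = complex_of_real (sin (2 * pi * real n * x))"

definition cs :: "nat \<Rightarrow> real \<Rightarrow> complex" where
  "cs n x = complex_of_real (cos (2 * pi * real n * x))"

definition phi :: "complex \<Rightarrow> nat \<Rightarrow> real \<Rightarrow> complex" where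
  "phi \<beta> n x = 4 * (\<beta> + 1) / (\<beta> - 1) * (\<beta> / (1 + \<beta>) - of_real x) * sn n x"

definition phi_star :: "complex \<Rightarrow> nat \<Rightarrow> real \<Rightarrow> complex" where
  "phi_star \<beta> n x =
     (if n = 0 then 2 * (cnj \<beta> + 1) / (cnj \<beta> - 1) * (of_real x - 1 / (1 + cnj \<beta>))
      else 4 * (cnj \<beta> + 1) / (cnj \<beta> - 1) * (of_real x - 1 / (1 + cnj \<beta>)) * cs n x)"

definition gamma1 :: "complex \<Rightarrow> complex" where
  "gamma1 \<beta> = 16 * of_real pi * (\<beta> + 1) / (\<beta> - 1)"

definition mu :: "nat \<Rightarrow> complex" where
  "mu n = of_real ((2 * pi * real n)\<^sup>2)"

definition U :: "nat \<Rightarrow> complex set" where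
  "U n = {z. cmod (z - mu n) \<le> real n}"

definition P :: "(real \<Rightarrow> complex) \<Rightarrow> nat \<Rightarrow> complex" where
  "P q n = inner01 (\<lambda>x. q x * cs n x) (sn n)"

definition Q :: "(real \<Rightarrow> complex) \<Rightarrow> complex \<Rightarrow> nat \<Rightarrow> complex" where
  "Q q \<beta> n = inner01 (\<lambda>x. q x * phi \<beta> n x) (sn n)"

definition P_star :: "(real \<Rightarrow> complex) \<Rightarrow> complex \<Rightarrow> nat \<Rightarrow> complex" where
  "P_star q \<beta> n = inner01 (\<lambda>x. q x * cs n x) (phi_star \<beta> n)"

definition Q_star :: "(real \<Rightarrow> complex) \<Rightarrow> complex \<Rightarrow> nat \<Rightarrow> complex" where
  "Q_star q \<beta> n = inner01 (\<lambda>x. q x * phi \<beta> n x) (phi_star \<beta> n)"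


text \<open>In the following four definitions \<open>i\<close> and \<open>j\<close> stand for \<open>n\<^sub>k\<close> and \<open>n\<^sub>k\<^sub>+\<^sub>1\<close>.\<close>

definition coef_a :: "(real \<Rightarrow> complex) \<Rightarrow> complex \<Rightarrow> complex \<Rightarrow> nat \<Rightarrow> nat \<Rightarrow> complex" where
  "coef_a q \<beta> z i j =
     inner01 (\<lambda>x. q x * phi \<beta> j x) (sn i) / (z - mu j) +
     gamma1 \<beta> * of_nat j * inner01 (\<lambda>x. q x * cs j x) (sn i) / (z - mu j)\<^sup>2"

definition coef_b :: "(real \<Rightarrow> complex) \<Rightarrow> complex \<Rightarrow> nat \<Rightarrow> nat \<Rightarrow> complex" where
  "coef_b q z i j = inner01 (\<lambda>x. q x * cs j x) (sn i) / (z - mu j)"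

definition coef_A :: "(real \<Rightarrow> complex) \<Rightarrow> complex \<Rightarrow> complex \<Rightarrow> nat \<Rightarrow> nat \<Rightarrow> complex" where
  "coef_A q \<beta> z i j =
     inner01 (\<lambda>x. q x * phi \<beta> j x) (phi_star \<beta> i) / (z - mu j) +
     gamma1 \<beta> * of_nat j * inner01 (\<lambda>x. q x * cs j x) (phi_star \<beta> i) / (z - mu j)\<^sup>2"

definition coef_B :: "(real \<Rightarrow> complex) \<Rightarrow> complex \<Rightarrow> complex \<Rightarrow> nat \<Rightarrow> nat \<Rightarrow> complex" where
  "coef_B q \<beta> z i j = inner01 (\<lambda>x. q x * cs j x) (phi_star \<beta> i) / (z - mu j)"

text \<open>The argument \<open>\<nu>\<close> is the list of indices \<open>n\<^sub>0, n\<^sub>1, \<dots>, n\<^sub>m\<close>. The recursions are started one step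
  earlier than usual, from \<open>(C\<^sub>0, M\<^sub>0) = (1, 0)\<close> and \<open>(C\<^sub>0, M\<^sub>0) = (0, 1)\<close> for the variant with tilde; this
  yields the initial values \<open>(a\<^sub>1, b\<^sub>1)\<close> and \<open>(A\<^sub>1, B\<^sub>1)\<close>, as shown in \<open>coef_first\<close>.\<close>

fun coef_C coef_M ::
    "(real \<Rightarrow> complex) \<Rightarrow> complex \<Rightarrow> complex \<Rightarrow> nat list \<Rightarrow> nat \<Rightarrow> complex" where
  "coef_C q \<beta> z \<nu> 0 = 1"
| "coef_C q \<beta> z \<nu> (Suc k) =
     coef_C q \<beta> z \<nu> k * coef_a q \<beta> z (\<nu> ! k) (\<nu> ! Suc k) +
     coef_M q \<beta> z \<nu> k * coef_A q \<beta> z (\<nu> ! k) (\<nu> ! Suc k)"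
| "coef_M q \<beta> z \<nu> 0 = 0"
| "coef_M q \<beta> z \<nu> (Suc k) =
     coef_C q \<beta> z \<nu> k * coef_b q z (\<nu> ! k) (\<nu> ! Suc k) +
     coef_M q \<beta> z \<nu> k * coef_B q \<beta> z (\<nu> ! k) (\<nu> ! Suc k)"

fun coef_Ct coef_Mt ::
    "(real \<Rightarrow> complex) \<Rightarrow> complex \<Rightarrow> complex \<Rightarrow> nat list \<Rightarrow> nat \<Rightarrow> complex" where
  "coef_Ct q \<beta> z \<nu> 0 = 0"
| "coef_Ct q \<beta> z \<nu> (Suc k) =
     coef_Ct q \<beta> z \<nu> k * coef_a q \<beta> z (\<nu> ! k) (\<nu> ! Suc k) +
     coef_Mt q \<beta> z \<nu> k * coef_A q \<beta> z (\<nu> ! k) (\<nu> ! Suc k)"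
| "coef_Mt q \<beta> z \<nu> 0 = 1"
| "coef_Mt q \<beta> z \<nu> (Suc k) =
     coef_Ct q \<beta> z \<nu> k * coef_b q z (\<nu> ! k) (\<nu> ! Suc k) +
     coef_Mt q \<beta> z \<nu> k * coef_B q \<beta> z (\<nu> ! k) (\<nu> ! Suc k)"

lemma coef_first:
  "coef_C q \<beta> z \<nu> 1 = coef_a q \<beta> z (\<nu> ! 0) (\<nu> ! 1)"
  "coef_M q \<beta> z \<nu> 1 = coef_b q z (\<nu> ! 0) (\<nu> ! 1)"
  "coef_Ct q \<beta> z \<nu> 1 = coef_A q \<beta> z (\<nu> ! 0) (\<nu> ! 1)"
  "coef_Mt q \<beta> z \<nu> 1 = coef_B q \<beta> z (\<nu> ! 0) (\<nu> ! 1)"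
  by simp_all

definition index_tuples :: "nat \<Rightarrow> nat \<Rightarrow> nat list set" where
  "index_tuples n m = {ns. length ns = m \<and> n \<notin> set ns}"

definition alpha_term :: "(real \<Rightarrow> complex) \<Rightarrow> complex \<Rightarrow> nat \<Rightarrow> nat \<Rightarrow> complex \<Rightarrow> complex" where
  "alpha_term q \<beta> n m z = infsum (\<lambda>ns. let \<nu> = n # ns in
     coef_C q \<beta> z \<nu> m * inner01 (\<lambda>x. q x * phi \<beta> n x) (sn (\<nu> ! m)) +
     coef_M q \<beta> z \<nu> m * inner01 (\<lambda>x. q x * phi \<beta> n x) (phi_star \<beta> (\<nu> ! m)))
     (index_tuples n m)"

definition beta_term :: "(real \<Rightarrow> complex) \<Rightarrow> complex \<Rightarrow> nat \<Rightarrow> nat \<Rightarrow> complex \<Rightarrow> complex" where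
  "beta_term q \<beta> n m z = infsum (\<lambda>ns. let \<nu> = n # ns in
     coef_C q \<beta> z \<nu> m * inner01 (\<lambda>x. q x * cs n x) (sn (\<nu> ! m)) +
     coef_M q \<beta> z \<nu> m * inner01 (\<lambda>x. q x * cs n x) (phi_star \<beta> (\<nu> ! m)))
     (index_tuples n m)"

definition alpha_term' :: "(real \<Rightarrow> complex) \<Rightarrow> complex \<Rightarrow> nat \<Rightarrow> nat \<Rightarrow> complex \<Rightarrow> complex" where
  "alpha_term' q \<beta> n m z = infsum (\<lambda>ns. let \<nu> = n # ns in
     coef_Ct q \<beta> z \<nu> m * inner01 (\<lambda>x. q x * cs n x) (sn (\<nu> ! m)) +
     coef_Mt q \<beta> z \<nu> m * inner01 (\<lambda>x. q x * cs n x) (phi_star \<beta> (\<nu> ! m)))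
     (index_tuples n m)"

definition beta_term' :: "(real \<Rightarrow> complex) \<Rightarrow> complex \<Rightarrow> nat \<Rightarrow> nat \<Rightarrow> complex \<Rightarrow> complex" where
  "beta_term' q \<beta> n m z = infsum (\<lambda>ns. let \<nu> = n # ns in
     coef_Ct q \<beta> z \<nu> m * inner01 (\<lambda>x. q x * phi \<beta> n x) (sn (\<nu> ! m)) +
     coef_Mt q \<beta> z \<nu> m * inner01 (\<lambda>x. q x * phi \<beta> n x) (phi_star \<beta> (\<nu> ! m)))
     (index_tuples n m)"

definition A_sum :: "(real \<Rightarrow> complex) \<Rightarrow> complex \<Rightarrow> nat \<Rightarrow> complex \<Rightarrow> complex" where
  "A_sum q \<beta> n z = (\<Sum>m. alpha_term q \<beta> n (Suc m) z)"

definition B_sum :: "(real \<Rightarrow> complex) \<Rightarrow> complex \<Rightarrow> nat \<Rightarrow> complex \<Rightarrow> complex" where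
  "B_sum q \<beta> n z = (\<Sum>m. beta_term q \<beta> n (Suc m) z)"

definition A_sum' :: "(real \<Rightarrow> complex) \<Rightarrow> complex \<Rightarrow> nat \<Rightarrow> complex \<Rightarrow> complex" where
  "A_sum' q \<beta> n z = (\<Sum>m. alpha_term' q \<beta> n (Suc m) z)"

definition B_sum' :: "(real \<Rightarrow> complex) \<Rightarrow> complex \<Rightarrow> nat \<Rightarrow> complex \<Rightarrow> complex" where
  "B_sum' q \<beta> n z = (\<Sum>m. beta_term' q \<beta> n (Suc m) z)"

definition char_eq_lhs :: "(real \<Rightarrow> complex) \<Rightarrow> complex \<Rightarrow> nat \<Rightarrow> complex \<Rightarrow> complex" where
  "char_eq_lhs q \<beta> n z =
     (z - mu n - Q q \<beta> n - A_sum q \<beta> n z) * (z - mu n - P_star q \<beta> n - A_sum' q \<beta> n z) -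
     (P q n + B_sum q \<beta> n z) * (gamma1 \<beta> * of_nat n + Q_star q \<beta> n + B_sum' q \<beta> n z)"

text \<open>The first and third conditions are needed for \<open>zorder\<close> to be meaningful.\<close>

definition double_root :: "(complex \<Rightarrow> complex) \<Rightarrow> complex \<Rightarrow> bool" where
  "double_root F z \<longleftrightarrow> F analytic_on {z} \<and> F z = 0 \<and>
     (\<exists>\<^sub>F w in at z. F w \<noteq> 0) \<and> zorder F z = 2"

end

theory Submission
  imports Defs
begin

text \<open>
  Let \<open>sn m\<close> and \<open>phi_star \<beta> m\<close> be the root functions of the adjoint of the operator with \<open>q = 0\<close>, and let
  \<open>phi \<beta> m\<close> and \<open>cs m\<close> be the system biorthogonal to them. Testing \<open>(T1 - z) y = r\<close> against the adjoint
  root functions gives an infinite linear system for the coefficients of \<open>y\<close>. Nothing is lost in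
  this passage: a continuous \<open>y\<close> with \<open>y 0 = y 1\<close> whose coefficients satisfy the system lies in the domain and
  solves the equation (\<open>T1_op_iff_weak_solution\<close>). One direction is Green's formula for functions
  whose second derivative is merely integrable (\<open>I01_by_parts_AC\<close>, by Fubini); the other is
  completeness of the biorthogonal system among continuous functions with equal end values
  (\<open>basis_complete\<close>, by the Stone-Weierstrass theorem on the circle).

  Fix a large \<open>n\<close> and let \<open>z\<close> be near \<open>mu n\<close>. Take as unknowns the numbers \<open>X\<close> obtained by
  testing \<open>q y - r\<close>, and let \<open>u\<close>, \<open>v\<close> be the two coefficients of \<open>y\<close> of index \<open>n\<close>. All other coefficients of \<open>y\<close> are
  \<open>X\<close> divided by factors \<open>z - mu m\<close>, which makes \<open>X = u f + v g - r' + K X\<close> with \<open>r'\<close> the tested \<open>r\<close>,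
  \<open>f\<close> and \<open>g\<close> the tested functions \<open>q phi n\<close> and \<open>q cs n\<close>, and \<open>K\<close> the infinite matrix with entries \<open>coef_a\<close>,
  \<open>coef_b\<close>, \<open>coef_A\<close>, \<open>coef_B\<close>. Since \<open>z - mu m\<close> is at least of size \<open>\<bar>m\<^sup>2 - n\<^sup>2\<bar>\<close>, the rows of \<open>K\<close> have sum
  \<open>O(n\<^sup>-\<^sup>1\<^sup>/\<^sup>2)\<close>, so that \<open>X\<close> is given by a Neumann series. Its terms in the rows of index \<open>n\<close> are the multiple sums
  \<open>\<alpha>\<^sub>m, \<beta>\<^sub>m, \<alpha>'\<^sub>m, \<beta>'\<^sub>m\<close> (\<open>terms_eq_iterates\<close>). The two remaining equations, those of index \<open>n\<close>, are then a
  two by two system for \<open>(u, v)\<close> whose determinant is the left side \<open>F z\<close> of the characteristic equation.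

  One off-diagonal entry of that system is close to \<open>- gamma1 \<beta> * n\<close>, hence not \<open>0\<close>, and \<open>u\<close> can be eliminated.
  What is left is one scalar equation \<open>F z * v = \<kappa> z r\<close> whose solutions \<open>v\<close> correspond one to one to
  the solutions \<open>y\<close> of \<open>(T1 - z) y = r\<close> (\<open>weak_solution_reduction\<close>, \<open>weak_solution_exists\<close>,
  \<open>weak_solution_unique\<close>). Everything follows from this equation. With \<open>r = 0\<close> it says that
  \<open>z\<close> is an eigenvalue iff \<open>F z = 0\<close>, and that eigenspaces are lines. For the algebraic
  multiplicity, start from an eigenfunction \<open>Y\<^sub>0\<close> at \<open>z\<^sub>0\<close> with \<open>v = 1\<close> and solve
  \<open>(T1 - z\<^sub>0) Y\<^sub>j = Y\<^sub>j\<^sub>-\<^sub>1\<close> with \<open>v = 0\<close> as long as possible. The function \<open>y = Y\<^sub>0 + (z - z\<^sub>0) Y\<^sub>1 + \<dots>\<close> with \<open>k\<close> summands satisfies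
  \<open>(T1 - z) y = - (z - z\<^sub>0)\<^sup>k Y\<^sub>k\<^sub>-\<^sub>1\<close> and has \<open>v = 1\<close>, so the scalar equation reads
  \<open>F z = - (z - z\<^sub>0)\<^sup>k \<kappa> z Y\<^sub>k\<^sub>-\<^sub>1\<close>, while the chain can be prolonged iff \<open>\<kappa> z\<^sub>0 Y\<^sub>k\<^sub>-\<^sub>1 = 0\<close>. So the
  order of the root is the length of the longest Jordan chain (\<open>T1_double_eigenvalue_iff\<close>).
  Finally, if \<open>z - mu n = O(n\<^sup>1\<^sup>/\<^sup>2)\<close>, the second equation of the system gives \<open>u = O(n\<^sup>-\<^sup>1\<^sup>/\<^sup>2) v\<close>; together with the
  bound on \<open>K\<close> this makes \<open>v cs n\<close> the main term of an eigenfunction, and normalization forces \<open>\<bar>v\<bar>\<close> to be close to \<open>\<surd>2\<close>.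
\<close>

section \<open>Integrals over the unit interval and partial integration\<close>

abbreviation I01 :: "(real \<Rightarrow> complex) \<Rightarrow> complex" where
  "I01 f \<equiv> (LINT x:{0..1}|lebesgue. f x)"

lemma abs_int_mult_continuous:
  fixes q g :: "real \<Rightarrow> complex"
  assumes "q absolutely_integrable_on {0..1}" "continuous_on {0..1} g"
  shows "(\<lambda>x. q x * g x) absolutely_integrable_on {0..1}"
proof -
  have "bilinear (\<lambda>a b::complex. b * a)"
    by (auto simp: bilinear_def linear_iff algebra_simps)
  moreover have "g \<in> borel_measurable (lebesgue_on {0..1})"
    using assms(2) by (intro continuous_imp_measurable_on_sets_lebesgue) auto
  moreover have "bounded (g ` {0..1})"
    using assms(2) compact_Icc compact_continuous_image compact_imp_bounded by blast
  ultimately show ?thesis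
    using absolutely_integrable_bounded_measurable_product[of "\<lambda>a b::complex. b * a" g "{0..1}" q] assms(1)
    by auto
qed

lemma abs_int_continuous:
  fixes g :: "real \<Rightarrow> complex"
  shows "continuous_on {0..1} g \<Longrightarrow> g absolutely_integrable_on {0..1}"
  by (rule absolutely_integrable_continuous_real)

lemma I01_eq_integral:
  "f absolutely_integrable_on {0..1} \<Longrightarrow> I01 f = integral {0..1} f"
  by (rule set_lebesgue_integral_eq_integral)

lemma I01_cong: "(\<And>x. x \<in> {0..1} \<Longrightarrow> f x = g x) \<Longrightarrow> I01 f = I01 g"
  by (intro set_lebesgue_integral_cong) auto

lemma I01_add:
  "f absolutely_integrable_on {0..1} \<Longrightarrow> g absolutely_integrable_on {0..1} \<Longrightarrow>
   I01 (\<lambda>x. f x + g x) = I01 f + I01 g"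
  by (rule set_integral_add)

lemma I01_diff:
  "f absolutely_integrable_on {0..1} \<Longrightarrow> g absolutely_integrable_on {0..1} \<Longrightarrow>
   I01 (\<lambda>x. f x - g x) = I01 f - I01 g"
  by (rule set_integral_diff)

lemma I01_mult: "I01 (\<lambda>x. c * f x) = c * I01 f"
  by (rule set_integral_mult_right)

lemma LINT_norm_mult_le:
  fixes q g :: "real \<Rightarrow> complex"
  assumes "q absolutely_integrable_on {0..1}" "continuous_on {0..1} g"
    and "\<And>x. x \<in> {0..1} \<Longrightarrow> norm (g x) \<le> B"
  shows "(LINT x:{0..1}|lebesgue. norm (q x * g x)) \<le> B * (LINT x:{0..1}|lebesgue. norm (q x))"
proof -
  have "(LINT x:{0..1}|lebesgue. norm (q x * g x)) \<le> (LINT x:{0..1}|lebesgue. B * norm (q x))"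
  proof (rule set_integral_mono)
    show "(\<lambda>x. norm (q x * g x)) absolutely_integrable_on {0..1}"
      by (intro set_integrable_norm abs_int_mult_continuous assms)
    show "(\<lambda>x. B * norm (q x)) absolutely_integrable_on {0..1}"
      by (intro set_integrable_mult_right set_integrable_norm assms)
    show "norm (q x * g x) \<le> B * norm (q x)" if "x \<in> {0..1}" for x
      using mult_right_mono[OF assms(3)[OF that], of "norm (q x)"] by (simp add: norm_mult mult.commute)
  qed
  then show ?thesis by simp
qed

lemma norm_I01_mult_le:
  fixes q g :: "real \<Rightarrow> complex"
  assumes "q absolutely_integrable_on {0..1}" "continuous_on {0..1} g"
    and "\<And>x. x \<in> {0..1} \<Longrightarrow> norm (g x) \<le> B"
  shows "norm (I01 (\<lambda>x. q x * g x)) \<le> B * (LINT x:{0..1}|lebesgue. norm (q x))"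
  using set_integral_norm_bound[OF abs_int_mult_continuous[OF assms(1,2)]] LINT_norm_mult_le[OF assms]
  by linarith

lemma I01_sums:
  fixes q f :: "real \<Rightarrow> complex" and e :: "nat \<Rightarrow> real \<Rightarrow> complex"
  assumes q: "q absolutely_integrable_on {0..1}"
    and e: "\<And>j. continuous_on {0..1} (e j)"
    and b: "\<And>j x. x \<in> {0..1} \<Longrightarrow> norm (e j x) \<le> b j" "summable b"
    and f: "\<And>x. x \<in> {0..1} \<Longrightarrow> f x = (\<Sum>j. e j x)"
  shows "(\<lambda>j. I01 (\<lambda>x. q x * e j x)) sums I01 (\<lambda>x. q x * f x)"
proof -
  let ?h = "\<lambda>j x. indicator {0..1} x *\<^sub>R (q x * e j x)"
  have i: "integrable lebesgue (?h j)" for j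
    using abs_int_mult_continuous[OF q e[of j]] by (simp add: set_integrable_def)
  have b0: "0 \<le> b j" for j using b(1)[of 0 j] by (meson atLeastAtMost_iff norm_ge_zero order_trans zero_le_one order_refl)
  have sm: "summable (\<lambda>j. norm (e j x))" if "x \<in> {0..1}" for x
    by (rule summable_comparison_test[OF _ b(2)]) (use b(1) that in auto)
  have AE: "AE x in lebesgue. summable (\<lambda>j. norm (?h j x))"
    by (rule AE_I2) (auto simp: indicator_def norm_mult intro!: summable_mult sm)
  have "(LINT x|lebesgue. norm (?h j x)) \<le> b j * (LINT x:{0..1}|lebesgue. norm (q x))" for j
  proof -
    have "(LINT x|lebesgue. norm (?h j x)) = (LINT x:{0..1}|lebesgue. norm (q x * e j x))"
      by (simp add: set_lebesgue_integral_def indicator_def if_distrib)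
    also have "\<dots> \<le> b j * (LINT x:{0..1}|lebesgue. norm (q x))"
      by (rule LINT_norm_mult_le) (use q e b(1) in auto)
    finally show ?thesis .
  qed
  then have S: "summable (\<lambda>j. LINT x|lebesgue. norm (?h j x))"
    by (intro summable_comparison_test[OF _ summable_mult2[OF b(2)]] exI[of _ 0]) auto
  have "(\<lambda>j. integral\<^sup>L lebesgue (?h j)) sums (\<integral>x. (\<Sum>j. ?h j x) \<partial>lebesgue)"
    by (rule sums_integral) (use i AE S in auto)
  moreover have "(\<Sum>j. ?h j x) = indicator {0..1} x *\<^sub>R (q x * f x)" for x
    using f sm[THEN summable_norm_cancel] by (auto simp: indicator_def suminf_mult)
  ultimately show ?thesis by (simp add: set_lebesgue_integral_def)
qed

lemma indefinite_integral_continuous_on: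
  fixes h g :: "real \<Rightarrow> complex"
  assumes h: "h absolutely_integrable_on {0..1}"
    and g: "\<And>x. x \<in> {0..1} \<Longrightarrow> g x = c + (LINT t:{0..x}|lebesgue. h t)"
  shows "continuous_on {0..1} g"
proof -
  have "g x = c + integral {0..x} h" if "x \<in> {0..1}" for x
  proof -
    have "h absolutely_integrable_on {0..x}"
      by (rule set_integrable_subset[OF h]) (use that in auto)
    then show ?thesis using g[OF that] set_lebesgue_integral_eq_integral(2) by metis
  qed
  moreover have "continuous_on {0..1} (\<lambda>x. c + integral {0..x} h)"
    using h by (intro continuous_intros indefinite_integral_continuous_1) (rule set_lebesgue_integral_eq_integral)
  ultimately show ?thesis by (metis (no_types, lifting) continuous_on_cong)
qed

text \<open>An indefinite integral \<open>g\<close> of \<open>h\<close> need not be differentiable at more than almost every point, so the product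
  rule is not at hand. Instead, \<open>h\<close> and \<open>p\<close> are integrated over the triangle \<open>t \<le> s\<close> in both orders.\<close>

lemma I01_by_parts_AC:
  fixes h p P :: "real \<Rightarrow> complex"
  assumes h: "h absolutely_integrable_on {0..1}" and p: "continuous_on {0..1} p"
    and P: "\<And>x. x \<in> {0..1} \<Longrightarrow> (P has_vector_derivative p x) (at x within {0..1})"
    and g: "\<And>x. x \<in> {0..1} \<Longrightarrow> g x = g 0 + (LINT t:{0..x}|lebesgue. h t)"
  shows "I01 (\<lambda>x. h x * P x) = g 1 * P 1 - g 0 * P 0 - I01 (\<lambda>x. g x * p x)"
proof -
  let ?M = "lebesgue_on {0..1::real}"
  interpret finite_measure ?M by (rule finite_measure_lebesgue_on) auto
  interpret pair_sigma_finite ?M ?M ..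
  have LI: "I01 f = integral\<^sup>L ?M f" for f
    by (simp add: set_lebesgue_integral_def integral_restrict_space)
  have hM: "integrable ?M h" using h by (simp add: set_integrable_def integrable_restrict_space)
  have pM: "integrable ?M p" using abs_int_continuous[OF p] by (simp add: set_integrable_def integrable_restrict_space)
  let ?f = "\<lambda>t s. (if t \<le> s then 1 else 0) *\<^sub>R (h t * p s)"
  have hp: "integrable (?M \<Otimes>\<^sub>M ?M) (\<lambda>(t,s). h t * p s)"
  proof (rule Fubini_integrable)
    show "(\<lambda>(t, s). h t * p s) \<in> borel_measurable (?M \<Otimes>\<^sub>M ?M)"
      using borel_measurable_integrable[OF hM] borel_measurable_integrable[OF pM] by measurable
    show "integrable ?M (\<lambda>x. \<integral>y. norm (case (x, y) of (t, s) \<Rightarrow> h t * p s) \<partial>?M)"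
      using hM by (simp add: norm_mult)
    show "AE x in ?M. integrable ?M (\<lambda>y. case (x, y) of (t, s) \<Rightarrow> h t * p s)"
      using pM by simp
  qed
  have idm: "(\<lambda>x::real. x) \<in> borel_measurable ?M"
    by (intro continuous_imp_measurable_on_sets_lebesgue continuous_intros) auto
  have int: "integrable (?M \<Otimes>\<^sub>M ?M) (case_prod ?f)"
  proof (rule Bochner_Integration.integrable_bound[OF hp])
    have "fst \<in> borel_measurable (?M \<Otimes>\<^sub>M ?M)"
      using measurable_compose[OF measurable_fst idm, of ?M] by simp
    moreover have "snd \<in> borel_measurable (?M \<Otimes>\<^sub>M ?M)"
      using measurable_compose[OF measurable_snd idm, of ?M] by simp
    ultimately have "Measurable.pred (?M \<Otimes>\<^sub>M ?M) (\<lambda>x. fst x \<le> snd x)"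
      by measurable
    then show "(case_prod ?f) \<in> borel_measurable (?M \<Otimes>\<^sub>M ?M)"
      using borel_measurable_integrable[OF hp] unfolding case_prod_beta by measurable
  qed auto
  have swap: "(\<integral>s. (\<integral>t. ?f t s \<partial>?M) \<partial>?M) = (\<integral>t. (\<integral>s. ?f t s \<partial>?M) \<partial>?M)"
    by (rule Fubini_integral[OF int])
  have left: "(\<integral>t. ?f t s \<partial>?M) = (g s - g 0) * p s" if "s \<in> {0..1}" for s
  proof -
    have "(\<integral>t. ?f t s \<partial>?M) = (\<integral>t. ((if t \<le> s then 1 else 0) *\<^sub>R h t) * p s \<partial>?M)"
      by (intro Bochner_Integration.integral_cong) auto
    also have "\<dots> = (\<integral>t. (if t \<le> s then 1 else 0) *\<^sub>R h t \<partial>?M) * p s"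
      by (rule integral_mult_left_zero)
    also have "(\<integral>t. (if t \<le> s then 1 else 0) *\<^sub>R h t \<partial>?M) = (LINT t:{0..s}|lebesgue. h t)"
      using that unfolding set_lebesgue_integral_def
      by (simp add: integral_restrict_space) (intro Bochner_Integration.integral_cong, auto simp: indicator_def)
    also have "\<dots> = g s - g 0" using g[OF that] by simp
    finally show ?thesis .
  qed
  have right: "(\<integral>s. ?f t s \<partial>?M) = h t * (P 1 - P t)" if "t \<in> {0..1}" for t
  proof -
    have "(\<integral>s. ?f t s \<partial>?M) = (\<integral>s. h t * ((if t \<le> s then 1 else 0) *\<^sub>R p s) \<partial>?M)"
      by (intro Bochner_Integration.integral_cong) auto
    also have "\<dots> = h t * (\<integral>s. (if t \<le> s then 1 else 0) *\<^sub>R p s \<partial>?M)"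
      by (rule integral_mult_right_zero)
    also have "(\<integral>s. (if t \<le> s then 1 else 0) *\<^sub>R p s \<partial>?M) = (LINT s:{t..1}|lebesgue. p s)"
      using that unfolding set_lebesgue_integral_def
      by (simp add: integral_restrict_space) (intro Bochner_Integration.integral_cong, auto simp: indicator_def)
    also have "\<dots> = integral {t..1} p"
      by (intro set_lebesgue_integral_eq_integral absolutely_integrable_continuous_real continuous_on_subset[OF p]) (use that in auto)
    also have "\<dots> = P 1 - P t"
      by (intro integral_unique fundamental_theorem_of_calculus has_vector_derivative_within_subset[OF P]) (use that in auto)
    finally show ?thesis .
  qed
  have "I01 (\<lambda>s. (g s - g 0) * p s) = (\<integral>s. (\<integral>t. ?f t s \<partial>?M) \<partial>?M)"
    unfolding LI by (rule Bochner_Integration.integral_cong) (auto simp: left)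
  also have "\<dots> = I01 (\<lambda>t. h t * (P 1 - P t))"
    unfolding LI swap by (rule Bochner_Integration.integral_cong) (auto simp: right)
  finally have swapped: "I01 (\<lambda>s. (g s - g 0) * p s) = I01 (\<lambda>t. h t * (P 1 - P t))" .
  have Pc: "continuous_on {0..1} P"
    using P by (meson continuous_on_eq_continuous_within has_vector_derivative_continuous)
  have gc: "continuous_on {0..1} g"
    by (rule indefinite_integral_continuous_on[OF h g])
  have l: "I01 (\<lambda>s. (g s - g 0) * p s) = I01 (\<lambda>s. g s * p s) - g 0 * (P 1 - P 0)"
  proof -
    have "I01 p = P 1 - P 0"
      unfolding I01_eq_integral[OF abs_int_continuous[OF p]]
      by (intro integral_unique fundamental_theorem_of_calculus P) auto
    moreover have "I01 (\<lambda>s. g s * p s - g 0 * p s) = I01 (\<lambda>s. g s * p s) - I01 (\<lambda>s. g 0 * p s)"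
      by (intro I01_diff abs_int_continuous continuous_intros gc p)
    ultimately show ?thesis by (simp only: left_diff_distrib I01_mult)
  qed
  have r: "I01 (\<lambda>t. h t * (P 1 - P t)) = (g 1 - g 0) * P 1 - I01 (\<lambda>t. h t * P t)"
  proof -
    have "I01 (\<lambda>t. h t * P 1 - h t * P t) = I01 (\<lambda>t. h t * P 1) - I01 (\<lambda>t. h t * P t)"
      by (intro I01_diff abs_int_mult_continuous h continuous_intros Pc)
    moreover have "I01 h = g 1 - g 0" using g[of 1] by simp
    ultimately show ?thesis by (simp add: algebra_simps)
  qed
  show ?thesis using swapped unfolding l r by (simp add: algebra_simps)
qed

lemma LINT_eq_integral_Icc:
  fixes p :: "real \<Rightarrow> complex"
  assumes "p absolutely_integrable_on {0..1}" "x \<in> {0..1}"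
  shows "(LINT t:{0..x}|lebesgue. p t) = integral {0..x} p"
  using assms by (intro set_lebesgue_integral_eq_integral set_integrable_subset[OF assms(1)]) auto

lemma primitive_eq_LINT:
  fixes p P :: "real \<Rightarrow> complex"
  assumes p: "continuous_on {0..1} p"
    and P: "\<And>x. x \<in> {0..1} \<Longrightarrow> (P has_vector_derivative p x) (at x within {0..1})"
    and x: "x \<in> {0..1}"
  shows "P x = P 0 + (LINT t:{0..x}|lebesgue. p t)"
proof -
  have "integral {0..x} p = P x - P 0"
    by (intro integral_unique fundamental_theorem_of_calculus has_vector_derivative_within_subset[OF P])
       (use x in auto)
  then show ?thesis using LINT_eq_integral_Icc[OF abs_int_continuous[OF p] x] by simp
qed

lemma green_formula:
  fixes y y' y'' e e' e'' :: "real \<Rightarrow> complex"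
  assumes y: "\<And>x. x \<in> {0..1} \<Longrightarrow> (y has_vector_derivative y' x) (at x within {0..1})"
    and y': "abs_cont_with_deriv y' y''"
    and e: "\<And>x. x \<in> {0..1} \<Longrightarrow> (e has_vector_derivative e' x) (at x within {0..1})"
    and e': "\<And>x. x \<in> {0..1} \<Longrightarrow> (e' has_vector_derivative e'' x) (at x within {0..1})"
    and e'': "continuous_on {0..1} e''"
  shows "I01 (\<lambda>x. y'' x * e x) = y' 1 * e 1 - y' 0 * e 0 - (y 1 * e' 1 - y 0 * e' 0) + I01 (\<lambda>x. y x * e'' x)"
proof -
  have i: "y'' absolutely_integrable_on {0..1}"
    and r: "\<And>x. x \<in> {0..1} \<Longrightarrow> y' x = y' 0 + (LINT t:{0..x}|lebesgue. y'' t)"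
    using y' unfolding abs_cont_with_deriv_def by blast+
  have c: "continuous_on {0..1} y'" by (rule indefinite_integral_continuous_on[OF i r])
  have ce': "continuous_on {0..1} e'"
    using e' by (meson continuous_on_eq_continuous_within has_vector_derivative_continuous)
  have "I01 (\<lambda>x. y'' x * e x) = y' 1 * e 1 - y' 0 * e 0 - I01 (\<lambda>x. y' x * e' x)"
    by (rule I01_by_parts_AC[OF i ce' e r])
  moreover have "I01 (\<lambda>x. y' x * e' x) = y 1 * e' 1 - y 0 * e' 0 - I01 (\<lambda>x. y x * e'' x)"
    by (rule I01_by_parts_AC[OF abs_int_continuous[OF c] e'' e' primitive_eq_LINT[OF c y]])
  ultimately show ?thesis by simp
qed

lemma I01_reflect:
  fixes f :: "real \<Rightarrow> complex"
  assumes "continuous_on {0..1} f"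
  shows "I01 (\<lambda>x. f (1 - x)) = I01 f"
proof -
  have im: "(\<lambda>x::real. 1 - x) ` {0..1} = {0..1}"
    by (auto simp: image_iff intro!: bexI[of _ "1 - x" for x])
  have "(f has_integral integral {0..1} f) (cbox 0 1)"
    using assms by (simp add: integrable_integral integrable_continuous_real)
  from has_integral_affinity[OF this, of "-1" 1]
  have "((\<lambda>x. f (1 - x)) has_integral integral {0..1} f) ((\<lambda>x. 1 - x) ` {0..1})"
    by (simp add: algebra_simps)
  then have "((\<lambda>x. f (1 - x)) has_integral integral {0..1} f) {0..1}" unfolding im .
  moreover have "continuous_on {0..1} (\<lambda>x. f (1 - x))"
    by (intro continuous_on_compose2[OF assms] continuous_intros) auto
  ultimately show ?thesis
    by (simp add: I01_eq_integral abs_int_continuous assms integral_unique)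
qed

text \<open>The parametrization of the circle maps compact sets to compact sets, so preimages of closed sets under the
  induced function are closed.\<close>

lemma circle_lift:
  fixes f :: "real \<Rightarrow> real"
  assumes f: "continuous_on {0..1} f" "f 0 = f 1"
  obtains F where "continuous_on (sphere 0 1) F" "\<And>x. x \<in> {0..1} \<Longrightarrow> F (cis (2 * pi * x)) = f x"
proof
  let ?F = "\<lambda>z. f (Arg2pi z / (2 * pi))"
  show F: "?F (cis (2 * pi * x)) = f x" if "x \<in> {0..1}" for x
  proof (cases "x = 1")
    case True
    have "Arg2pi (cis (2 * pi)) = 0" by (simp add: Arg2pi_unique[of 1 0 1])
    with True show ?thesis using f(2) by simp
  next
    case False
    have "Arg2pi (cis (2 * pi * x)) = 2 * pi * x"
      by (rule Arg2pi_unique[of 1]) (use that False in \<open>auto simp: cis_conv_exp\<close>)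
    then show ?thesis by simp
  qed
  have "closed (?F -` B \<inter> sphere 0 1)" if "closed B" for B
  proof -
    have "?F -` B \<inter> sphere 0 1 = (\<lambda>x. cis (2 * pi * x)) ` (f -` B \<inter> {0..1})"
    proof (intro equalityI subsetI)
      fix z :: complex assume z: "z \<in> ?F -` B \<inter> sphere 0 1"
      have "z = cis (2 * pi * (Arg2pi z / (2 * pi)))"
        using z Arg2pi_eq[of z] by (auto simp: cis_conv_exp mult.commute)
      moreover have "Arg2pi z / (2 * pi) \<in> f -` B \<inter> {0..1}"
        using z Arg2pi_ge_0[of z] Arg2pi_lt_2pi[of z] by auto
      ultimately show "z \<in> (\<lambda>x. cis (2 * pi * x)) ` (f -` B \<inter> {0..1})" by blast
    qed (use F in auto)
    moreover have "compact (f -` B \<inter> {0..1})"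
      using continuous_on_closed_vimage[of "{0..1}" f] f(1) that
      by (metis closed_atLeastAtMost compact_Icc compact_Int_closed inf.right_idem inf_commute)
    moreover have "continuous_on (f -` B \<inter> {0..1}) (\<lambda>x. cis (2 * pi * x))"
      by (intro continuous_intros)
    ultimately show ?thesis
      by (metis compact_imp_closed compact_continuous_image)
  qed
  then show "continuous_on (sphere 0 1) ?F"
    by (subst continuous_on_closed_vimage) auto
qed

definition exp_int :: "int \<Rightarrow> real \<Rightarrow> complex" where
  "exp_int k x = cis (2 * pi * of_int k * x)"

lemma continuous_on_exp_int [continuous_intros]: "continuous_on A (exp_int k)"
  unfolding exp_int_def[abs_def] by (intro continuous_intros)

text \<open>The vanishing of all Fourier coefficients is inherited by products with polynomials in the coordinates of
  the circle: multiplication by a coordinate only shifts the index. Quantifying over \<open>g\<close> is what lets the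
  induction pass through products of polynomials.\<close>

lemma polynomial_on_circle_orthogonal:
  assumes "real_polynomial_function (p :: complex \<Rightarrow> real)"
    and "continuous_on {0..1} g" and "\<And>k. I01 (\<lambda>x. g x * exp_int k x) = 0"
  shows "continuous_on {0..1} (\<lambda>x. g x * of_real (p (cis (2 * pi * x)))) \<and>
    I01 (\<lambda>x. g x * of_real (p (cis (2 * pi * x))) * exp_int k x) = 0"
  using assms
proof (induction arbitrary: g k)
  case (linear f)
  define a b where "a = f 1" and "b = f \<i>"
  have f: "f (cis t) = cos t * a + sin t * b" for t
  proof -
    interpret bounded_linear f by fact
    have "cis t = cos t *\<^sub>R 1 + sin t *\<^sub>R \<i>" by (simp add: complex_eq_iff)
    then show ?thesis by (simp only: add scaleR a_def b_def) simp
  qed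
  have c: "continuous_on {0..1} (\<lambda>x. g x * of_real (f (cis (2 * pi * x))))"
    unfolding f by (intro continuous_intros linear)
  \<comment> \<open>the coordinates expressed by the exponentials of index \<open>1\<close> and \<open>- 1\<close>\<close>
  let ?u = "(of_real a - \<i> * of_real b) / 2" and ?v = "(of_real a + \<i> * of_real b) / 2"
  have "complex_of_real (f (cis t)) = ?u * cis t + ?v * cis (- t)" for t
    unfolding f by (simp add: complex_eq_iff) (simp add: field_simps)
  moreover have shift: "exp_int (k + 1) x = exp_int k x * cis (2 * pi * x)"
    "exp_int (k - 1) x = exp_int k x * cis (- (2 * pi * x))" for x
    by (simp_all add: exp_int_def cis_mult ring_distribs)
  ultimately have "I01 (\<lambda>x. g x * of_real (f (cis (2 * pi * x))) * exp_int k x) =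
    I01 (\<lambda>x. ?u * (g x * exp_int (k + 1) x) + ?v * (g x * exp_int (k - 1) x))"
    by (intro I01_cong) (simp add: shift algebra_simps)
  also have "\<dots> = ?u * I01 (\<lambda>x. g x * exp_int (k + 1) x) + ?v * I01 (\<lambda>x. g x * exp_int (k - 1) x)"
    by (subst I01_add; (subst I01_mult)?) (intro abs_int_continuous continuous_intros linear | simp)+
  finally show ?case using c linear by simp
next
  case (const c)
  have "I01 (\<lambda>x. g x * of_real c * exp_int k x) = of_real c * I01 (\<lambda>x. g x * exp_int k x)"
    by (subst I01_mult[symmetric]) (simp add: algebra_simps)
  then show ?case using const by (auto intro!: continuous_intros)
next
  case (add f h)
  let ?f = "\<lambda>x. g x * of_real (f (cis (2 * pi * x)))" and ?h = "\<lambda>x. g x * of_real (h (cis (2 * pi * x)))"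
  note f = add(3)[OF add(5,6)] and h = add(4)[OF add(5,6)]
  have eq: "(\<lambda>x. g x * of_real (f (cis (2 * pi * x)) + h (cis (2 * pi * x)))) = (\<lambda>x. ?f x + ?h x)"
    by (simp add: ring_distribs)
  have cf: "continuous_on {0..1} ?f" and ch: "continuous_on {0..1} ?h" using f h by blast+
  have "I01 (\<lambda>x. ?f x * exp_int k x + ?h x * exp_int k x) =
      I01 (\<lambda>x. ?f x * exp_int k x) + I01 (\<lambda>x. ?h x * exp_int k x)"
    by (rule I01_add) (rule abs_int_continuous, rule continuous_on_mult, rule cf ch, rule continuous_on_exp_int)+
  then have "I01 (\<lambda>x. (?f x + ?h x) * exp_int k x) = 0"
    using conjunct2[OF f] conjunct2[OF h] by (simp only: ring_distribs add_0)
  then show ?case using continuous_on_add[OF cf ch] by (simp only: ring_distribs of_real_add)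
next
  case (mult f h)
  let ?g = "\<lambda>x. g x * of_real (f (cis (2 * pi * x)))"
  have "I01 (\<lambda>x. ?g x * of_real (h (cis (2 * pi * x))) * exp_int k x) = 0"
    and "continuous_on {0..1} (\<lambda>x. ?g x * of_real (h (cis (2 * pi * x))))"
    using mult(4)[OF conjunct1 conjunct2, OF mult(3) mult(3), OF mult(5,6) mult(5,6)] by blast+
  then show ?case by (simp only: mult.assoc of_real_mult)
qed

text \<open>By Stone-Weierstrass, \<open>h\<close> is orthogonal to all continuous real functions with equal end values, in
  particular to its own real and imaginary parts.\<close>

lemma exp_int_complete:
  fixes h :: "real \<Rightarrow> complex"
  assumes h: "continuous_on {0..1} h" "h 0 = h 1"
    and orth: "\<And>k. I01 (\<lambda>x. h x * exp_int k x) = 0"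
    and x: "x \<in> {0..1}"
  shows "h x = 0"
proof -
  have part: "I01 (\<lambda>x. h x * of_real (f x)) = 0"
    if f: "continuous_on {0..1} f" "f 0 = f 1" for f :: "real \<Rightarrow> real"
  proof -
    obtain F where F: "continuous_on (sphere 0 1) F" "\<And>x. x \<in> {0..1} \<Longrightarrow> F (cis (2 * pi * x)) = f x"
      using circle_lift[OF f] by blast
    let ?N = "LINT x:{0..1}|lebesgue. norm (h x)"
    have "norm (I01 (\<lambda>x. h x * of_real (f x))) \<le> e * ?N" if e: "e > 0" for e
    proof -
      obtain p where p: "real_polynomial_function p" "\<And>z. z \<in> sphere 0 1 \<Longrightarrow> \<bar>F z - p z\<bar> < e"
        using Stone_Weierstrass_real_polynomial_function[OF _ F(1) e] by auto
      let ?p = "\<lambda>x. p (cis (2 * pi * x))"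
      note po = polynomial_on_circle_orthogonal[OF p(1) h(1) orth]
      have cp: "continuous_on {0..1} (\<lambda>x. of_real (?p x) :: complex)"
      proof (rule continuous_on_of_real, rule continuous_on_compose2[of UNIV p])
        show "continuous_on UNIV p"
          using p(1) by (simp add: continuous_at_imp_continuous_on continuous_real_polymonial_function)
      qed (auto intro!: continuous_intros)
      have "I01 (\<lambda>x. h x * of_real (f x)) = I01 (\<lambda>x. h x * (of_real (f x) - of_real (?p x)) + h x * of_real (?p x) * exp_int 0 x)"
        by (intro I01_cong) (simp add: exp_int_def algebra_simps)
      also have "\<dots> = I01 (\<lambda>x. h x * (of_real (f x) - of_real (?p x)))"
        using po[of 0] by (subst I01_add) (auto intro!: abs_int_continuous continuous_intros h f cp)
      also have "norm \<dots> \<le> e * ?N"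
      proof (rule norm_I01_mult_le)
        show "cmod (of_real (f x) - of_real (?p x)) \<le> e" if "x \<in> {0..1}" for x
          using p(2)[of "cis (2 * pi * x)"] F(2)[OF that] by (simp flip: of_real_diff)
      qed (intro abs_int_continuous continuous_intros h f cp)+
      finally show ?thesis by simp
    qed
    note bound = this
    have N: "0 \<le> ?N"
      unfolding set_lebesgue_integral_def by (intro Bochner_Integration.integral_nonneg) auto
    have "norm (I01 (\<lambda>x. h x * of_real (f x))) \<le> 0"
    proof (rule field_le_epsilon)
      fix e :: real assume e: "e > 0"
      have "norm (I01 (\<lambda>x. h x * of_real (f x))) \<le> e / (?N + 1) * ?N"
        by (rule bound) (use e N in auto)
      also have "\<dots> = e * (?N / (?N + 1))" by simp
      also have "\<dots> \<le> e * 1" using e N by (intro mult_left_mono) auto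
      finally show "norm (I01 (\<lambda>x. h x * of_real (f x))) \<le> 0 + e" by simp
    qed
    then show ?thesis by simp
  qed
  have R: "I01 (\<lambda>x. h x * of_real (Re (h x))) = 0" and I: "I01 (\<lambda>x. h x * of_real (Im (h x))) = 0"
    by (rule part; use h in \<open>auto intro!: continuous_on_Re continuous_on_Im\<close>)+
  have "I01 (\<lambda>x. h x * of_real (Re (h x)) - \<i> * (h x * of_real (Im (h x)))) =
    I01 (\<lambda>x. h x * of_real (Re (h x))) - I01 (\<lambda>x. \<i> * (h x * of_real (Im (h x))))"
    by (intro I01_diff abs_int_continuous continuous_on_mult continuous_on_of_real continuous_on_Re
        continuous_on_Im continuous_on_const h)
  then have "I01 (\<lambda>x. h x * of_real (Re (h x)) - \<i> * (h x * of_real (Im (h x)))) = 0"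
    unfolding I01_mult R I by simp
  also have "(\<lambda>x. h x * of_real (Re (h x)) - \<i> * (h x * of_real (Im (h x)))) = (\<lambda>x. of_real ((norm (h x))\<^sup>2))"
    by (auto simp: fun_eq_iff complex_eq_iff cmod_def power2_eq_square algebra_simps)
  finally have z: "I01 (\<lambda>x. of_real ((norm (h x))\<^sup>2)) = 0" .
  have c: "continuous_on {0..1} (\<lambda>x. (norm (h x))\<^sup>2)"
    by (intro continuous_on_power continuous_on_norm h)
  then have c': "continuous_on {0..1} (\<lambda>x. of_real ((norm (h x))\<^sup>2) :: complex)"
    by (rule continuous_on_of_real)
  have "((\<lambda>x. of_real ((norm (h x))\<^sup>2) :: complex) has_integral 0) {0..1}"
    using z integrable_integral[OF integrable_continuous_real[OF c']] I01_eq_integral[OF abs_int_continuous[OF c']]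
    by (simp only:)
  from has_integral_Re[OF this]
  have "((\<lambda>x. (norm (h x))\<^sup>2) has_integral 0) (cbox 0 1)" by simp
  then have "(norm (h x))\<^sup>2 = 0"
    by (rule has_integral_0_cbox_imp_0[rotated 2]) (use c x in auto)
  then show ?thesis by simp
qed

section \<open>The unperturbed root functions\<close>

text \<open>Both families of root functions are indexed by a Boolean: \<open>False\<close> belongs to \<open>sn\<close> and \<open>phi\<close>, \<open>True\<close> to
  \<open>phi_star\<close> and \<open>cs\<close>. The test functions are conjugated once and for all, so that coefficients are bilinear integrals.\<close>

definition test_fun :: "complex \<Rightarrow> bool \<Rightarrow> nat \<Rightarrow> real \<Rightarrow> complex" where
  "test_fun \<beta> t m = (if t then (\<lambda>x. cnj (phi_star \<beta> m x)) else sn m)"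

definition basis_fun :: "complex \<Rightarrow> bool \<Rightarrow> nat \<Rightarrow> real \<Rightarrow> complex" where
  "basis_fun \<beta> t m = (if t then cs m else phi \<beta> m)"

abbreviation coef :: "complex \<Rightarrow> (real \<Rightarrow> complex) \<Rightarrow> bool \<Rightarrow> nat \<Rightarrow> complex" where
  "coef \<beta> f t m \<equiv> I01 (\<lambda>x. f x * test_fun \<beta> t m x)"

lemma inner01_sn: "inner01 f (sn m) = coef \<beta> f False m"
  by (simp add: inner01_def test_fun_def sn_def)

lemma inner01_phi_star: "inner01 f (phi_star \<beta> m) = coef \<beta> f True m"
  by (simp add: inner01_def test_fun_def)

definition angle :: "nat \<Rightarrow> real" where "angle m = 2 * pi * real m"

lemma mu_angle: "mu m = of_real (angle m) ^ 2"
  by (simp add: mu_def angle_def)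

lemma sn_angle: "sn m x = of_real (sin (angle m * x))" and cs_angle: "cs m x = of_real (cos (angle m * x))"
  by (simp_all add: sn_def cs_def angle_def)

lemma angle_periodic: "sin (angle m) = 0" "cos (angle m) = 1"
  by (simp_all add: angle_def sin_integer_2pi cos_integer_2pi mult.assoc)
    (metis Ints_of_nat cos_integer_2pi sin_integer_2pi mult.assoc)+

lemma trig_at_ends [simp]: "sn m 0 = 0" "sn m 1 = 0" "cs m 0 = 1" "cs m 1 = 1"
  by (simp_all add: sn_angle cs_angle angle_periodic)

lemma sn_reflect: "sn m (1 - x) = - sn m x" and cs_reflect: "cs m (1 - x) = cs m x"
  by (simp_all add: sn_angle cs_angle right_diff_distrib sin_diff cos_diff angle_periodic)

lemma sn_deriv: "(sn m has_vector_derivative of_real (angle m) * cs m x) (at x within S)"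
  unfolding sn_angle[abs_def] cs_angle
  by (rule has_vector_derivative_eq_rhs, rule has_vector_derivative_of_real)
     (auto intro!: derivative_eq_intros)

lemma cs_deriv: "(cs m has_vector_derivative - of_real (angle m) * sn m x) (at x within S)"
  unfolding cs_angle[abs_def] sn_angle
  by (rule has_vector_derivative_eq_rhs, rule has_vector_derivative_of_real)
     (auto intro!: derivative_eq_intros)

lemma continuous_sn_cs: "continuous_on A (sn m)" "continuous_on A (cs m)"
  unfolding sn_def[abs_def] cs_def[abs_def] by (intro continuous_intros)+

definition psi_factor :: "complex \<Rightarrow> nat \<Rightarrow> complex" where
  "psi_factor \<beta> m = (if m = 0 then 2 else 4) * (\<beta> + 1) / (\<beta> - 1)"

lemma test_fun_True: "test_fun \<beta> True m x = psi_factor \<beta> m * (of_real x - 1 / (1 + \<beta>)) * cs m x"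
  by (simp add: test_fun_def phi_star_def psi_factor_def cs_def)

lemma basis_fun_False: "basis_fun \<beta> False m x = 4 * (\<beta> + 1) / (\<beta> - 1) * (\<beta> / (1 + \<beta>) - of_real x) * sn m x"
  by (simp add: basis_fun_def phi_def)

lemma test_fun_False: "test_fun \<beta> False m = sn m" by (simp add: test_fun_def)
lemma basis_fun_True: "basis_fun \<beta> True m = cs m" by (simp add: basis_fun_def)

lemma continuous_test_fun: "continuous_on A (test_fun \<beta> t m)"
proof (cases t)
  case True
  have "continuous_on A (test_fun \<beta> True m)"
    unfolding test_fun_True[abs_def] by (intro continuous_intros continuous_sn_cs)
  with True show ?thesis by simp
qed (simp add: test_fun_False continuous_sn_cs)

lemma continuous_basis_fun: "continuous_on A (basis_fun \<beta> t m)"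
proof (cases t)
  case False
  have "continuous_on A (basis_fun \<beta> False m)"
    unfolding basis_fun_False[abs_def] by (intro continuous_intros continuous_sn_cs)
  with False show ?thesis by simp
qed (simp add: basis_fun_True continuous_sn_cs)

lemma norm_sn_cs_le: "norm (sn m x) \<le> 1" "norm (cs m x) \<le> 1"
  by (simp_all add: sn_def cs_def)

text \<open>A common bound for all test and basis functions; the summand \<open>1\<close> covers \<open>sn\<close> and \<open>cs\<close>.\<close>

definition fun_bound :: "complex \<Rightarrow> real" where
  "fun_bound \<beta> = 1 + norm (4 * (\<beta> + 1) / (\<beta> - 1)) * (1 + norm (\<beta> / (1 + \<beta>)) + norm (1 / (1 + \<beta>)))"

lemma fun_bound_ge_1: "1 \<le> fun_bound \<beta>"
  by (simp add: fun_bound_def)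

lemma norm_test_basis_le:
  assumes "x \<in> {0..1}"
  shows "norm (test_fun \<beta> t m x) \<le> fun_bound \<beta>" "norm (basis_fun \<beta> t m x) \<le> fun_bound \<beta>"
proof -
  let ?k = "norm (4 * (\<beta> + 1) / (\<beta> - 1))"
  have x: "norm (of_real x :: complex) \<le> 1" using assms by simp
  have k: "norm (psi_factor \<beta> m) \<le> ?k"
    unfolding psi_factor_def norm_divide norm_mult
    by (intro divide_right_mono mult_right_mono) auto
  have "norm (psi_factor \<beta> m * (of_real x - 1 / (1 + \<beta>)) * cs m x) \<le> ?k * (1 + norm (1 / (1 + \<beta>))) * 1"
    unfolding norm_mult by (intro mult_mono k norm_sn_cs_le order_trans[OF norm_triangle_ineq4] add_mono x) auto
  moreover have "norm (4 * (\<beta> + 1) / (\<beta> - 1) * (\<beta> / (1 + \<beta>) - of_real x) * sn m x) \<le> ?k * (norm (\<beta> / (1 + \<beta>)) + 1) * 1"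
    unfolding norm_mult[of _ "sn m x"] norm_mult[of _ "_ - _"]
    by (intro mult_mono norm_sn_cs_le order_trans[OF norm_triangle_ineq4] add_mono x) auto
  moreover have "?k * (1 + norm (1 / (1 + \<beta>))) \<le> fun_bound \<beta>" "?k * (norm (\<beta> / (1 + \<beta>)) + 1) \<le> fun_bound \<beta>"
  proof -
    have "0 \<le> ?k * norm (1 / (1 + \<beta>))" "0 \<le> ?k * norm (\<beta> / (1 + \<beta>))" by simp_all
    then show "?k * (1 + norm (1 / (1 + \<beta>))) \<le> fun_bound \<beta>" "?k * (norm (\<beta> / (1 + \<beta>)) + 1) \<le> fun_bound \<beta>"
      unfolding fun_bound_def ring_distribs by linarith+
  qed
  ultimately show "norm (test_fun \<beta> t m x) \<le> fun_bound \<beta>" "norm (basis_fun \<beta> t m x) \<le> fun_bound \<beta>"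
    using norm_sn_cs_le[of m x] fun_bound_ge_1[of \<beta>]
    by (cases t; simp add: test_fun_True test_fun_False basis_fun_True basis_fun_False; linarith)+
qed

lemma of_real_minus_const_deriv: "((\<lambda>x. of_real x - c :: complex) has_vector_derivative 1) (at x within S)"
proof -
  have "((\<lambda>x. of_real x :: complex) has_vector_derivative of_real 1) (at x within S)"
    by (rule has_vector_derivative_of_real) (auto intro!: derivative_eq_intros)
  from has_vector_derivative_diff[OF this has_vector_derivative_const[of c]] show ?thesis by simp
qed

text \<open>Only the boundary condition on the derivative is assumed, so a multiple of \<open>y 1 - y 0\<close> survives;
  \<open>T1_opI_coef_eqs\<close> uses it to recover \<open>y 0 = y 1\<close>. The term with \<open>gamma1\<close> is there because \<open>phi_star\<close>
  is an associated function and not an eigenfunction of the adjoint.\<close>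

lemma green_trig:
  assumes y: "\<And>x. x \<in> {0..1} \<Longrightarrow> (y has_vector_derivative y' x) (at x within {0..1})"
    and y': "abs_cont_with_deriv y' y''"
    and \<beta>: "\<beta> \<noteq> 1" "\<beta> \<noteq> -1"
    and bc: "y' 0 + \<beta> * y' 1 = 0"
  shows "I01 (\<lambda>x. - y'' x * test_fun \<beta> False m x) = of_real (angle m) * (y 1 - y 0) + mu m * coef \<beta> y False m"
    and "I01 (\<lambda>x. - y'' x * test_fun \<beta> True m x) = psi_factor \<beta> m * (y 1 - y 0) + mu m * coef \<beta> y True m
           + gamma1 \<beta> * of_nat m * coef \<beta> y False m"
proof -
  let ?w = "of_real (angle m) :: complex" and ?K = "psi_factor \<beta> m" and ?c = "1 / (1 + \<beta>)"
  have \<beta>1: "1 + \<beta> \<noteq> 0" using \<beta>(2) by (simp add: add_eq_0_iff)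
  have yc: "continuous_on {0..1} y"
    using y by (meson continuous_on_eq_continuous_within has_vector_derivative_continuous)
  have m: "I01 (\<lambda>x. - f x) = - I01 f" for f :: "real \<Rightarrow> complex"
    using I01_mult[of "-1" f] by simp
  have "I01 (\<lambda>x. y'' x * sn m x) = y' 1 * sn m 1 - y' 0 * sn m 0 - (y 1 * (?w * cs m 1) - y 0 * (?w * cs m 0))
      + I01 (\<lambda>x. y x * (- (?w ^ 2) * sn m x))"
    by (rule green_formula[OF y y' sn_deriv])
       (auto intro!: continuous_intros continuous_sn_cs has_vector_derivative_eq_rhs[OF has_vector_derivative_mult_right[OF cs_deriv]]
          simp: power2_eq_square)
  moreover have "I01 (\<lambda>x. y x * (- (?w ^ 2) * sn m x)) = - (?w ^ 2) * I01 (\<lambda>x. y x * sn m x)"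
    by (subst I01_mult[symmetric]) (simp add: algebra_simps)
  ultimately show "I01 (\<lambda>x. - y'' x * test_fun \<beta> False m x) = ?w * (y 1 - y 0) + mu m * coef \<beta> y False m"
    by (simp add: test_fun_False m mu_angle algebra_simps)
  let ?e = "\<lambda>x. ?K * (of_real x - ?c) * cs m x"
  let ?e' = "\<lambda>x. ?K * (cs m x - (of_real x - ?c) * ?w * sn m x)"
  let ?e'' = "\<lambda>x. - (2 * ?w * ?K * sn m x + ?w ^ 2 * ?e x)"
  have dx: "((\<lambda>x. of_real x - ?c) has_vector_derivative 1) (at x within {0..1})" for x
    by (rule of_real_minus_const_deriv)
  have e: "(?e has_vector_derivative ?e' x) (at x within {0..1})" for x
    by (rule has_vector_derivative_eq_rhs[OF has_vector_derivative_mult[OF has_vector_derivative_mult_right[OF dx] cs_deriv]])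
       (simp add: algebra_simps)
  have e': "(?e' has_vector_derivative ?e'' x) (at x within {0..1})" for x
    by (rule has_vector_derivative_eq_rhs[OF has_vector_derivative_mult_right[OF has_vector_derivative_diff[OF cs_deriv
          has_vector_derivative_mult[OF has_vector_derivative_mult_left[OF dx] sn_deriv]]]])
       (simp add: algebra_simps power2_eq_square)
  have f1: "I01 (\<lambda>x. y'' x * ?e x) = y' 1 * ?e 1 - y' 0 * ?e 0 - (y 1 * ?e' 1 - y 0 * ?e' 0) + I01 (\<lambda>x. y x * ?e'' x)"
    by (rule green_formula[OF y y' e e'], assumption) (intro continuous_intros continuous_sn_cs)
  have f2: "y' 1 * ?e 1 - y' 0 * ?e 0 = ?K * ((y' 0 + \<beta> * y' 1) * ?c)"
  proof -
    have "1 - ?c = \<beta> * ?c" using \<beta>1 by (simp add: field_simps)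
    then have "y' 1 * (?K * (of_real 1 - ?c) * cs m 1) = ?K * (\<beta> * y' 1 * ?c)" by simp
    then show ?thesis by (simp add: algebra_simps)
  qed
  have f3: "y 1 * ?e' 1 - y 0 * ?e' 0 = ?K * (y 1 - y 0)" by (simp add: algebra_simps)
  have f5: "2 * ?w * ?K = gamma1 \<beta> * of_nat m"
    by (simp add: psi_factor_def gamma1_def angle_def)
  have f4: "I01 (\<lambda>x. y x * ?e'' x) = - (2 * ?w * ?K * I01 (\<lambda>x. y x * sn m x) + ?w ^ 2 * I01 (\<lambda>x. y x * ?e x))"
  proof -
    have "I01 (\<lambda>x. y x * ?e'' x) = I01 (\<lambda>x. - (2 * ?w * ?K) * (y x * sn m x) + (- (?w ^ 2)) * (y x * ?e x))"
      by (intro I01_cong) (simp add: algebra_simps)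
    also have "\<dots> = I01 (\<lambda>x. - (2 * ?w * ?K) * (y x * sn m x)) + I01 (\<lambda>x. (- (?w ^ 2)) * (y x * ?e x))"
      by (intro I01_add abs_int_continuous continuous_intros yc continuous_sn_cs)
    finally show ?thesis unfolding I01_mult by simp
  qed
  have "I01 (\<lambda>x. y'' x * ?e x) = - (?K * (y 1 - y 0)) - gamma1 \<beta> * of_nat m * I01 (\<lambda>x. y x * sn m x) - (?w ^ 2) * I01 (\<lambda>x. y x * ?e x)"
    unfolding f1 f2 f3 f4 unfolding f5 bc by simp
  then show "I01 (\<lambda>x. - y'' x * test_fun \<beta> True m x) = ?K * (y 1 - y 0) + mu m * coef \<beta> y True m
           + gamma1 \<beta> * of_nat m * coef \<beta> y False m"
    by (simp add: test_fun_False test_fun_True m mu_angle)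
qed

text \<open>Orthogonality to the sines makes \<open>h\<close> symmetric about \<open>1/2\<close>. For symmetric \<open>h\<close> the linear factor of
  \<open>phi_star\<close> may be replaced by its mean over reflected points, the constant \<open>1/2 - 1/(1 + \<beta>)\<close>; as \<open>\<beta> \<noteq> 1\<close>
  it is not zero, and \<open>h\<close> is orthogonal to the cosines as well.\<close>

lemma basis_complete:
  fixes h :: "real \<Rightarrow> complex"
  assumes \<beta>: "\<beta> \<noteq> 1" "\<beta> \<noteq> -1"
    and h: "continuous_on {0..1} h" "h 0 = h 1"
    and orth: "\<And>t m. coef \<beta> h t m = 0"
    and x: "x \<in> {0..1}"
  shows "h x = 0"
proof -
  have \<beta>1: "1 + \<beta> \<noteq> 0" using \<beta>(2) by (simp add: add_eq_0_iff)
  have trig: "g x = 0" if g: "continuous_on {0..1} g" "g 0 = g 1"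
    "\<And>m. I01 (\<lambda>x. g x * sn m x) = 0" "\<And>m. I01 (\<lambda>x. g x * cs m x) = 0" "x \<in> {0..1}" for g x
  proof (rule exp_int_complete[OF g(1,2) _ g(5)])
    fix k :: int
    let ?m = "nat \<bar>k\<bar>"
    have "exp_int k x = cs ?m x + (of_int (sgn k) * \<i>) * sn ?m x" for x
      by (cases k rule: int_cases3) (auto simp: exp_int_def cs_def sn_def complex_eq_iff nat_minus_as_int)
    then have "I01 (\<lambda>x. g x * exp_int k x) = I01 (\<lambda>x. g x * cs ?m x + (of_int (sgn k) * \<i>) * (g x * sn ?m x))"
      by (simp add: algebra_simps)
    also have "\<dots> = I01 (\<lambda>x. g x * cs ?m x) + I01 (\<lambda>x. (of_int (sgn k) * \<i>) * (g x * sn ?m x))"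
      by (intro I01_add abs_int_continuous continuous_intros continuous_sn_cs g)
    finally show "I01 (\<lambda>x. g x * exp_int k x) = 0" unfolding I01_mult using g(3,4) by simp
  qed
  have hr: "continuous_on {0..1} (\<lambda>x. h (1 - x))"
    by (intro continuous_on_compose2[OF h(1)] continuous_intros) auto
  have sn0: "I01 (\<lambda>x. h x * sn m x) = 0" for m using orth[of False m] by (simp add: test_fun_False)
  have refl: "I01 (\<lambda>x. h (1 - x) * f (1 - x)) = I01 (\<lambda>x. h x * f x)" if "continuous_on {0..1} f" for f
    by (rule I01_reflect[of "\<lambda>x. h x * f x"]) (intro continuous_intros h that)
  have even: "h (1 - x) = h x" if "x \<in> {0..1}" for x
  proof -
    have "h x - h (1 - x) = 0"
    proof (rule trig[OF _ _ _ _ that])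
      fix m
      have "I01 (\<lambda>x. h (1 - x) * sn m x) = - I01 (\<lambda>x. h x * sn m x)"
        using refl[OF continuous_sn_cs(1), of m] I01_mult[of "-1" "\<lambda>x. h (1 - x) * sn m x"] by (simp add: sn_reflect)
      moreover have "I01 (\<lambda>x. h x * sn m x - h (1 - x) * sn m x) = I01 (\<lambda>x. h x * sn m x) - I01 (\<lambda>x. h (1 - x) * sn m x)"
        by (intro I01_diff abs_int_continuous continuous_intros continuous_sn_cs h hr)
      ultimately show "I01 (\<lambda>x. (h x - h (1 - x)) * sn m x) = 0" using sn0 by (simp add: algebra_simps)
      have "I01 (\<lambda>x. h (1 - x) * cs m x) = I01 (\<lambda>x. h x * cs m x)"
        using refl[OF continuous_sn_cs(2), of m] by (simp add: cs_reflect)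
      moreover have "I01 (\<lambda>x. h x * cs m x - h (1 - x) * cs m x) = I01 (\<lambda>x. h x * cs m x) - I01 (\<lambda>x. h (1 - x) * cs m x)"
        by (intro I01_diff abs_int_continuous continuous_intros continuous_sn_cs h hr)
      ultimately show "I01 (\<lambda>x. (h x - h (1 - x)) * cs m x) = 0" by (simp add: algebra_simps)
    qed (use h hr in \<open>auto intro!: continuous_intros\<close>)
    then show ?thesis by simp
  qed
  have cs0: "I01 (\<lambda>x. h x * cs m x) = 0" for m
  proof -
    let ?K = "psi_factor \<beta> m" and ?c = "1 / (1 + \<beta>)"
    let ?e = "\<lambda>x. ?K * (of_real x - ?c) * cs m x" and ?r = "\<lambda>x. ?K * (of_real (1 - x) - ?c) * cs m x"
    have e0: "I01 (\<lambda>x. h x * ?e x) = 0" using orth[of True m] by (simp add: test_fun_True)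
    have "I01 (\<lambda>x. h x * ?r x) = I01 (\<lambda>x. h (1 - x) * ?e (1 - x))"
      by (intro I01_cong) (simp add: even cs_reflect)
    also have "\<dots> = I01 (\<lambda>x. h x * ?e x)"
      by (rule refl) (intro continuous_intros continuous_sn_cs)
    finally have r0: "I01 (\<lambda>x. h x * ?r x) = 0" using e0 by simp
    have "I01 (\<lambda>x. h x * ?e x + h x * ?r x) = I01 (\<lambda>x. h x * ?e x) + I01 (\<lambda>x. h x * ?r x)"
      by (intro I01_add abs_int_continuous continuous_intros continuous_sn_cs h)
    then have "I01 (\<lambda>x. h x * ?e x + h x * ?r x) = 0" using e0 r0 by simp
    moreover have "(\<lambda>x. h x * ?e x + h x * ?r x) = (\<lambda>x. (?K * (1 - 2 * ?c)) * (h x * cs m x))"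
      by (simp add: fun_eq_iff algebra_simps)
    ultimately have "?K * (1 - 2 * ?c) * I01 (\<lambda>x. h x * cs m x) = 0"
      using I01_mult by metis
    moreover have "?K \<noteq> 0" using \<beta> \<beta>1 by (simp add: psi_factor_def add.commute)
    moreover have "1 - 2 * ?c \<noteq> 0"
    proof
      assume "1 - 2 * ?c = 0"
      then have "1 + \<beta> = 2" using \<beta>1 by (simp add: field_simps)
      then show False using \<beta>(1) by (simp add: algebra_simps)
    qed
    ultimately show ?thesis by (metis mult_eq_0_iff)
  qed
  show ?thesis by (rule trig[OF h sn0 cs0 x])
qed

lemma basis_fun_ends: "basis_fun \<beta> s i 0 = basis_fun \<beta> s i 1"
  by (cases s) (simp_all add: basis_fun_True basis_fun_False)

text \<open>Green's formula applied to the basis functions themselves; for \<open>i \<noteq> j\<close> these relations already force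
  biorthogonality.\<close>

lemma basis_coef_eqs:
  assumes \<beta>: "\<beta> \<noteq> 1" "\<beta> \<noteq> -1"
  defines "c \<equiv> \<lambda>s i. coef \<beta> (basis_fun \<beta> s i)"
  shows "mu i * c True i False j = mu j * c True i False j"
    and "mu i * c True i True j = mu j * c True i True j + gamma1 \<beta> * of_nat j * c True i False j"
    and "mu i * c False i False j + gamma1 \<beta> * of_nat i * c True i False j = mu j * c False i False j"
    and "mu i * c False i True j + gamma1 \<beta> * of_nat i * c True i True j =
      mu j * c False i True j + gamma1 \<beta> * of_nat j * c False i False j"
proof -
  define K where "K = 4 * (\<beta> + 1) / (\<beta> - 1)"
  define b where "b = \<beta> / (1 + \<beta>)"
  let ?w = "of_real (angle i) :: complex"
  have \<beta>1: "1 + \<beta> \<noteq> 0" using \<beta>(2) by (simp add: add_eq_0_iff)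
  have K: "?w * K * 2 = gamma1 \<beta> * of_nat i"
    by (simp add: gamma1_def angle_def K_def)
  have AC: "abs_cont_with_deriv y' y''"
    if "continuous_on {0..1} y''" "\<And>x. x \<in> {0..1} \<Longrightarrow> (y' has_vector_derivative y'' x) (at x within {0..1})" for y' y''
    unfolding abs_cont_with_deriv_def using primitive_eq_LINT[OF that] abs_int_continuous[OF that(1)] by blast
  have cyc: "continuous_on {0..1} (\<lambda>x. - (?w ^ 2 * cs i x))"
    by (intro continuous_intros continuous_sn_cs)
  have cd: "((\<lambda>x. - ?w * sn i x) has_vector_derivative - (?w ^ 2 * cs i x)) (at x within {0..1})" for x
    by (rule has_vector_derivative_eq_rhs[OF has_vector_derivative_mult_right[OF sn_deriv]])
       (simp add: power2_eq_square)
  note cs = green_trig[OF cs_deriv AC[OF cyc cd] \<beta>, simplified]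
  have "I01 (\<lambda>x. ?w ^ 2 * cs i x * test_fun \<beta> t j x) = mu i * coef \<beta> (cs i) t j" for t
    unfolding mu_angle mult.assoc I01_mult ..
  note this[of False] this[of True] cs(1)[of j] cs(2)[of j]
  then show "mu i * c True i False j = mu j * c True i False j"
    "mu i * c True i True j = mu j * c True i True j + gamma1 \<beta> * of_nat j * c True i False j"
    unfolding c_def basis_fun_True by (simp_all only:)
  let ?y = "\<lambda>x. - K * (of_real x - b) * sn i x"
  let ?y' = "\<lambda>x. - K * (sn i x + (of_real x - b) * ?w * cs i x)"
  let ?y'' = "\<lambda>x. - (?w * K * 2 * cs i x + ?w ^ 2 * ?y x)"
  have y: "(?y has_vector_derivative ?y' x) (at x within {0..1})" for x
    by (rule has_vector_derivative_eq_rhs[OF has_vector_derivative_mult[OF has_vector_derivative_mult_right[OF of_real_minus_const_deriv] sn_deriv]])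
       (simp add: algebra_simps)
  have y': "(?y' has_vector_derivative ?y'' x) (at x within {0..1})" for x
    by (rule has_vector_derivative_eq_rhs[OF has_vector_derivative_mult_right[OF has_vector_derivative_add[OF sn_deriv
          has_vector_derivative_mult[OF has_vector_derivative_mult_left[OF of_real_minus_const_deriv] cs_deriv]]]])
       (simp add: algebra_simps power2_eq_square)
  have y'': "continuous_on {0..1} ?y''"
    by (intro continuous_intros continuous_sn_cs)
  have bc: "?y' 0 + \<beta> * ?y' 1 = 0"
  proof -
    have "?y' 0 + \<beta> * ?y' 1 = - K * ?w * (\<beta> - (1 + \<beta>) * b)" by (simp add: algebra_simps)
    then show ?thesis using \<beta>1 by (simp add: b_def)
  qed
  have yb: "?y x = basis_fun \<beta> False i x" for x by (unfold basis_fun_False, fold K_def b_def) (simp add: algebra_simps)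
  note ph = green_trig[OF y AC[OF y'' y'] \<beta> bc, of j]
  have "I01 (\<lambda>x. - ?y'' x * test_fun \<beta> t j x) = mu i * c False i t j + gamma1 \<beta> * of_nat i * c True i t j" for t
  proof -
    have "I01 (\<lambda>x. - ?y'' x * test_fun \<beta> t j x) = I01 (\<lambda>x. (?w * K * 2) * (cs i x * test_fun \<beta> t j x) + ?w ^ 2 * (?y x * test_fun \<beta> t j x))"
      by (intro I01_cong) (simp only: minus_minus distrib_right mult.assoc)
    also have "\<dots> = I01 (\<lambda>x. (?w * K * 2) * (cs i x * test_fun \<beta> t j x)) + I01 (\<lambda>x. ?w ^ 2 * (?y x * test_fun \<beta> t j x))"
      by (intro I01_add abs_int_continuous continuous_intros continuous_sn_cs continuous_test_fun)
    also have "\<dots> = gamma1 \<beta> * of_nat i * c True i t j + mu i * c False i t j"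
      unfolding I01_mult K mu_angle c_def yb basis_fun_True ..
    finally show ?thesis by (simp only: add.commute)
  qed
  note this[of False] this[of True]
  moreover have "?y 1 - ?y 0 = 0" by simp
  ultimately show "mu i * c False i False j + gamma1 \<beta> * of_nat i * c True i False j = mu j * c False i False j"
    "mu i * c False i True j + gamma1 \<beta> * of_nat i * c True i True j =
      mu j * c False i True j + gamma1 \<beta> * of_nat j * c False i False j"
    using ph unfolding yb c_def by (simp_all only: mult_zero_right add_0)
qed

lemma mu_inj: "mu i = mu j \<longleftrightarrow> i = j"
  by (simp add: mu_def del: of_real_power of_real_mult)

lemma gamma1_nonzero: "\<beta> \<noteq> 1 \<Longrightarrow> \<beta> \<noteq> -1 \<Longrightarrow> gamma1 \<beta> \<noteq> 0"
  by (simp add: gamma1_def add_eq_0_iff2)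

text \<open>Off the diagonal this follows from \<open>basis_coef_eqs\<close>, since \<open>mu i \<noteq> mu j\<close>. On the diagonal, these relations are
  supplemented by the reflection \<open>x \<mapsto> 1 - x\<close>, which changes the sign of the integrand or replaces its
  linear factor by a constant. The condition
  \<open>s \<or> i \<noteq> 0\<close> accounts for \<open>phi \<beta> 0 = sn 0 = 0\<close>.\<close>

lemma basis_biorthogonal:
  assumes \<beta>: "\<beta> \<noteq> 1" "\<beta> \<noteq> -1"
  shows "coef \<beta> (basis_fun \<beta> s i) t j = (if s = t \<and> i = j \<and> (s \<or> i \<noteq> 0) then 1 else 0)"
proof -
  have \<beta>1: "1 + \<beta> \<noteq> 0" using \<beta>(2) by (simp add: add_eq_0_iff)
  define c where "c = (\<lambda>s i. coef \<beta> (basis_fun \<beta> s i))"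
  have E: "mu i * c True i False j = mu j * c True i False j"
    "mu i * c True i True j = mu j * c True i True j + gamma1 \<beta> * of_nat j * c True i False j"
    "mu i * c False i False j + gamma1 \<beta> * of_nat i * c True i False j = mu j * c False i False j"
    "mu i * c False i True j + gamma1 \<beta> * of_nat i * c True i True j =
      mu j * c False i True j + gamma1 \<beta> * of_nat j * c False i False j" for i j
    using basis_coef_eqs[OF \<beta>] unfolding c_def by blast+
  have c: "1 - 1 / (1 + \<beta>) = \<beta> / (1 + \<beta>)" using \<beta>1 by (simp add: field_simps)
  show ?thesis
  proof (cases "i = j")
    case False
    then have m: "mu i \<noteq> mu j" by (simp add: mu_inj)
    have "c True i False j = 0" using E(1)[of i j] m by simp
    moreover from this have "c True i True j = 0" using E(2)[of i j] m by simp
    moreover from calculation have "c False i False j = 0" using E(3)[of i j] m by simp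
    moreover from calculation have "c False i True j = 0" using E(4)[of i j] m by simp
    ultimately have "c s i t j = 0" by (cases s; cases t) auto
    then show ?thesis using False by (simp add: c_def)
  next
    case True
    have FT0: "c False i True i = 0"
    proof -
      let ?f = "\<lambda>x. basis_fun \<beta> False i x * test_fun \<beta> True i x"
      define d where "d = 1 / (1 + \<beta>)"
      have "?f (1 - x) = - ?f x" for x
        unfolding basis_fun_False test_fun_True sn_reflect cs_reflect c[symmetric] d_def[symmetric] by simp
      then have "I01 ?f = I01 (\<lambda>x. -1 * ?f x)"
        using I01_reflect[of ?f] continuous_on_mult[OF continuous_basis_fun continuous_test_fun] by simp
      then have "I01 ?f = - I01 ?f" unfolding I01_mult by simp
      then show ?thesis by (simp add: c_def)
    qed
    have TF0: "c True i False i = 0"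
    proof (cases "i = 0")
      case True
      then have "c True i False i = I01 (\<lambda>x. 0 * 0)"
        unfolding c_def test_fun_False by (intro I01_cong) (simp add: sn_def)
      then show ?thesis by simp
    qed (use E(2)[of i i] gamma1_nonzero[OF \<beta>] in auto)
    have FF1: "c False i False i = 1" if i: "i \<noteq> 0"
    proof -
      define K where "K = 4 * (\<beta> + 1) / (\<beta> - 1)"
      define b where "b = \<beta> / (1 + \<beta>)"
      let ?f = "\<lambda>x. basis_fun \<beta> False i x * sn i x"
      have cf: "continuous_on {0..1} ?f" by (intro continuous_on_mult continuous_basis_fun continuous_sn_cs)
      have cr: "continuous_on {0..1} (\<lambda>x. ?f (1 - x))" by (intro continuous_on_compose2[OF cf] continuous_intros) auto
      have "2 * b - 1 = (\<beta> - 1) / (1 + \<beta>)" using \<beta>1 by (simp add: b_def field_simps)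
      then have Kb: "K * (2 * b - 1) = 4" using \<beta> \<beta>1 by (simp add: K_def add.commute divide_eq_eq)
      have "?f x + ?f (1 - x) = 2 + (-2) * cs (2 * i) x" for x
      proof -
        have "cs (2 * i) x = 1 - 2 * (sn i x)\<^sup>2"
          using cos_double_sin[of "2 * pi * real i * x"]
          by (simp add: cs_def sn_def mult.assoc mult.left_commute flip: of_real_power)
        then have sq: "(sn i x)\<^sup>2 = (1 - cs (2 * i) x) / 2" by simp
        have "?f x + ?f (1 - x) = K * (2 * b - 1) * (sn i x)\<^sup>2"
          unfolding basis_fun_False sn_reflect K_def[symmetric] b_def[symmetric]
          by (simp add: algebra_simps power2_eq_square)
        also have "\<dots> = 2 + (-2) * cs (2 * i) x" unfolding Kb sq by simp
        finally show ?thesis .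
      qed
      then have "I01 (\<lambda>x. ?f x + ?f (1 - x)) = I01 (\<lambda>x. 2 + (-2) * cs (2 * i) x)" by simp
      moreover have "I01 (\<lambda>x. ?f x + ?f (1 - x)) = I01 ?f + I01 ?f"
        using I01_add[OF abs_int_continuous[OF cf] abs_int_continuous[OF cr]] I01_reflect[OF cf] by simp
      moreover have "I01 (\<lambda>x. 2 + (-2) * cs (2 * i) x) = I01 (\<lambda>x. 2) + I01 (\<lambda>x. (-2) * cs (2 * i) x)"
        by (intro I01_add abs_int_continuous continuous_intros continuous_sn_cs)
      moreover have "I01 (cs (2 * i)) = 0"
        using I01_eq_integral[OF abs_int_continuous[OF continuous_sn_cs(2)]]
          primitive_eq_LINT[OF continuous_on_mult[OF continuous_on_const continuous_sn_cs(2)] sn_deriv, of 1 "2 * i"] i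
        by (simp add: angle_def)
      moreover have "I01 (\<lambda>x. 2) = 2" by (subst I01_eq_integral) (auto intro!: abs_int_continuous)
      ultimately have "I01 ?f = 1" unfolding I01_mult by simp
      then show ?thesis by (simp add: c_def test_fun_False)
    qed
    have TT1: "c True i True i = 1"
    proof (cases "i = 0")
      case False
      then show ?thesis using E(4)[of i i] FF1 gamma1_nonzero[OF \<beta>] by simp
    next
      case True
      define K where "K = 2 * (\<beta> + 1) / (\<beta> - 1)"
      define d where "d = 1 / (1 + \<beta>)"
      let ?f = "\<lambda>x::real. K * (of_real x - d)"
      have cf: "continuous_on {0..1} ?f" by (intro continuous_intros)
      have cr: "continuous_on {0..1} (\<lambda>x. ?f (1 - x))" by (intro continuous_intros)
      have "(\<lambda>x. ?f x + ?f (1 - x)) = (\<lambda>x. K * (1 - 2 * d))" by (simp add: fun_eq_iff algebra_simps)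
      also have "K * (1 - 2 * d) = 2"
      proof -
        have "1 - 2 * d = (\<beta> - 1) / (1 + \<beta>)" using \<beta>1 by (simp add: d_def field_simps)
        then show ?thesis using \<beta> \<beta>1 by (simp add: K_def add.commute divide_eq_eq)
      qed
      finally have "I01 (\<lambda>x. ?f x + ?f (1 - x)) = I01 (\<lambda>x. 2)" by (simp only:)
      then have "I01 ?f + I01 ?f = I01 (\<lambda>x. 2)"
        unfolding I01_add[OF abs_int_continuous[OF cf] abs_int_continuous[OF cr]] I01_reflect[OF cf] .
      moreover have "I01 (\<lambda>x. 2) = 2" by (subst I01_eq_integral) (auto intro!: abs_int_continuous)
      ultimately have "I01 ?f = 1" by simp
      moreover have "c True i True i = I01 ?f"
        unfolding c_def basis_fun_True test_fun_True using True
        by (intro I01_cong) (simp add: cs_def psi_factor_def K_def d_def)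
      ultimately show ?thesis by simp
    qed
    have FF0: "c False 0 False 0 = 0"
      by (simp add: c_def test_fun_False sn_def)
    have "c s i t i = (if s = t \<and> (s \<or> i \<noteq> 0) then 1 else 0)"
      using FT0 TF0 FF1 TT1 FF0 by (cases s; cases t; cases "i = 0") auto
    then show ?thesis using True by (simp add: c_def)
  qed
qed

section \<open>The equation in terms of coefficients\<close>

lemma T1_op_coef_eqs:
  assumes \<beta>: "\<beta> \<noteq> 1" "\<beta> \<noteq> -1" and q: "q absolutely_integrable_on {0..1}"
    and f: "continuous_on {0..1} f" and op: "T1_op q \<beta> y f"
  shows "continuous_on {0..1} y" and "y 0 = y 1"
    and "coef \<beta> f False m - coef \<beta> (\<lambda>x. q x * y x) False m = mu m * coef \<beta> y False m"
    and "coef \<beta> f True m - coef \<beta> (\<lambda>x. q x * y x) True m =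
      mu m * coef \<beta> y True m + gamma1 \<beta> * of_nat m * coef \<beta> y False m"
proof -
  obtain y' y'' where y: "\<And>x. x \<in> {0..1} \<Longrightarrow> (y has_vector_derivative y' x) (at x within {0..1})"
    and y': "abs_cont_with_deriv y' y''"
    and AE: "AE x in lebesgue. x \<in> {0..1} \<longrightarrow> f x = - y'' x + q x * y x"
    and bc: "y' 0 + \<beta> * y' 1 = 0" "y 0 - y 1 = 0"
    using op unfolding T1_op_def by blast
  show yc: "continuous_on {0..1} y"
    using y by (meson continuous_on_eq_continuous_within has_vector_derivative_continuous)
  show "y 0 = y 1" using bc(2) by simp
  have y''i: "y'' absolutely_integrable_on {0..1}" using y' by (simp add: abs_cont_with_deriv_def)
  have "coef \<beta> f t m - coef \<beta> (\<lambda>x. q x * y x) t m = I01 (\<lambda>x. - y'' x * test_fun \<beta> t m x)" for t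
  proof -
    have i1: "(\<lambda>x. f x * test_fun \<beta> t m x) absolutely_integrable_on {0..1}"
      by (intro abs_int_mult_continuous abs_int_continuous f continuous_test_fun)
    have i2: "(\<lambda>x. q x * y x * test_fun \<beta> t m x) absolutely_integrable_on {0..1}"
      by (intro abs_int_mult_continuous q yc continuous_test_fun)
    have i3: "(\<lambda>x. - y'' x * test_fun \<beta> t m x) absolutely_integrable_on {0..1}"
      using abs_int_mult_continuous[OF y''i continuous_on_minus[OF continuous_test_fun]] by simp
    have "coef \<beta> f t m = I01 (\<lambda>x. - y'' x * test_fun \<beta> t m x + q x * y x * test_fun \<beta> t m x)"
      unfolding set_lebesgue_integral_def
    proof (rule integral_cong_AE)
      show "(\<lambda>x. indicat_real {0..1} x *\<^sub>R (f x * test_fun \<beta> t m x)) \<in> borel_measurable lebesgue"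
        using i1 by (simp add: set_integrable_def borel_measurable_integrable)
      show "(\<lambda>x. indicat_real {0..1} x *\<^sub>R (- y'' x * test_fun \<beta> t m x + q x * y x * test_fun \<beta> t m x)) \<in> borel_measurable lebesgue"
        using set_integral_add(1)[OF i3 i2] by (simp add: set_integrable_def borel_measurable_integrable)
      show "AE x in lebesgue. indicat_real {0..1} x *\<^sub>R (f x * test_fun \<beta> t m x) =
          indicat_real {0..1} x *\<^sub>R (- y'' x * test_fun \<beta> t m x + q x * y x * test_fun \<beta> t m x)"
        using AE by eventually_elim (auto simp: indicator_def left_diff_distrib)
    qed
    also have "\<dots> = I01 (\<lambda>x. - y'' x * test_fun \<beta> t m x) + coef \<beta> (\<lambda>x. q x * y x) t m"
      by (rule I01_add[OF i3 i2])
    finally show ?thesis by simp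
  qed
  then show "coef \<beta> f False m - coef \<beta> (\<lambda>x. q x * y x) False m = mu m * coef \<beta> y False m"
    and "coef \<beta> f True m - coef \<beta> (\<lambda>x. q x * y x) True m =
      mu m * coef \<beta> y True m + gamma1 \<beta> * of_nat m * coef \<beta> y False m"
    using green_trig[OF y y' \<beta> bc(1), of m] \<open>y 0 = y 1\<close> by simp_all
qed

text \<open>The function \<open>W\<close> with \<open>- W'' = f - q y\<close> that satisfies the boundary condition on the derivative is explicit.
  The coefficient relation for \<open>phi_star\<close> of index \<open>0\<close> is the solvability condition \<open>W 0 = W 1\<close>. Then \<open>W\<close>
  and \<open>y\<close> have the same coefficients, because all \<open>mu m\<close> with \<open>m > 0\<close> are nonzero and the additive constant of \<open>W\<close> is
  free, and they agree by completeness.\<close>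

lemma T1_opI_coef_eqs:
  assumes \<beta>: "\<beta> \<noteq> 1" "\<beta> \<noteq> -1" and q: "q absolutely_integrable_on {0..1}"
    and f: "continuous_on {0..1} f" and y: "continuous_on {0..1} y" "y 0 = y 1"
    and F: "\<And>m. coef \<beta> f False m - coef \<beta> (\<lambda>x. q x * y x) False m = mu m * coef \<beta> y False m"
    and T: "\<And>m. coef \<beta> f True m - coef \<beta> (\<lambda>x. q x * y x) True m =
      mu m * coef \<beta> y True m + gamma1 \<beta> * of_nat m * coef \<beta> y False m"
  shows "T1_op q \<beta> y f"
proof -
  have \<beta>1: "1 + \<beta> \<noteq> 0" using \<beta>(2) by (simp add: add_eq_0_iff)
  define g where "g = (\<lambda>x. f x - q x * y x)"
  have qy: "(\<lambda>x. q x * y x) absolutely_integrable_on {0..1}" by (rule abs_int_mult_continuous[OF q y(1)])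
  have g: "g absolutely_integrable_on {0..1}"
    unfolding g_def by (rule set_integral_diff(1)[OF abs_int_continuous[OF f] qy])
  have gm: "(\<lambda>x. - g x) absolutely_integrable_on {0..1}"
    using set_integrable_mult_right[OF g, of "-1"] by simp
  have cg: "coef \<beta> g t m = coef \<beta> f t m - coef \<beta> (\<lambda>x. q x * y x) t m" for t m
    unfolding g_def left_diff_distrib
    by (intro I01_diff abs_int_mult_continuous abs_int_continuous f continuous_test_fun q y)
  define b where "b = \<beta> / (1 + \<beta>)"
  \<comment> \<open>the constant of integration is chosen so that the boundary condition holds\<close>
  define W' where "W' x = b * I01 g - (LINT t:{0..x}|lebesgue. g t)" for x
  have sing: "(LINT t:{0..0}|lebesgue. h t) = 0" if "h absolutely_integrable_on {0..1}" for h :: "real \<Rightarrow> complex"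
    using LINT_eq_integral_Icc[OF that, of 0] by simp
  have W'r: "W' x = W' 0 + (LINT t:{0..x}|lebesgue. - g t)" if "x \<in> {0..1}" for x
  proof -
    have "(LINT t:{0..x}|lebesgue. - g t) = - (LINT t:{0..x}|lebesgue. g t)"
      unfolding set_lebesgue_integral_def by simp
    then show ?thesis using sing[OF g] by (simp add: W'_def)
  qed
  have W'AC: "abs_cont_with_deriv W' (\<lambda>x. - g x)"
    unfolding abs_cont_with_deriv_def using gm W'r by blast
  have W'c: "continuous_on {0..1} W'"
    by (rule indefinite_integral_continuous_on[OF gm W'r])
  have W'bc: "W' 0 + \<beta> * W' 1 = 0"
  proof -
    have "W' 0 + \<beta> * W' 1 = I01 g * ((1 + \<beta>) * b - \<beta>)"
      using sing[OF g] by (simp add: W'_def algebra_simps)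
    then show ?thesis using \<beta>1 by (simp add: b_def)
  qed
  define V where "V x = (LINT t:{0..x}|lebesgue. W' t)" for x
  have VI: "V x = integral {0..x} W'" if "x \<in> {0..1}" for x
    unfolding V_def by (rule LINT_eq_integral_Icc[OF abs_int_continuous[OF W'c] that])
  have Vd: "(V has_vector_derivative W' x) (at x within {0..1})" if "x \<in> {0..1}" for x
    by (rule has_vector_derivative_transform[OF that VI integral_has_vector_derivative[OF W'c that]])
  \<comment> \<open>the additive constant that matches the coefficients of index \<open>0\<close>\<close>
  define d where "d = coef \<beta> y True 0 - coef \<beta> V True 0"
  define W where "W x = V x + d" for x
  have Wd: "(W has_vector_derivative W' x) (at x within {0..1})" if "x \<in> {0..1}" for x
    using has_vector_derivative_add[OF Vd[OF that] has_vector_derivative_const[of d]] by (simp add: W_def[abs_def])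
  have Wc: "continuous_on {0..1} W" and Vc: "continuous_on {0..1} V"
    using Wd Vd by (meson continuous_on_eq_continuous_within has_vector_derivative_continuous)+
  note gr = green_trig[OF Wd W'AC \<beta> W'bc, simplified minus_minus, folded cg]
  have W01: "W 1 = W 0"
  proof -
    have "psi_factor \<beta> 0 * (W 1 - W 0) = 0"
      using gr(2)[of 0] T[of 0] by (simp add: cg mu_def)
    moreover have "psi_factor \<beta> 0 \<noteq> 0"
      using \<beta> \<beta>1 unfolding psi_factor_def mult_eq_0_iff divide_eq_0_iff by (auto simp: add.commute)
    ultimately show ?thesis by simp
  qed
  have eqF: "coef \<beta> W False m = coef \<beta> y False m" for m
  proof (cases "m = 0")
    case True
    have "coef \<beta> h False 0 = 0" for h by (simp add: test_fun_False sn_def)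
    then show ?thesis using True by simp
  next
    case False
    then have "mu m \<noteq> 0" by (simp add: mu_def)
    then show ?thesis using gr(1)[of m] F[of m] by (simp add: cg W01)
  qed
  have eqT: "coef \<beta> W True m = coef \<beta> y True m" for m
  proof (cases "m = 0")
    case True
    have "coef \<beta> W True 0 = coef \<beta> V True 0 + coef \<beta> (\<lambda>x. d) True 0"
      unfolding W_def distrib_right
      by (intro I01_add abs_int_continuous continuous_intros continuous_test_fun Vc)
    also have "coef \<beta> (\<lambda>x. d) True 0 = d * coef \<beta> (basis_fun \<beta> True 0) True 0"
      by (subst I01_mult[symmetric]) (simp add: basis_fun_True cs_def)
    finally show ?thesis using True basis_biorthogonal[OF \<beta>, of True 0 True 0] by (simp add: d_def)
  next
    case False
    then have "mu m \<noteq> 0" by (simp add: mu_def)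
    then show ?thesis using gr(2)[of m] T[of m] eqF[of m] by (simp add: cg W01)
  qed
  have eq: "y x = W x" if "x \<in> {0..1}" for x
  proof -
    have "y x - W x = 0"
    proof (rule basis_complete[OF \<beta> _ _ _ that])
      show "continuous_on {0..1} (\<lambda>x. y x - W x)" by (intro continuous_intros y Wc)
      show "y 0 - W 0 = y 1 - W 1" using y(2) W01 by simp
      show "coef \<beta> (\<lambda>x. y x - W x) t m = 0" for t m
      proof -
        have "coef \<beta> (\<lambda>x. y x - W x) t m = coef \<beta> y t m - coef \<beta> W t m"
          unfolding left_diff_distrib
          by (intro I01_diff abs_int_continuous continuous_intros continuous_test_fun Wc y)
        then show ?thesis using eqF eqT by (cases t) auto
      qed
    qed
    then show ?thesis by simp
  qed
  have yd: "(y has_vector_derivative W' x) (at x within {0..1})" if "x \<in> {0..1}" for x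
    by (rule has_vector_derivative_transform[OF that eq Wd[OF that]])
  have "in_L2 f"
    unfolding in_L2_def
  proof
    show "set_borel_measurable lebesgue {0..1} f"
      using abs_int_continuous[OF f] by (simp add: set_integrable_def set_borel_measurable_def borel_measurable_integrable)
    show "(\<lambda>x. (cmod (f x))\<^sup>2) absolutely_integrable_on {0..1}"
      by (intro absolutely_integrable_continuous_real continuous_intros f)
  qed
  moreover have "AE x in lebesgue. x \<in> {0..1} \<longrightarrow> f x = - (- g x) + q x * y x"
    by (simp add: g_def)
  moreover have "y 0 - y 1 = 0" using y(2) by simp
  ultimately show ?thesis
    unfolding T1_op_def using yd W'AC W'bc by (intro conjI exI[of _ W'] exI[of _ "\<lambda>x. - g x"] ballI) auto
qed

definition basis_term :: "complex \<Rightarrow> (bool \<Rightarrow> nat \<Rightarrow> complex) \<Rightarrow> nat \<Rightarrow> real \<Rightarrow> complex" where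
  "basis_term \<beta> c j x = c False j * basis_fun \<beta> False j x + c True j * basis_fun \<beta> True j x"

lemma continuous_basis_term: "continuous_on A (basis_term \<beta> c j)"
  unfolding basis_term_def[abs_def] by (intro continuous_intros continuous_basis_fun)

lemma norm_basis_term_le:
  assumes "x \<in> {0..1}"
  shows "norm (basis_term \<beta> c j x) \<le> fun_bound \<beta> * (norm (c False j) + norm (c True j))"
proof -
  have "norm (basis_term \<beta> c j x) \<le> norm (c False j) * fun_bound \<beta> + norm (c True j) * fun_bound \<beta>"
    unfolding basis_term_def
    by (rule order_trans[OF norm_triangle_ineq], unfold norm_mult)
       (intro add_mono mult_left_mono norm_test_basis_le assms norm_ge_zero)
  then show ?thesis by (simp add: algebra_simps)
qed

context
  fixes \<beta> :: complex and c :: "bool \<Rightarrow> nat \<Rightarrow> complex" and y :: "real \<Rightarrow> complex"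
  assumes c: "summable (\<lambda>j. norm (c False j) + norm (c True j))"
    and y: "\<And>x. x \<in> {0..1} \<Longrightarrow> y x = (\<Sum>j. basis_term \<beta> c j x)"
begin

lemma basis_series_continuous: "continuous_on {0..1} y"
proof -
  have "uniform_limit {0..1} (\<lambda>n x. \<Sum>j<n. basis_term \<beta> c j x) (\<lambda>x. \<Sum>j. basis_term \<beta> c j x) sequentially"
    by (rule Weierstrass_m_test[OF _ summable_mult[OF c]]) (rule norm_basis_term_le)
  then have "continuous_on {0..1} (\<lambda>x. \<Sum>j. basis_term \<beta> c j x)"
    by (rule uniform_limit_theorem[rotated])
       (auto intro!: always_eventually continuous_on_sum continuous_basis_term)
  then show ?thesis by (rule continuous_on_eq) (simp add: y)
qed

lemma basis_series_ends: "y 0 = y 1"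
  by (simp add: y basis_term_def basis_fun_ends)

lemma basis_series_sums:
  assumes x: "x \<in> {0..1}" shows "(\<lambda>j. basis_term \<beta> c j x) sums y x"
  unfolding y[OF x]
  by (intro summable_sums summable_norm_cancel[OF summable_comparison_test[OF _ summable_mult[OF c]]] exI[of _ 0] allI impI)
     (use norm_basis_term_le[OF x] in auto)

lemma basis_series_integral:
  assumes g: "g absolutely_integrable_on {0..1}" and e: "continuous_on {0..1} e"
  shows "(\<lambda>j. c False j * I01 (\<lambda>x. g x * basis_fun \<beta> False j x * e x) + c True j * I01 (\<lambda>x. g x * basis_fun \<beta> True j x * e x))
    sums I01 (\<lambda>x. g x * y x * e x)"
proof -
  have ge: "(\<lambda>x. g x * e x) absolutely_integrable_on {0..1}" by (rule abs_int_mult_continuous[OF g e])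
  have "(\<lambda>j. I01 (\<lambda>x. g x * e x * basis_term \<beta> c j x)) sums I01 (\<lambda>x. g x * e x * y x)"
    by (rule I01_sums[OF ge continuous_basis_term norm_basis_term_le summable_mult[OF c] y])
  moreover have "I01 (\<lambda>x. g x * e x * basis_term \<beta> c j x) =
     c False j * I01 (\<lambda>x. g x * basis_fun \<beta> False j x * e x) + c True j * I01 (\<lambda>x. g x * basis_fun \<beta> True j x * e x)" for j
  proof -
    have "I01 (\<lambda>x. g x * e x * basis_term \<beta> c j x) =
      I01 (\<lambda>x. c False j * (g x * basis_fun \<beta> False j x * e x) + c True j * (g x * basis_fun \<beta> True j x * e x))"
      by (intro I01_cong) (simp add: basis_term_def algebra_simps)
    also have "\<dots> = I01 (\<lambda>x. c False j * (g x * basis_fun \<beta> False j x * e x)) + I01 (\<lambda>x. c True j * (g x * basis_fun \<beta> True j x * e x))"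
      by (intro I01_add set_integrable_mult_right abs_int_mult_continuous g e continuous_basis_fun)
    finally show ?thesis unfolding I01_mult .
  qed
  moreover have "(\<lambda>x. g x * e x * y x) = (\<lambda>x. g x * y x * e x)" by (simp add: algebra_simps)
  ultimately show ?thesis by simp
qed

lemma basis_series_coef:
  assumes \<beta>: "\<beta> \<noteq> 1" "\<beta> \<noteq> -1" and tm: "t \<or> m \<noteq> 0"
  shows "coef \<beta> y t m = c t m"
proof -
  have "(\<lambda>j. c False j * coef \<beta> (basis_fun \<beta> False j) t m + c True j * coef \<beta> (basis_fun \<beta> True j) t m) sums coef \<beta> y t m"
    using basis_series_integral[of "\<lambda>x. 1", OF abs_int_continuous[OF continuous_on_const] continuous_test_fun[of _ \<beta> t m]] by simp
  moreover have "c False j * coef \<beta> (basis_fun \<beta> False j) t m + c True j * coef \<beta> (basis_fun \<beta> True j) t m =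
     (if j = m then c t m else 0)" for j
    unfolding basis_biorthogonal[OF \<beta>] using tm by (cases t) auto
  ultimately have "(\<lambda>j. if j = m then c t m else 0) sums coef \<beta> y t m" by simp
  with sums_single[of m "\<lambda>j. c t m"] show ?thesis using sums_unique2 by blast
qed

end

lemma basis_expansion:
  assumes \<beta>: "\<beta> \<noteq> 1" "\<beta> \<noteq> -1" and y: "continuous_on {0..1} y" "y 0 = y 1"
    and s: "summable (\<lambda>j. norm (coef \<beta> y False j) + norm (coef \<beta> y True j))"
    and x: "x \<in> {0..1}"
  shows "y x = (\<Sum>j. basis_term \<beta> (coef \<beta> y) j x)"
proof -
  define w where "w x = (\<Sum>j. basis_term \<beta> (coef \<beta> y) j x)" for x
  have wc: "continuous_on {0..1} w" "w 0 = w 1"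
    using basis_series_continuous[OF s w_def] basis_series_ends[OF s w_def] by auto
  have "y x - w x = 0"
  proof (rule basis_complete[OF \<beta> _ _ _ x])
    show "continuous_on {0..1} (\<lambda>x. y x - w x)" by (intro continuous_intros y wc)
    show "y 0 - w 0 = y 1 - w 1" using y wc by simp
    show "coef \<beta> (\<lambda>x. y x - w x) t m = 0" for t m
    proof -
      have "coef \<beta> (\<lambda>x. y x - w x) t m = coef \<beta> y t m - coef \<beta> w t m"
        unfolding left_diff_distrib
        by (intro I01_diff abs_int_continuous continuous_intros continuous_test_fun wc y)
      moreover have "coef \<beta> h False 0 = 0" for h by (simp add: test_fun_False sn_def)
      ultimately show ?thesis using basis_series_coef[OF s w_def \<beta>, of t m] by (cases "t \<or> m \<noteq> 0") auto
    qed
  qed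
  then show ?thesis by (simp add: w_def)
qed

section \<open>Neumann series of a small infinite matrix\<close>

lemma holomorphic_on_suminf:
  fixes f :: "nat \<Rightarrow> complex \<Rightarrow> complex"
  assumes S: "open S" and f: "\<And>j. f j holomorphic_on S"
    and b: "\<And>j z. z \<in> S \<Longrightarrow> norm (f j z) \<le> b j" "summable b"
  shows "(\<lambda>z. \<Sum>j. f j z) holomorphic_on S"
proof (rule holomorphic_uniform_sequence[OF S])
  show "(\<lambda>z. \<Sum>j<m. f j z) holomorphic_on S" for m
    by (intro holomorphic_on_sum f)
  fix z assume "z \<in> S"
  then obtain d where d: "d > 0" "cball z d \<subseteq> S" using S open_contains_cball by blast
  have "uniform_limit (cball z d) (\<lambda>m z. \<Sum>j<m. f j z) (\<lambda>z. \<Sum>j. f j z) sequentially"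
    by (rule Weierstrass_m_test[OF _ b(2)]) (use b(1) d in auto)
  with d show "\<exists>d>0. cball z d \<subseteq> S \<and> uniform_limit (cball z d) (\<lambda>m z. \<Sum>j<m. f j z) (\<lambda>z. \<Sum>j. f j z) sequentially"
    by blast
qed

definition bounded_by :: "(bool \<Rightarrow> nat \<Rightarrow> complex) \<Rightarrow> real \<Rightarrow> bool" where
  "bounded_by X B \<longleftrightarrow> (\<forall>t i. norm (X t i) \<le> B)"

lemma bounded_byD: "bounded_by X B \<Longrightarrow> norm (X t i) \<le> B"
  by (simp add: bounded_by_def)

lemma bounded_by_nonneg: "bounded_by X B \<Longrightarrow> 0 \<le> B"
  using order_trans[OF norm_ge_zero bounded_byD] .

lemma bounded_by_add: "bounded_by X B \<Longrightarrow> bounded_by Y C \<Longrightarrow> bounded_by (\<lambda>t i. X t i + Y t i) (B + C)"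
  unfolding bounded_by_def by (intro allI order_trans[OF norm_triangle_ineq]) (simp add: add_mono)

lemma bounded_by_scale: "bounded_by X B \<Longrightarrow> bounded_by (\<lambda>t i. c * X t i) (norm c * B)"
  unfolding bounded_by_def by (auto simp: norm_mult intro: mult_left_mono)

text \<open>An infinite matrix of two by two blocks, holomorphic in a parameter, whose columns other than the \<open>n\<close>-th are
  bounded by a summable weight. The factor \<open>4\<close> makes the operator below a contraction with factor \<open>1/2\<close> on bounded
  sequences: each column index carries two scalar columns.\<close>

locale small_kernel =
  fixes k :: "complex \<Rightarrow> bool \<Rightarrow> nat \<Rightarrow> bool \<Rightarrow> nat \<Rightarrow> complex"
    and S :: "complex set" and n :: nat and w :: "nat \<Rightarrow> real"
  assumes S: "open S"
    and w: "\<And>j. 0 \<le> w j" "summable w" "4 * suminf w \<le> 1"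
    and kb: "\<And>z t i s j. z \<in> S \<Longrightarrow> j \<noteq> n \<Longrightarrow> norm (k z t i s j) \<le> w j"
    and kh: "\<And>t i s j. j \<noteq> n \<Longrightarrow> (\<lambda>z. k z t i s j) holomorphic_on S"
begin

definition K_term where
  "K_term z X t i j = (if j = n then 0 else k z t i False j * X False j + k z t i True j * X True j)"

text \<open>The column of index \<open>n\<close> is left out, but the row of index \<open>n\<close> is computed.\<close>

definition K where "K z X t i = (\<Sum>j. K_term z X t i j)"

definition solution where "solution z X t i = (\<Sum>m. (K z ^^ m) X t i)"

lemma norm_K_term_le:
  assumes "z \<in> S" "bounded_by X B"
  shows "norm (K_term z X t i j) \<le> 2 * B * w j"
proof (cases "j = n")
  case True
  then show ?thesis using w(1)[of j] bounded_by_nonneg[OF assms(2)] by (simp add: K_term_def)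
next
  case False
  have "norm (k z t i s j * X s j) \<le> w j * B" for s
    unfolding norm_mult by (intro mult_mono kb assms(1) False bounded_byD[OF assms(2)] w norm_ge_zero)
  from norm_triangle_mono[OF this[of False] this[of True]]
  show ?thesis using False by (simp add: K_term_def algebra_simps)
qed

lemma K_term_summable:
  assumes "z \<in> S" "bounded_by X B"
  shows "summable (\<lambda>j. norm (K_term z X t i j))"
  by (rule summable_comparison_test[OF _ summable_mult[OF w(2)]]) (use norm_K_term_le[OF assms] in auto)

lemma norm_K_le:
  assumes "z \<in> S" "bounded_by X B"
  shows "norm (K z X t i) \<le> 2 * B * suminf w"
proof -
  have "norm (K z X t i) \<le> (\<Sum>j. 2 * B * w j)"
    unfolding K_def by (rule norm_suminf_le[OF norm_K_term_le[OF assms] summable_mult[OF w(2)]])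
  then show ?thesis by (simp add: suminf_mult w(2))
qed

lemma K_bounded_by:
  assumes "z \<in> S" "bounded_by X B"
  shows "bounded_by (K z X) (B / 2)"
  unfolding bounded_by_def
proof (intro allI)
  fix t i
  have "B * (4 * suminf w) \<le> B * 1"
    by (rule mult_left_mono[OF w(3) bounded_by_nonneg[OF assms(2)]])
  with norm_K_le[OF assms, of t i] show "norm (K z X t i) \<le> B / 2" by simp
qed

lemma K_add:
  assumes "z \<in> S" "bounded_by X B" "bounded_by Y C"
  shows "K z (\<lambda>t i. X t i + Y t i) t i = K z X t i + K z Y t i"
proof -
  have "K z X t i + K z Y t i = (\<Sum>j. K_term z X t i j + K_term z Y t i j)"
    unfolding K_def
    by (rule suminf_add) (rule summable_norm_cancel, rule K_term_summable, rule assms(1), rule assms)+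
  also have "\<dots> = K z (\<lambda>t i. X t i + Y t i) t i"
    unfolding K_def by (intro suminf_cong) (simp add: K_term_def algebra_simps)
  finally show ?thesis by simp
qed

lemma K_scale:
  assumes "z \<in> S" "bounded_by X B"
  shows "K z (\<lambda>t i. c * X t i) t i = c * K z X t i"
proof -
  have "c * K z X t i = (\<Sum>j. c * K_term z X t i j)"
    unfolding K_def by (rule suminf_mult[symmetric, OF summable_norm_cancel[OF K_term_summable[OF assms]]])
  also have "\<dots> = K z (\<lambda>t i. c * X t i) t i"
    unfolding K_def by (intro suminf_cong) (simp add: K_term_def algebra_simps)
  finally show ?thesis by simp
qed

lemma K_iterate_bounded_by:
  assumes "z \<in> S" "bounded_by X B"
  shows "bounded_by ((K z ^^ m) X) (B * (1/2) ^ m)"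
proof (induction m)
  case (Suc m)
  from K_bounded_by[OF assms(1) this] show ?case by simp
qed (simp add: assms)

lemma norm_K_iterate_le:
  assumes "z \<in> S" "bounded_by X B"
  shows "norm ((K z ^^ m) X t i) \<le> B * (1/2) ^ m"
  using bounded_byD[OF K_iterate_bounded_by[OF assms]] .

lemma solution_sums:
  assumes "z \<in> S" "bounded_by X B"
  shows "(\<lambda>m. (K z ^^ m) X t i) sums solution z X t i"
  unfolding solution_def
  by (intro summable_sums summable_norm_cancel[OF summable_comparison_test[OF _ summable_mult[OF summable_geometric]]] exI[of _ 0] allI impI)
     (use norm_K_iterate_le[OF assms] in auto)

lemma norm_suminf_half_power_le:
  fixes f :: "nat \<Rightarrow> complex"
  assumes "\<And>m. norm (f m) \<le> B * (1/2) ^ m"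
  shows "norm (suminf f) \<le> 2 * B"
proof -
  have "norm (suminf f) \<le> (\<Sum>m. B * (1/2) ^ m)"
    by (rule norm_suminf_le[OF assms]) (intro summable_mult summable_geometric, simp)
  also have "\<dots> = 2 * B" by (subst suminf_mult) (simp_all add: suminf_geometric)
  finally show ?thesis .
qed

lemma solution_bounded_by:
  assumes "z \<in> S" "bounded_by X B"
  shows "bounded_by (solution z X) (2 * B)"
  unfolding bounded_by_def solution_def
  by (intro allI norm_suminf_half_power_le norm_K_iterate_le[OF assms])

lemma solution_unique:
  assumes z: "z \<in> S" and Y: "bounded_by Y B" "\<And>t i. Y t i = K z Y t i"
  shows "Y t i = 0"
proof -
  have Y': "K z Y = Y" using Y(2) by (intro ext) simp
  have "(K z ^^ m) Y = Y" for m by (induction m) (simp_all add: Y')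
  then have "norm (Y t i) \<le> B * (1/2) ^ m" for m using norm_K_iterate_le[OF z Y(1), of m] by simp
  moreover have "(\<lambda>m. B * (1/2) ^ m) \<longlonglongrightarrow> B * 0"
    by (intro tendsto_intros LIMSEQ_power_zero) simp
  ultimately have "norm (Y t i) \<le> B * 0"
    by (intro LIMSEQ_le_const[of "\<lambda>m. B * (1/2) ^ m"]) auto
  then show ?thesis by simp
qed

text \<open>The partial sums \<open>P N\<close> of the Neumann series satisfy \<open>P (N + 1) = X + K (P N)\<close> and approach the solution
  uniformly; so no interchange of two infinite sums is needed.\<close>

lemma solution_eq:
  assumes z: "z \<in> S" and X: "bounded_by X B"
  shows "solution z X t i = X t i + K z (solution z X) t i"
proof -
  let ?P = "\<lambda>N t i. \<Sum>m<N. (K z ^^ m) X t i"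
  have P: "bounded_by (?P N) (2 * B)" for N
    unfolding bounded_by_def
  proof (intro allI)
    fix t i
    have "norm (?P N t i) \<le> (\<Sum>m<N. B * (1/2) ^ m)"
      by (rule sum_norm_le) (rule norm_K_iterate_le[OF z X])
    also have "\<dots> \<le> (\<Sum>m. B * (1/2) ^ m)"
      by (rule sum_le_suminf) (auto intro!: summable_mult summable_geometric mult_nonneg_nonneg bounded_by_nonneg[OF X])
    also have "\<dots> = 2 * B" by (subst suminf_mult) (simp_all add: suminf_geometric)
    finally show "norm (?P N t i) \<le> 2 * B" .
  qed
  have step: "?P (Suc N) t i = X t i + K z (?P N) t i" for N t i
  proof (induction N arbitrary: t i)
    case 0
    have "K z (\<lambda>t i. 0) t i = 0" by (simp add: K_def K_term_def cong: if_cong)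
    then show ?case by simp
  next
    case (Suc N)
    have "K z (?P (Suc N)) t i = K z (\<lambda>t i. ?P N t i + (K z ^^ N) X t i) t i" by simp
    also have "\<dots> = K z (?P N) t i + (K z ^^ Suc N) X t i"
      by (subst K_add[OF z P K_iterate_bounded_by[OF z X]]) simp
    finally show ?case using Suc[of t i] by simp
  qed
  have tail: "bounded_by (\<lambda>t i. solution z X t i + (-1) * ?P N t i) (2 * B * (1/2) ^ N)" for N
    unfolding bounded_by_def
  proof (intro allI)
    fix t i
    have "solution z X t i = (\<Sum>m. (K z ^^ (m + N)) X t i) + ?P N t i"
      unfolding solution_def by (rule suminf_split_initial_segment[OF sums_summable[OF solution_sums[OF z X]]])
    moreover have "norm (\<Sum>m. (K z ^^ (m + N)) X t i) \<le> 2 * (B * (1/2) ^ N)"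
    proof (rule norm_suminf_half_power_le)
      show "norm ((K z ^^ (m + N)) X t i) \<le> B * (1/2) ^ N * (1/2) ^ m" for m
        using norm_K_iterate_le[OF z X, of "m + N" t i] by (simp add: power_add mult_ac)
    qed
    ultimately show "norm (solution z X t i + (-1) * ?P N t i) \<le> 2 * B * (1/2) ^ N" by simp
  qed
  have "norm (solution z X t i - X t i - K z (solution z X) t i) \<le> 2 * B * (1/2) ^ N" for N
  proof -
    have sb: "bounded_by (solution z X) (2 * B)" by (rule solution_bounded_by[OF z X])
    have pb: "bounded_by (\<lambda>t i. (-1) * ?P N t i) (norm (-1 :: complex) * (2 * B))" by (rule bounded_by_scale[OF P])
    have "K z (\<lambda>t i. solution z X t i + (-1) * ?P N t i) t i = K z (solution z X) t i - K z (?P N) t i"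
      unfolding K_add[OF z sb pb] K_scale[OF z P] by simp
    then have "solution z X t i - X t i - K z (solution z X) t i =
      (solution z X t i + (-1) * ?P (Suc N) t i) - K z (\<lambda>t i. solution z X t i + (-1) * ?P N t i) t i"
      by (simp only: step) simp
    also have "norm \<dots> \<le> 2 * B * (1/2) ^ Suc N + 2 * B * (1/2) ^ N / 2"
      by (rule norm_triangle_le_diff) (intro add_mono bounded_byD[OF tail] bounded_byD[OF K_bounded_by[OF z tail]])
    finally show ?thesis by simp
  qed
  moreover have "(\<lambda>N. 2 * B * (1/2) ^ N) \<longlonglongrightarrow> 2 * B * 0"
    by (intro tendsto_intros LIMSEQ_power_zero) simp
  ultimately have "norm (solution z X t i - X t i - K z (solution z X) t i) \<le> 2 * B * 0"
    by (intro LIMSEQ_le_const[of "\<lambda>m. 2 * B * (1/2) ^ m"]) auto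
  then show ?thesis by (simp add: algebra_simps)
qed

lemma solution_eqI:
  assumes z: "z \<in> S" and X: "bounded_by X B" and Y: "bounded_by Y C" "\<And>t i. Y t i = X t i + K z Y t i"
  shows "Y t i = solution z X t i"
proof -
  let ?s = "\<lambda>t i. (-1) * solution z X t i"
  have s: "bounded_by ?s (norm (-1 :: complex) * (2 * B))"
    by (rule bounded_by_scale[OF solution_bounded_by[OF z X]])
  have "Y t i + ?s t i = 0"
  proof (rule solution_unique[OF z bounded_by_add[OF Y(1) s]])
    fix t i
    show "Y t i + ?s t i = K z (\<lambda>t i. Y t i + ?s t i) t i"
      unfolding K_add[OF z Y(1) s] K_scale[OF z solution_bounded_by[OF z X]]
      using Y(2)[of t i] solution_eq[OF z X, of t i] by simp
  qed
  then show ?thesis by simp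
qed

lemma solution_add:
  assumes z: "z \<in> S" and X: "bounded_by X B" and Y: "bounded_by Y C"
  shows "solution z (\<lambda>t i. X t i + Y t i) t i = solution z X t i + solution z Y t i"
proof (rule solution_eqI[symmetric, OF z bounded_by_add[OF X Y] bounded_by_add[OF solution_bounded_by[OF z X] solution_bounded_by[OF z Y]]])
  show "solution z X t i + solution z Y t i = X t i + Y t i + K z (\<lambda>t i. solution z X t i + solution z Y t i) t i" for t i
    unfolding K_add[OF z solution_bounded_by[OF z X] solution_bounded_by[OF z Y]]
    using solution_eq[OF z X, of t i] solution_eq[OF z Y, of t i] by simp
qed

lemma solution_scale:
  assumes z: "z \<in> S" and X: "bounded_by X B"
  shows "solution z (\<lambda>t i. c * X t i) t i = c * solution z X t i"
proof (rule solution_eqI[symmetric, OF z bounded_by_scale[OF X] bounded_by_scale[OF solution_bounded_by[OF z X]]])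
  show "c * solution z X t i = c * X t i + K z (\<lambda>t i. c * solution z X t i) t i" for t i
    unfolding K_scale[OF z solution_bounded_by[OF z X]]
    by (subst solution_eq[OF z X]) (simp add: ring_distribs)
qed

lemma K_holomorphic:
  assumes Y: "\<And>z. z \<in> S \<Longrightarrow> bounded_by (Y z) B" "\<And>t i. (\<lambda>z. Y z t i) holomorphic_on S"
  shows "(\<lambda>z. K z (Y z) t i) holomorphic_on S"
  unfolding K_def
proof (rule holomorphic_on_suminf[OF S _ norm_K_term_le[OF _ Y(1)]])
  show "(\<lambda>z. K_term z (Y z) t i j) holomorphic_on S" for j
    unfolding K_term_def by (cases "j = n") (auto intro!: holomorphic_intros kh Y(2))
qed (auto intro: summable_mult w)

lemma solution_holomorphic:
  assumes X: "bounded_by X B"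
  shows "(\<lambda>z. solution z X t i) holomorphic_on S"
  unfolding solution_def
proof (rule holomorphic_on_suminf[OF S _ norm_K_iterate_le[OF _ X]])
  show "(\<lambda>z. (K z ^^ m) X t i) holomorphic_on S" for m
  proof (induction m arbitrary: t i)
    case (Suc m)
    from K_holomorphic[OF K_iterate_bounded_by[OF _ X] Suc] show ?case by simp
  qed simp
qed (auto intro!: summable_mult summable_geometric)

text \<open>The products of blocks along a path of indices; for the matrix of the eigenvalue problem these are the
  coefficients \<open>C, M\<close> (\<open>t = False\<close>) and their variants with tilde (\<open>t = True\<close>).\<close>

primrec path_weight :: "complex \<Rightarrow> bool \<Rightarrow> nat list \<Rightarrow> nat \<Rightarrow> bool \<Rightarrow> complex" where
  "path_weight z t \<nu> 0 s = (if s = t then 1 else 0)"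
| "path_weight z t \<nu> (Suc m) s =
     path_weight z t \<nu> m False * k z False (\<nu> ! m) s (\<nu> ! Suc m) +
     path_weight z t \<nu> m True * k z True (\<nu> ! m) s (\<nu> ! Suc m)"

lemma path_weight_append: "m < length \<nu> \<Longrightarrow> path_weight z t (\<nu> @ \<nu>') m s = path_weight z t \<nu> m s"
  by (induction m arbitrary: s) (simp_all add: nth_append)

lemma index_tuples_0: "index_tuples n 0 = {[]}"
  by (auto simp: index_tuples_def)

lemma index_tuples_Suc: "index_tuples n (Suc m) = (\<lambda>(ns, j). ns @ [j]) ` (index_tuples n m \<times> (- {n}))"
proof (intro equalityI subsetI)
  fix ns assume ns: "ns \<in> index_tuples n (Suc m)"
  then have "ns \<noteq> []" by (auto simp: index_tuples_def)
  then have "ns = butlast ns @ [last ns]" by simp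
  moreover have "(butlast ns, last ns) \<in> index_tuples n m \<times> (- {n})"
    using ns \<open>ns \<noteq> []\<close> last_in_set[of ns] by (auto simp: index_tuples_def dest: in_set_butlastD)
  ultimately show "ns \<in> (\<lambda>(ns, j). ns @ [j]) ` (index_tuples n m \<times> (- {n}))"
    by (metis (mono_tags, lifting) case_prod_conv image_iff)
qed (auto simp: index_tuples_def)

lemma inj_snoc: "inj_on (\<lambda>(ns, j). ns @ [j]) A"
  by (auto simp: inj_on_def)

lemma K_has_sum:
  assumes "z \<in> S" "bounded_by X B"
  shows "((\<lambda>j. k z t i False j * X False j + k z t i True j * X True j) has_sum K z X t i) (- {n})"
proof -
  have "(K_term z X t i has_sum K z X t i) UNIV"
    unfolding K_def
    by (rule norm_summable_imp_has_sum[OF K_term_summable[OF assms] summable_sums[OF summable_norm_cancel[OF K_term_summable[OF assms]]]])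
  then show ?thesis
    by (rule has_sum_cong_neutral[THEN iffD1, rotated -1]) (auto simp: K_term_def)
qed

lemma w_summable_on: "w summable_on A"
proof -
  have "w summable_on UNIV"
    by (rule norm_summable_imp_summable_on) (simp add: w)
  then show ?thesis by (rule summable_on_subset_banach) simp
qed

lemma product_summable_on:
  assumes g: "g summable_on A" and g0: "\<And>x. 0 \<le> (g x :: real)"
  shows "(\<lambda>(x, j). g x * w j) summable_on (A \<times> B)"
proof -
  have "(\<lambda>x. norm (case x of (x, j) \<Rightarrow> g x * w j)) summable_on (A \<times> B)"
    unfolding Infinite_Sum.abs_summable_on_Sigma_iff
  proof (intro conjI ballI)
    show "(\<lambda>j. norm (case (x, j) of (x, j) \<Rightarrow> g x * w j)) summable_on B" for x
      using summable_on_cmult_right[OF w_summable_on[of B], of "g x"] g0[of x] w(1) by simp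
    have "(\<lambda>x. g x * infsum w B) summable_on A"
      by (rule summable_on_cmult_left[OF g])
    moreover have "(\<Sum>\<^sub>\<infinity>j\<in>B. norm (case (x, j) of (x, j) \<Rightarrow> g x * w j)) = g x * infsum w B" for x
      using infsum_cmult_right'[of "g x" w B] w(1) g0[of x] by simp
    moreover have "0 \<le> infsum w B" by (rule infsum_nonneg) (rule w)
    ultimately show "(\<lambda>x. norm (\<Sum>\<^sub>\<infinity>j\<in>B. norm (case (x, j) of (x, j) \<Rightarrow> g x * w j))) summable_on A"
      using g0 by simp
  qed
  moreover have "norm (case x of (x, j) \<Rightarrow> g x * w j) = (case x of (x, j) \<Rightarrow> g x * w j)" for x
    using g0 w(1) by (auto split: prod.split)
  ultimately show ?thesis by simp
qed

definition path_size where
  "path_size z t ns m = norm (path_weight z t (n # ns) m False) + norm (path_weight z t (n # ns) m True)"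

lemma path_weight_snoc:
  assumes "ns \<in> index_tuples n m"
  shows "path_weight z t (n # ns @ [j]) (Suc m) s =
     path_weight z t (n # ns) m False * k z False ((n # ns) ! m) s j +
     path_weight z t (n # ns) m True * k z True ((n # ns) ! m) s j"
proof -
  have l: "length ns = m" using assms by (simp add: index_tuples_def)
  have "(n # ns @ [j]) ! m = (n # ns) ! m" using l by (simp add: nth_append nth_Cons')
  moreover have "(n # ns @ [j]) ! Suc m = j" using l by (simp add: nth_append)
  moreover have "path_weight z t (n # ns @ [j]) m r = path_weight z t (n # ns) m r" for r
    using path_weight_append[of m "n # ns" z t "[j]" r] l by simp
  ultimately show ?thesis by simp
qed

lemma path_size_snoc_le:
  assumes z: "z \<in> S" and ns: "ns \<in> index_tuples n m" and j: "j \<noteq> n"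
  shows "path_size z t (ns @ [j]) (Suc m) \<le> 2 * (path_size z t ns m * w j)"
proof -
  have "norm (path_weight z t (n # ns @ [j]) (Suc m) s) \<le> path_size z t ns m * w j" for s
    unfolding path_weight_snoc[OF ns] path_size_def distrib_right
    by (rule norm_triangle_le) (unfold norm_mult, intro add_mono mult_left_mono kb z j norm_ge_zero)
  from add_mono[OF this[of False] this[of True]] show ?thesis unfolding path_size_def[of _ _ "ns @ [j]"] mult_2 by (simp only:)
qed

lemma path_size_nonneg: "0 \<le> path_size z t ns m"
  by (simp add: path_size_def)

text \<open>Appending an index multiplies the size of a path by at most twice a summable weight. The
  absolute summability obtained here justifies rearranging the multiple sums below.\<close>

lemma path_size_summable_on:
  assumes z: "z \<in> S"
  shows "(\<lambda>ns. path_size z t ns m) summable_on index_tuples n m"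
proof (induction m)
  case 0
  show ?case by (simp add: index_tuples_0)
next
  case (Suc m)
  have "(\<lambda>x. 2 * (case x of (ns, j) \<Rightarrow> path_size z t ns m * w j)) summable_on (index_tuples n m \<times> (- {n}))"
    by (rule summable_on_cmult_right[OF product_summable_on[OF Suc path_size_nonneg]])
  then have "(\<lambda>(ns, j). path_size z t (ns @ [j]) (Suc m)) summable_on (index_tuples n m \<times> (- {n}))"
    by (rule summable_on_comparison_test) (auto simp: path_size_nonneg intro!: path_size_snoc_le z)
  then show ?case
    unfolding index_tuples_Suc by (subst summable_on_reindex[OF inj_snoc]) (simp only: o_def case_prod_unfold)
qed

text \<open>The last step of a path belongs to the factor of the iterate that acts on \<open>X\<close> first; so the induction keeps
  \<open>X\<close> arbitrary and is applied to \<open>K z X\<close>.\<close>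

lemma K_iterate_path_sum:
  assumes z: "z \<in> S" and X: "bounded_by X B"
  shows "(K z ^^ m) X t n = (\<Sum>\<^sub>\<infinity>ns\<in>index_tuples n m.
    path_weight z t (n # ns) m False * X False ((n # ns) ! m) +
    path_weight z t (n # ns) m True * X True ((n # ns) ! m))"
  using X
proof (induction m arbitrary: X B)
  case 0
  then show ?case by (cases t) (simp_all add: index_tuples_0)
next
  case (Suc m)
  note X = Suc.prems
  let ?f = "\<lambda>ns. path_weight z t (n # ns) (Suc m) False * X False ((n # ns) ! Suc m) +
    path_weight z t (n # ns) (Suc m) True * X True ((n # ns) ! Suc m)"
  let ?p = "\<lambda>ns. path_weight z t (n # ns) m"
  let ?T = "index_tuples n m"
  have f: "?f (ns @ [j]) = (?p ns False * (k z False ((n # ns) ! m) False j * X False j + k z False ((n # ns) ! m) True j * X True j)) +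
      (?p ns True * (k z True ((n # ns) ! m) False j * X False j + k z True ((n # ns) ! m) True j * X True j))"
    if "ns \<in> ?T" for ns j
  proof -
    have "(n # ns @ [j]) ! Suc m = j" using that by (simp add: index_tuples_def nth_append)
    then show ?thesis by (simp only: append_Cons path_weight_snoc[OF that]) (simp add: algebra_simps)
  qed
  have inner: "(\<Sum>\<^sub>\<infinity>j\<in>- {n}. ?f (ns @ [j])) = ?p ns False * K z X False ((n # ns) ! m) + ?p ns True * K z X True ((n # ns) ! m)"
    if "ns \<in> ?T" for ns
    unfolding f[OF that] by (intro infsumI has_sum_add has_sum_cmult_right K_has_sum[OF z X])
  have fs: "(\<lambda>(ns, j). ?f (ns @ [j])) summable_on (?T \<times> (- {n}))"
  proof (rule abs_summable_summable, rule summable_on_comparison_test)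
    show "(\<lambda>x. 2 * B * (case x of (ns, j) \<Rightarrow> path_size z t ns m * w j)) summable_on (?T \<times> (- {n}))"
      by (rule summable_on_cmult_right[OF product_summable_on[OF path_size_summable_on[OF z] path_size_nonneg]])
    fix x assume x: "x \<in> ?T \<times> (- {n})"
    obtain ns j where [simp]: "x = (ns, j)" by (cases x)
    have j: "(n # ns @ [j]) ! Suc m = j" using x by (simp add: index_tuples_def nth_append)
    have "norm (?f (ns @ [j])) \<le> norm (path_weight z t (n # ns @ [j]) (Suc m) False) * B + norm (path_weight z t (n # ns @ [j]) (Suc m) True) * B"
      unfolding append_Cons j by (rule norm_triangle_le) (unfold norm_mult, intro add_mono mult_left_mono bounded_byD[OF X] norm_ge_zero)
    also have "\<dots> = path_size z t (ns @ [j]) (Suc m) * B" by (simp add: path_size_def distrib_right)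
    also have "\<dots> \<le> (2 * (path_size z t ns m * w j)) * B"
      using x by (intro mult_right_mono path_size_snoc_le z bounded_by_nonneg[OF X]) auto
    finally show "norm (case x of (ns, j) \<Rightarrow> ?f (ns @ [j])) \<le> 2 * B * (case x of (ns, j) \<Rightarrow> path_size z t ns m * w j)"
      by (simp add: mult_ac)
  qed simp
  have "(K z ^^ Suc m) X t n = (K z ^^ m) (K z X) t n" by (simp add: funpow_swap1)
  also have "\<dots> = (\<Sum>\<^sub>\<infinity>ns\<in>?T. ?p ns False * K z X False ((n # ns) ! m) + ?p ns True * K z X True ((n # ns) ! m))"
    by (rule Suc.IH[OF K_bounded_by[OF z X]])
  also have "\<dots> = (\<Sum>\<^sub>\<infinity>ns\<in>?T. \<Sum>\<^sub>\<infinity>j\<in>- {n}. ?f (ns @ [j]))"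
    by (rule infsum_cong) (simp only: inner)
  also have "\<dots> = (\<Sum>\<^sub>\<infinity>(ns, j)\<in>?T \<times> (- {n}). ?f (ns @ [j]))"
    by (rule infsum_Sigma'_banach[OF fs])
  also have "\<dots> = infsum ?f (index_tuples n (Suc m))"
    unfolding index_tuples_Suc by (subst infsum_reindex[OF inj_snoc]) (simp only: o_def case_prod_unfold)
  finally show ?case .
qed

end

section \<open>Row sums and the weak form of the equation\<close>

text \<open>The value \<open>d powr (- 3 / 2)\<close>, with the default value \<open>0\<close> for \<open>d = 0\<close>, which discards the index \<open>n\<close>.\<close>

definition rho :: "real \<Rightarrow> real" where "rho d = 1 / (d * sqrt d)"

definition rho_sum :: real where "rho_sum = (\<Sum>m. rho (real m))"

definition weight :: "nat \<Rightarrow> nat \<Rightarrow> real" where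
  "weight n j = rho \<bar>real j - real n\<bar> / sqrt (real n)"

lemma rho_nonneg: "0 \<le> d \<Longrightarrow> 0 \<le> rho d"
  by (simp add: rho_def)

lemma rho_summable: "summable (\<lambda>m. rho (real m))"
proof (rule summable_cong[THEN iffD1])
  show "\<forall>\<^sub>F m in sequentially. real m powr (- (3/2)) = rho (real m)"
  proof (rule eventually_sequentiallyI[of 1])
    fix m :: nat assume "1 \<le> m"
    then have "real m powr (3/2) = real m * sqrt (real m)"
      using powr_add[of "real m" 1 "1/2"] by (simp add: powr_half_sqrt)
    then show "real m powr (- (3/2)) = rho (real m)" by (simp only: powr_minus_divide rho_def)
  qed
  show "summable (\<lambda>m. real m powr (- (3/2)))" by (subst summable_real_powr_iff) simp
qed

lemma rho_sum_nonneg: "0 \<le> rho_sum"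
  unfolding rho_sum_def by (rule suminf_nonneg[OF rho_summable]) (simp add: rho_nonneg)

lemma rho_shift_summable: "summable (\<lambda>j. rho \<bar>real j - real n\<bar>)"
  and rho_shift_sum_le: "(\<Sum>j. rho \<bar>real j - real n\<bar>) \<le> 2 * rho_sum"
proof -
  have eq: "(\<lambda>j. rho \<bar>real (j + n) - real n\<bar>) = (\<lambda>j. rho (real j))" by simp
  show s: "summable (\<lambda>j. rho \<bar>real j - real n\<bar>)"
    by (subst summable_iff_shift[symmetric, of _ n], subst eq) (rule rho_summable)
  have "(\<Sum>j<n. rho \<bar>real j - real n\<bar>) = (\<Sum>j<n. rho (real (n - j)))"
    by (intro sum.cong) (auto simp: of_nat_diff)
  also have "\<dots> = (\<Sum>j<n. rho (real (Suc j)))"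
    using sum.nat_diff_reindex[of "\<lambda>i. rho (real (Suc i))" n] by (simp add: Suc_diff_Suc)
  also have "\<dots> \<le> (\<Sum>j. rho (real (Suc j)))"
  proof (rule sum_le_suminf)
    show "summable (\<lambda>j. rho (real (Suc j)))" using rho_summable by (subst summable_Suc_iff)
    show "0 \<le> rho (real (Suc j))" for j by (rule rho_nonneg) simp
  qed simp
  also have "\<dots> \<le> rho_sum"
    using suminf_split_head[OF rho_summable] by (simp add: rho_sum_def rho_def)
  finally have "(\<Sum>j<n. rho \<bar>real j - real n\<bar>) \<le> rho_sum" .
  moreover have "(\<Sum>j. rho \<bar>real j - real n\<bar>) = rho_sum + (\<Sum>j<n. rho \<bar>real j - real n\<bar>)"
    using suminf_split_initial_segment[OF s, of n] unfolding eq rho_sum_def .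
  ultimately show "(\<Sum>j. rho \<bar>real j - real n\<bar>) \<le> 2 * rho_sum" by simp
qed

lemma weight_nonneg: "0 \<le> weight n j"
  by (simp add: weight_def rho_nonneg)

lemma weight_summable: "summable (weight n)"
  unfolding weight_def[abs_def] by (rule summable_divide[OF rho_shift_summable])

lemma weight_sum_le: "suminf (weight n) \<le> 2 * rho_sum / sqrt (real n)"
  unfolding weight_def[abs_def] suminf_divide[OF rho_shift_summable]
  by (rule divide_right_mono[OF rho_shift_sum_le]) simp

definition disc :: "nat \<Rightarrow> complex set" where "disc n = ball (mu n) (2 * real n)"

text \<open>With \<open>d = \<bar>j - n\<bar>\<close> and \<open>s = j + n\<close>, the distance of \<open>z\<close> to \<open>mu j\<close> is at least \<open>d s\<close>, and \<open>s\<close> dominates both \<open>n\<close> and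
  \<open>d\<close>, hence the square root of \<open>n d\<close>. Splitting \<open>s\<close> in this way trades the sharp rate of the sum over \<open>j\<close>,
  \<open>ln n / n\<close>, for a summand depending on \<open>d\<close> only; the resulting \<open>n powr (- 1 / 2)\<close> suffices.\<close>

lemma disc_away_from_mu:
  assumes n: "1 \<le> n" and z: "z \<in> disc n" and j: "j \<noteq> n"
  shows "z \<noteq> mu j" and "1 / norm (z - mu j) \<le> weight n j"
    and "real j / norm (z - mu j) ^ 2 \<le> weight n j"
proof -
  define d s where "d = \<bar>real j - real n\<bar>" and "s = real j + real n"
  have d: "1 \<le> d" using j unfolding d_def by linarith
  have s: "d \<le> s" "real n \<le> s" "real j \<le> s" by (auto simp: d_def s_def)
  have s1: "1 \<le> s" using s n by linarith
  have "norm (mu n - mu j) = (2 * pi)\<^sup>2 * \<bar>real n ^ 2 - real j ^ 2\<bar>"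
    unfolding mu_def of_real_diff[symmetric] norm_of_real
    by (simp add: power_mult_distrib abs_mult flip: right_diff_distrib)
  also have "real n ^ 2 - real j ^ 2 = - ((real j - real n) * s)"
    by (simp add: s_def power2_eq_square algebra_simps)
  also have "\<bar>- ((real j - real n) * s)\<bar> = d * s" using s1 by (simp add: d_def abs_mult)
  finally have "norm (mu n - mu j) = (2 * pi)\<^sup>2 * (d * s)" .
  moreover have "3 * (d * s) \<le> (2 * pi)\<^sup>2 * (d * s)"
  proof (rule mult_right_mono)
    \<comment> \<open>a factor \<open>3\<close> is enough: the radius \<open>2 n\<close> of the disc takes away at most \<open>2 d s\<close>\<close>
    have "3 ^ 2 \<le> (2 * pi)\<^sup>2" by (rule power_mono) (use pi_gt3 in auto)
    then show "3 \<le> (2 * pi)\<^sup>2" by simp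
  qed (use d s1 in auto)
  moreover have "norm (mu n - mu j) \<le> norm (z - mu j) + norm (z - mu n)"
    using norm_triangle_ineq4[of "z - mu j" "z - mu n"] by simp
  moreover have "norm (z - mu n) < 2 * real n" using z by (simp add: disc_def dist_norm norm_minus_commute)
  moreover have "1 * s \<le> d * s" using d s1 by (intro mult_right_mono) auto
  ultimately have ds: "d * s \<le> norm (z - mu j)" using s(2) by linarith
  have ds0: "0 < d * s" using d s1 by simp
  show "z \<noteq> mu j" using ds ds0 by auto
  have "sqrt (real n) * sqrt d \<le> sqrt s * sqrt s"
    using s d by (intro mult_mono) auto
  then have "sqrt (real n) * sqrt d \<le> s" using s1 by simp
  then have "d * (sqrt (real n) * sqrt d) \<le> d * s" using d by (intro mult_left_mono) auto
  moreover have "0 < d * (sqrt (real n) * sqrt d)" using d n by simp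
  ultimately have "1 / (d * s) \<le> 1 / (d * (sqrt (real n) * sqrt d))" by (intro divide_left_mono) auto
  also have "\<dots> = weight n j" by (simp add: weight_def rho_def d_def mult_ac)
  finally have w: "1 / (d * s) \<le> weight n j" .
  have "1 / norm (z - mu j) \<le> 1 / (d * s)" by (rule frac_le) (use ds ds0 in simp_all)
  with w show "1 / norm (z - mu j) \<le> weight n j" by simp
  have "real j / norm (z - mu j) ^ 2 \<le> s / (d * s) ^ 2"
    using ds ds0 s(3) by (intro frac_le power_mono) auto
  also have "\<dots> = 1 / (d * (d * s))" using s1 d by (simp add: power2_eq_square)
  also have "\<dots> \<le> 1 / (1 * (d * s))" by (rule frac_le) (use mult_right_mono[OF d, of "d * s"] ds0 in simp_all)
  finally show "real j / norm (z - mu j) ^ 2 \<le> weight n j" using w by simp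
qed

lemma T1_op_continuous: "T1_op q \<beta> y f \<Longrightarrow> continuous_on {0..1} y"
  unfolding T1_op_def by (meson continuous_on_eq_continuous_within has_vector_derivative_continuous)

lemma coef_False_0: "coef \<beta> h False 0 = 0" by (simp add: test_fun_False sn_def)

locale sturm =
  fixes q :: "real \<Rightarrow> complex" and \<beta> :: complex
  assumes q: "q absolutely_integrable_on {0..1}" and \<beta>: "\<beta> \<noteq> 1" "\<beta> \<noteq> -1"
begin

abbreviation "\<gamma> \<equiv> gamma1 \<beta>"

definition q_matrix :: "bool \<Rightarrow> nat \<Rightarrow> bool \<Rightarrow> nat \<Rightarrow> complex" where
  "q_matrix t i s j = coef \<beta> (\<lambda>x. q x * basis_fun \<beta> s j x) t i"

definition q_bound :: real where
  "q_bound = fun_bound \<beta> * fun_bound \<beta> * (LINT x:{0..1}|lebesgue. norm (q x))"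

lemma coef_bounded:
  assumes "g absolutely_integrable_on {0..1}"
  shows "norm (coef \<beta> g t i) \<le> fun_bound \<beta> * (LINT x:{0..1}|lebesgue. norm (g x))"
  by (rule norm_I01_mult_le[OF assms continuous_test_fun norm_test_basis_le(1)])

lemma q_matrix_le: "norm (q_matrix t i s j) \<le> q_bound"
proof -
  have "norm (I01 (\<lambda>x. q x * (basis_fun \<beta> s j x * test_fun \<beta> t i x))) \<le> fun_bound \<beta> * fun_bound \<beta> * (LINT x:{0..1}|lebesgue. norm (q x))"
  proof (rule norm_I01_mult_le[OF q])
    fix x :: real assume x: "x \<in> {0..1}"
    show "norm (basis_fun \<beta> s j x * test_fun \<beta> t i x) \<le> fun_bound \<beta> * fun_bound \<beta>"
      unfolding norm_mult by (intro mult_mono norm_test_basis_le x) (use fun_bound_ge_1[of \<beta>] in auto)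
  qed (intro continuous_on_mult continuous_basis_fun continuous_test_fun)
  then show ?thesis by (simp add: q_matrix_def q_bound_def mult.assoc)
qed

lemma q_bound_nonneg: "0 \<le> q_bound" using order_trans[OF norm_ge_zero q_matrix_le] .

text \<open>The matrix that expresses the tested \<open>q y\<close> through itself; see \<open>kern_coefs\<close>.\<close>

definition kern :: "complex \<Rightarrow> bool \<Rightarrow> nat \<Rightarrow> bool \<Rightarrow> nat \<Rightarrow> complex" where
  "kern z t i s j = q_matrix t i s j / (z - mu j) +
     (if s then 0 else \<gamma> * of_nat j * q_matrix t i True j / (z - mu j)\<^sup>2)"

lemma kern_coefs:
  "coef_a q \<beta> z i j = kern z False i False j" "coef_b q z i j = kern z False i True j"
  "coef_A q \<beta> z i j = kern z True i False j" "coef_B q \<beta> z i j = kern z True i True j"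
  by (simp_all add: coef_a_def coef_b_def coef_A_def coef_B_def kern_def q_matrix_def inner01_sn[of _ _ \<beta>]
      inner01_phi_star basis_fun_def)

lemma kern_bound:
  assumes n: "1 \<le> n" and z: "z \<in> disc n" and j: "j \<noteq> n"
  shows "norm (kern z t i s j) \<le> q_bound * (1 + norm \<gamma>) * weight n j"
proof -
  note d = disc_away_from_mu[OF n z j]
  have 1: "norm (q_matrix t i s j / (z - mu j)) \<le> q_bound * weight n j" for s
    using mult_mono[OF q_matrix_le d(2) q_bound_nonneg] by (simp add: norm_divide)
  have 2: "norm (\<gamma> * of_nat j * q_matrix t i True j / (z - mu j)\<^sup>2) \<le> norm \<gamma> * (q_bound * weight n j)"
  proof -
    have "norm (\<gamma> * of_nat j * q_matrix t i True j / (z - mu j)\<^sup>2) =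
      norm \<gamma> * (norm (q_matrix t i True j) * (real j / norm (z - mu j) ^ 2))"
      by (simp add: norm_divide norm_mult norm_power)
    also have "\<dots> \<le> norm \<gamma> * (q_bound * weight n j)"
      by (intro mult_left_mono mult_mono q_matrix_le d(3) q_bound_nonneg) auto
    finally show ?thesis .
  qed
  have 3: "0 \<le> norm \<gamma> * (q_bound * weight n j)" by (simp add: q_bound_nonneg weight_nonneg)
  have "norm (kern z t i s j) \<le> q_bound * weight n j + norm \<gamma> * (q_bound * weight n j)"
    unfolding kern_def by (rule norm_triangle_le, rule add_mono[OF 1]) (use 2 3 in simp)
  then show ?thesis by (simp add: algebra_simps)
qed

lemma kern_holomorphic:
  assumes n: "1 \<le> n" and j: "j \<noteq> n"
  shows "(\<lambda>z. kern z t i s j) holomorphic_on disc n"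
  unfolding kern_def
  by (cases s) (auto intro!: holomorphic_intros dest: disc_away_from_mu(1)[OF n _ j])

text \<open>The equation \<open>(T1 - z) y = r\<close>, stated for the coefficients of \<open>y\<close>. In this form it is
  linear in \<open>(y, r)\<close>, and a change of \<open>z\<close> is absorbed by \<open>r\<close>.\<close>

definition weak_solution :: "complex \<Rightarrow> (real \<Rightarrow> complex) \<Rightarrow> (real \<Rightarrow> complex) \<Rightarrow> bool" where
  "weak_solution z y r \<longleftrightarrow> continuous_on {0..1} y \<and> y 0 = y 1 \<and>
     (\<forall>m. (z - mu m) * coef \<beta> y False m = coef \<beta> (\<lambda>x. q x * y x) False m - coef \<beta> r False m \<and>
          (z - mu m) * coef \<beta> y True m - \<gamma> * of_nat m * coef \<beta> y False m =
            coef \<beta> (\<lambda>x. q x * y x) True m - coef \<beta> r True m)"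

lemma coef_lin:
  assumes "f absolutely_integrable_on {0..1}" "g absolutely_integrable_on {0..1}"
  shows "coef \<beta> (\<lambda>x. a * f x + b * g x) t m = a * coef \<beta> f t m + b * coef \<beta> g t m"
proof -
  have "coef \<beta> (\<lambda>x. a * f x + b * g x) t m = I01 (\<lambda>x. a * (f x * test_fun \<beta> t m x) + b * (g x * test_fun \<beta> t m x))"
    by (simp add: algebra_simps)
  also have "\<dots> = I01 (\<lambda>x. a * (f x * test_fun \<beta> t m x)) + I01 (\<lambda>x. b * (g x * test_fun \<beta> t m x))"
    by (intro I01_add set_integrable_mult_right abs_int_mult_continuous continuous_test_fun assms)
  finally show ?thesis unfolding I01_mult .
qed

lemma coef_lin_continuous:
  assumes "continuous_on {0..1} f" "continuous_on {0..1} g"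
  shows "coef \<beta> (\<lambda>x. a * f x + b * g x) t m = a * coef \<beta> f t m + b * coef \<beta> g t m"
  using assms by (intro coef_lin abs_int_continuous)

lemma T1_op_iff_weak_solution:
  assumes r: "continuous_on {0..1} r"
  shows "T1_op q \<beta> y (\<lambda>x. z * y x + r x) \<longleftrightarrow> weak_solution z y r"
proof -
  have key: "(coef \<beta> (\<lambda>x. z * y x + r x) False m - coef \<beta> (\<lambda>x. q x * y x) False m = mu m * coef \<beta> y False m \<and>
      coef \<beta> (\<lambda>x. z * y x + r x) True m - coef \<beta> (\<lambda>x. q x * y x) True m =
        mu m * coef \<beta> y True m + \<gamma> * of_nat m * coef \<beta> y False m) \<longleftrightarrow>
     ((z - mu m) * coef \<beta> y False m = coef \<beta> (\<lambda>x. q x * y x) False m - coef \<beta> r False m \<and>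
          (z - mu m) * coef \<beta> y True m - \<gamma> * of_nat m * coef \<beta> y False m =
            coef \<beta> (\<lambda>x. q x * y x) True m - coef \<beta> r True m)"
    if y: "continuous_on {0..1} y" for m
    using coef_lin_continuous[OF y r, of z 1] by (simp add: algebra_simps)
  have f: "continuous_on {0..1} (\<lambda>x. z * y x + r x)" if "continuous_on {0..1} y"
    using that r by (intro continuous_intros)
  show ?thesis
  proof
    assume op: "T1_op q \<beta> y (\<lambda>x. z * y x + r x)"
    have y: "continuous_on {0..1} y" by (rule T1_op_continuous[OF op])
    show "weak_solution z y r"
      unfolding weak_solution_def using T1_op_coef_eqs[OF \<beta> q f[OF y] op] key[OF y] by blast
  next
    assume w: "weak_solution z y r"
    then have y: "continuous_on {0..1} y" "y 0 = y 1" by (simp_all add: weak_solution_def)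
    show "T1_op q \<beta> y (\<lambda>x. z * y x + r x)"
      by (rule T1_opI_coef_eqs[OF \<beta> q f[OF y(1)] y]; use w key[OF y(1)] in \<open>unfold weak_solution_def, blast\<close>)
  qed
qed

lemma weak_solution_lin:
  assumes y: "weak_solution z y r" and r: "continuous_on {0..1} r"
    and y': "weak_solution z y' r'" and r': "continuous_on {0..1} r'"
  shows "weak_solution z (\<lambda>x. a * y x + b * y' x) (\<lambda>x. a * r x + b * r' x)"
proof -
  have c: "continuous_on {0..1} y" "continuous_on {0..1} y'" using y y' by (simp_all add: weak_solution_def)
  have "coef \<beta> (\<lambda>x. q x * (a * y x + b * y' x)) t m = coef \<beta> (\<lambda>x. a * (q x * y x) + b * (q x * y' x)) t m" for t m
    by (simp add: algebra_simps)
  also have "\<dots> t m = a * coef \<beta> (\<lambda>x. q x * y x) t m + b * coef \<beta> (\<lambda>x. q x * y' x) t m" for t m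
    by (intro coef_lin abs_int_mult_continuous q c)
  finally have qc: "coef \<beta> (\<lambda>x. q x * (a * y x + b * y' x)) t m = a * coef \<beta> (\<lambda>x. q x * y x) t m + b * coef \<beta> (\<lambda>x. q x * y' x) t m" for t m .
  have E: "(z - mu m) * coef \<beta> y False m = coef \<beta> (\<lambda>x. q x * y x) False m - coef \<beta> r False m"
    "(z - mu m) * coef \<beta> y True m - \<gamma> * of_nat m * coef \<beta> y False m = coef \<beta> (\<lambda>x. q x * y x) True m - coef \<beta> r True m"
    "(z - mu m) * coef \<beta> y' False m = coef \<beta> (\<lambda>x. q x * y' x) False m - coef \<beta> r' False m"
    "(z - mu m) * coef \<beta> y' True m - \<gamma> * of_nat m * coef \<beta> y' False m = coef \<beta> (\<lambda>x. q x * y' x) True m - coef \<beta> r' True m"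
    for m using y y' unfolding weak_solution_def by blast+
  have "(z - mu m) * (a * coef \<beta> y False m + b * coef \<beta> y' False m) =
    a * ((z - mu m) * coef \<beta> y False m) + b * ((z - mu m) * coef \<beta> y' False m)" for m
    by (simp add: algebra_simps)
  then have F: "(z - mu m) * (a * coef \<beta> y False m + b * coef \<beta> y' False m) =
    a * coef \<beta> (\<lambda>x. q x * y x) False m + b * coef \<beta> (\<lambda>x. q x * y' x) False m - (a * coef \<beta> r False m + b * coef \<beta> r' False m)" for m
    unfolding E by (simp add: algebra_simps)
  have "(z - mu m) * (a * coef \<beta> y True m + b * coef \<beta> y' True m) - \<gamma> * of_nat m * (a * coef \<beta> y False m + b * coef \<beta> y' False m) =
    a * ((z - mu m) * coef \<beta> y True m - \<gamma> * of_nat m * coef \<beta> y False m) + b * ((z - mu m) * coef \<beta> y' True m - \<gamma> * of_nat m * coef \<beta> y' False m)" for m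
    by (simp add: algebra_simps)
  then have T: "(z - mu m) * (a * coef \<beta> y True m + b * coef \<beta> y' True m) - \<gamma> * of_nat m * (a * coef \<beta> y False m + b * coef \<beta> y' False m) =
    a * coef \<beta> (\<lambda>x. q x * y x) True m + b * coef \<beta> (\<lambda>x. q x * y' x) True m - (a * coef \<beta> r True m + b * coef \<beta> r' True m)" for m
    unfolding E by (simp add: algebra_simps)
  have "a * y 0 + b * y' 0 = a * y 1 + b * y' 1" using y y' by (simp add: weak_solution_def)
  then show ?thesis
    unfolding weak_solution_def coef_lin_continuous[OF c] coef_lin_continuous[OF r r'] qc
    using F T c by (intro conjI allI continuous_on_add continuous_on_mult continuous_on_const) auto
qed

lemma weak_solution_shift:
  assumes y: "weak_solution z y r" and r: "continuous_on {0..1} r"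
  shows "weak_solution z' y (\<lambda>x. r x + (z - z') * y x)"
proof -
  have c: "continuous_on {0..1} y" using y by (simp add: weak_solution_def)
  have "coef \<beta> (\<lambda>x. r x + (z - z') * y x) t m = coef \<beta> r t m + (z - z') * coef \<beta> y t m" for t m
    using coef_lin_continuous[OF r c, of 1 "z - z'"] by simp
  then show ?thesis using y unfolding weak_solution_def by (simp add: algebra_simps)
qed

lemma weak_solution_zero_rhs:
  assumes w: "weak_solution z (\<lambda>x. 0) r" and r: "continuous_on {0..1} r" "r 0 = r 1" and x: "x \<in> {0..1}"
  shows "r x = 0"
proof (rule basis_complete[OF \<beta> r _ x])
  show "coef \<beta> r t m = 0" for t m using w by (cases t) (simp_all add: weak_solution_def)
qed

lemma weak_solution_cong:
  assumes "weak_solution z y r" "\<And>x. x \<in> {0..1} \<Longrightarrow> y x = y' x" "\<And>x. x \<in> {0..1} \<Longrightarrow> r x = r' x"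
  shows "weak_solution z y' r'"
proof -
  have "continuous_on {0..1} y" using assms(1) by (simp add: weak_solution_def)
  then have "continuous_on {0..1} y'" by (rule continuous_on_eq[OF _ assms(2)])
  moreover have "coef \<beta> y' t m = coef \<beta> y t m" "coef \<beta> r' t m = coef \<beta> r t m"
    "coef \<beta> (\<lambda>x. q x * y' x) t m = coef \<beta> (\<lambda>x. q x * y x) t m" for t m
    by (intro I01_cong; use assms(2,3) in simp)+
  ultimately show ?thesis using assms(1) assms(2)[of 0] assms(2)[of 1] by (simp add: weak_solution_def)
qed

text \<open>The second condition makes the kernel contracting, the third keeps the off-diagonal entry \<open>D21\<close> of the reduced system
  away from zero.\<close>

definition large :: "nat \<Rightarrow> bool" where
  "large n \<longleftrightarrow> 1 \<le> n \<and> 8 * (q_bound * (1 + norm \<gamma>)) * rho_sum \<le> sqrt (real n) \<and> 4 * q_bound \<le> norm \<gamma> * real n"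

lemma eventually_large: "eventually large sequentially"
proof -
  have "filterlim (\<lambda>n. sqrt (real n)) at_top sequentially"
    by (rule filterlim_compose[OF sqrt_at_top filterlim_real_sequentially])
  then have 1: "\<forall>\<^sub>F n in sequentially. 8 * (q_bound * (1 + norm \<gamma>)) * rho_sum \<le> sqrt (real n)"
    unfolding filterlim_at_top by (rule spec)
  have "0 < norm \<gamma>" using gamma1_nonzero[OF \<beta>] by simp
  then have "filterlim (\<lambda>n. norm \<gamma> * real n) at_top sequentially"
    by (intro filterlim_tendsto_pos_mult_at_top[OF tendsto_const] filterlim_real_sequentially)
  then have 2: "\<forall>\<^sub>F n in sequentially. 4 * q_bound \<le> norm \<gamma> * real n"
    unfolding filterlim_at_top by (rule spec)
  show ?thesis
    using 1 2 eventually_ge_at_top[of "1::nat"] by eventually_elim (simp only: large_def)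
qed

end

section \<open>Reduction to a scalar equation\<close>

locale sturm_large = sturm +
  fixes n :: nat
  assumes large: "large n"
begin

lemma n_ge_1: "1 \<le> n" using large by (simp add: large_def)

sublocale small_kernel kern "disc n" n "\<lambda>j. q_bound * (1 + norm \<gamma>) * weight n j"
proof
  show "open (disc n)" by (simp add: disc_def)
  have C: "0 \<le> q_bound * (1 + norm \<gamma>)" by (simp add: q_bound_nonneg)
  show "0 \<le> q_bound * (1 + norm \<gamma>) * weight n j" for j
    by (rule mult_nonneg_nonneg[OF C weight_nonneg])
  show "summable (\<lambda>j. q_bound * (1 + norm \<gamma>) * weight n j)" by (rule summable_mult[OF weight_summable])
  have "(\<Sum>j. q_bound * (1 + norm \<gamma>) * weight n j) = q_bound * (1 + norm \<gamma>) * suminf (weight n)"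
    by (rule suminf_mult[OF weight_summable])
  also have "\<dots> \<le> q_bound * (1 + norm \<gamma>) * (2 * rho_sum / sqrt (real n))"
    by (rule mult_left_mono[OF weight_sum_le C])
  also have "4 * \<dots> = 8 * (q_bound * (1 + norm \<gamma>)) * rho_sum / sqrt (real n)" by simp
  also have "\<dots> \<le> 1" using large by (simp add: large_def divide_le_eq)
  finally show "4 * (\<Sum>j. q_bound * (1 + norm \<gamma>) * weight n j) \<le> 1" by simp
  show "norm (kern z t i s j) \<le> q_bound * (1 + norm \<gamma>) * weight n j" if "z \<in> disc n" "j \<noteq> n" for z t i s j
    by (rule kern_bound[OF n_ge_1 that])
  show "(\<lambda>z. kern z t i s j) holomorphic_on disc n" if "j \<noteq> n" for t i s j
    by (rule kern_holomorphic[OF n_ge_1 that])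
qed

definition col :: "bool \<Rightarrow> bool \<Rightarrow> nat \<Rightarrow> complex" where "col s t i = q_matrix t i s n"

lemma col_bounded: "bounded_by (col s) q_bound"
  by (simp add: bounded_by_def col_def q_matrix_le)

lemma coef_bounded_by:
  assumes "r absolutely_integrable_on {0..1}"
  shows "bounded_by (coef \<beta> r) (fun_bound \<beta> * (LINT x:{0..1}|lebesgue. norm (r x)))"
  using coef_bounded[OF assms] by (simp add: bounded_by_def)

text \<open>The coefficients of \<open>y\<close> as functions of the residual \<open>X\<close> and of the two coefficients of index \<open>n\<close>, obtained by solving the
  triangular system for each index \<open>j \<noteq> n\<close>.\<close>

definition coef_of :: "complex \<Rightarrow> complex \<Rightarrow> complex \<Rightarrow> (bool \<Rightarrow> nat \<Rightarrow> complex) \<Rightarrow> bool \<Rightarrow> nat \<Rightarrow> complex" where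
  "coef_of z u v X t j =
     (if j = n then if t then v else u
      else if t then X True j / (z - mu j) + \<gamma> * of_nat j * X False j / (z - mu j)\<^sup>2
      else X False j / (z - mu j))"

lemma norm_coef_of_le:
  assumes z: "z \<in> disc n" and X: "bounded_by X B" and j: "j \<noteq> n"
  shows "norm (coef_of z u v X False j) + norm (coef_of z u v X True j) \<le> B * (2 + norm \<gamma>) * weight n j"
proof -
  note d = disc_away_from_mu[OF n_ge_1 z j]
  have 1: "norm (X t j / (z - mu j)) \<le> B * weight n j" for t
    using mult_mono[OF bounded_byD[OF X] d(2) bounded_by_nonneg[OF X]] by (simp add: norm_divide)
  have 2: "norm (\<gamma> * of_nat j * X False j / (z - mu j)\<^sup>2) \<le> norm \<gamma> * (B * weight n j)"
  proof -
    have "norm (\<gamma> * of_nat j * X False j / (z - mu j)\<^sup>2) =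
      norm \<gamma> * (norm (X False j) * (real j / norm (z - mu j) ^ 2))"
      by (simp add: norm_divide norm_mult norm_power)
    also have "\<dots> \<le> norm \<gamma> * (B * weight n j)"
      by (intro mult_left_mono mult_mono bounded_byD[OF X] d(3) bounded_by_nonneg[OF X]) auto
    finally show ?thesis .
  qed
  have "norm (coef_of z u v X True j) \<le> B * weight n j + norm \<gamma> * (B * weight n j)"
    using j unfolding coef_of_def by simp (rule norm_triangle_le, rule add_mono[OF 1 2])
  moreover have "norm (coef_of z u v X False j) \<le> B * weight n j"
    using j 1[of False] unfolding coef_of_def by simp
  ultimately show ?thesis by (simp add: algebra_simps)
qed

lemma coef_of_summable:
  assumes z: "z \<in> disc n" and X: "bounded_by X B"
  shows "summable (\<lambda>j. norm (coef_of z u v X False j) + norm (coef_of z u v X True j))"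
proof (rule summable_comparison_test)
  show "summable (\<lambda>j. (if j = n then norm u + norm v else 0) + B * (2 + norm \<gamma>) * weight n j)"
    by (intro summable_add summable_mult weight_summable sums_summable[OF sums_single])
  have B: "0 \<le> B * (2 + norm \<gamma>) * weight n j" for j
    using bounded_by_nonneg[OF X] by (simp add: weight_nonneg)
  show "\<exists>N. \<forall>j\<ge>N. norm (norm (coef_of z u v X False j) + norm (coef_of z u v X True j))
      \<le> (if j = n then norm u + norm v else 0) + B * (2 + norm \<gamma>) * weight n j"
    using norm_coef_of_le[OF z X, of _ u v] B by (auto simp: coef_of_def[of _ _ _ _ _ n])
qed

lemma coef_of_tail:
  assumes z: "z \<in> disc n" and X: "bounded_by X B"
    and y: "\<And>x. x \<in> {0..1} \<Longrightarrow> y x = (\<Sum>j. basis_term \<beta> (coef_of z u v X) j x)" and x: "x \<in> {0..1}"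
  shows "norm (y x - (u * basis_fun \<beta> False n x + v * basis_fun \<beta> True n x)) \<le>
    fun_bound \<beta> * (B * (2 + norm \<gamma>)) * (2 * rho_sum / sqrt (real n))"
proof -
  let ?t = "\<lambda>j. basis_term \<beta> (coef_of z u v X) j x"
  let ?C = "fun_bound \<beta> * (B * (2 + norm \<gamma>))"
  have C: "0 \<le> ?C" using fun_bound_ge_1[of \<beta>] bounded_by_nonneg[OF X] by simp
  have "?t sums y x" by (rule basis_series_sums[OF coef_of_summable[OF z X] y x])
  then have "(\<lambda>j. ?t j - (if j = n then ?t j else 0)) sums (y x - ?t n)"
    by (rule sums_diff[OF _ sums_single])
  then have "norm (y x - ?t n) = norm (\<Sum>j. ?t j - (if j = n then ?t j else 0))" by (simp add: sums_iff)
  also have "\<dots> \<le> (\<Sum>j. ?C * weight n j)"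
  proof (rule norm_suminf_le)
    show "summable (\<lambda>j. ?C * weight n j)" by (rule summable_mult[OF weight_summable])
    show "norm (?t j - (if j = n then ?t j else 0)) \<le> ?C * weight n j" for j
    proof (cases "j = n")
      case False
      have "norm (?t j) \<le> fun_bound \<beta> * (B * (2 + norm \<gamma>) * weight n j)"
        by (rule order_trans[OF norm_basis_term_le[OF x]], rule mult_left_mono[OF norm_coef_of_le[OF z X False]])
           (use fun_bound_ge_1[of \<beta>] in simp)
      with False show ?thesis by (simp add: mult.assoc)
    qed (use C weight_nonneg in simp)
  qed
  also have "\<dots> = ?C * suminf (weight n)" by (rule suminf_mult[OF weight_summable])
  also have "\<dots> \<le> ?C * (2 * rho_sum / sqrt (real n))" by (rule mult_left_mono[OF weight_sum_le C])
  finally show ?thesis by (simp add: basis_term_def coef_of_def)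
qed

text \<open>Integrating the expansion of \<open>y\<close> against \<open>q\<close> term by term produces exactly the kernel, since \<open>coef_of\<close>
  contains the denominators that occur in it.\<close>

lemma coef_q_series:
  assumes z: "z \<in> disc n" and X: "bounded_by X B"
    and y: "\<And>x. x \<in> {0..1} \<Longrightarrow> y x = (\<Sum>j. basis_term \<beta> (coef_of z u v X) j x)"
  shows "coef \<beta> (\<lambda>x. q x * y x) t i = u * col False t i + v * col True t i + K z X t i"
proof -
  let ?c = "coef_of z u v X"
  have "(\<lambda>j. ?c False j * q_matrix t i False j + ?c True j * q_matrix t i True j) sums coef \<beta> (\<lambda>x. q x * y x) t i"
    unfolding q_matrix_def by (rule basis_series_integral[OF coef_of_summable[OF z X] y q continuous_test_fun])
  moreover have "?c False j * q_matrix t i False j + ?c True j * q_matrix t i True j =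
    (if j = n then u * col False t i + v * col True t i else 0) + K_term z X t i j" for j
    by (simp add: coef_of_def K_term_def kern_def col_def algebra_simps add_divide_distrib)
  moreover have "(\<lambda>j. (if j = n then u * col False t i + v * col True t i else 0) + K_term z X t i j)
    sums (u * col False t i + v * col True t i + K z X t i)"
    unfolding K_def
    by (intro sums_add sums_single summable_sums summable_norm_cancel[OF K_term_summable[OF z X]])
  ultimately show ?thesis using sums_unique2 by (simp only:)
qed

lemma solution_combination:
  assumes z: "z \<in> disc n" and \<rho>: "bounded_by \<rho> B"
  shows "solution z (\<lambda>t i. u * col False t i + v * col True t i + (-1) * \<rho> t i) t i =
    u * solution z (col False) t i + v * solution z (col True) t i - solution z \<rho> t i"
  using solution_add[OF z bounded_by_add[OF bounded_by_scale[OF col_bounded] bounded_by_scale[OF col_bounded]] bounded_by_scale[OF \<rho>], of u False v True "-1" t i]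
    solution_add[OF z bounded_by_scale[OF col_bounded] bounded_by_scale[OF col_bounded], of u False v True t i]
    solution_scale[OF z col_bounded] solution_scale[OF z \<rho>, of "-1"] by simp

text \<open>The entries of the system for \<open>(u, v)\<close> formed by the two equations of index \<open>n\<close>.\<close>

definition D11 where "D11 z = z - mu n - solution z (col False) False n"
definition D12 where "D12 z = - solution z (col True) False n"
definition D21 where "D21 z = - (\<gamma> * of_nat n + solution z (col False) True n)"
definition D22 where "D22 z = z - mu n - solution z (col True) True n"

definition char_fun where "char_fun z = D11 z * D22 z - D12 z * D21 z"

text \<open>The right side that results when \<open>u\<close> is eliminated from the system by Cramer's rule.\<close>

definition rhs_functional where
  "rhs_functional z r = D21 z * solution z (coef \<beta> r) False n - D11 z * solution z (coef \<beta> r) True n"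

lemma D21_lower: assumes z: "z \<in> disc n" shows "norm \<gamma> * real n / 2 \<le> norm (D21 z)"
proof -
  have "norm (solution z (col False) True n) \<le> 2 * q_bound"
    using bounded_byD[OF solution_bounded_by[OF z col_bounded]] .
  moreover have "4 * q_bound \<le> norm \<gamma> * real n" using large by (simp add: large_def)
  moreover have "norm (\<gamma> * of_nat n) \<le> norm (D21 z) + norm (solution z (col False) True n)"
    using norm_triangle_ineq4[of "\<gamma> * of_nat n + solution z (col False) True n" "solution z (col False) True n"]
    unfolding D21_def norm_minus_cancel by simp
  ultimately show ?thesis by (simp add: norm_mult)
qed

lemma D21_nonzero: "z \<in> disc n \<Longrightarrow> D21 z \<noteq> 0"
proof
  assume z: "z \<in> disc n" "D21 z = 0"
  have "0 < norm \<gamma> * real n / 2" using gamma1_nonzero[OF \<beta>] n_ge_1 by simp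
  with D21_lower[OF z(1)] z(2) show False by simp
qed

text \<open>The residual \<open>X\<close> is bounded and solves the fixed point equation, so it is the Neumann series; inserting it into
  the equations of index \<open>n\<close> gives the reduced system.\<close>

lemma weak_solution_reduction:
  assumes z: "z \<in> disc n" and y: "weak_solution z y r" and r: "continuous_on {0..1} r"
  defines "X \<equiv> \<lambda>t i. coef \<beta> (\<lambda>x. q x * y x) t i - coef \<beta> r t i"
    and "u \<equiv> coef \<beta> y False n" and "v \<equiv> coef \<beta> y True n"
  shows "X t i = u * solution z (col False) t i + v * solution z (col True) t i - solution z (coef \<beta> r) t i"
    and "x \<in> {0..1} \<Longrightarrow> y x = (\<Sum>j. basis_term \<beta> (coef_of z u v X) j x)"
    and "D11 z * u + D12 z * v = - solution z (coef \<beta> r) False n"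
    and "D21 z * u + D22 z * v = - solution z (coef \<beta> r) True n"
    and "char_fun z * v = rhs_functional z r"
proof -
  have yc: "continuous_on {0..1} y" "y 0 = y 1" using y by (simp_all add: weak_solution_def)
  have E: "(z - mu m) * coef \<beta> y False m = X False m"
    "(z - mu m) * coef \<beta> y True m - \<gamma> * of_nat m * coef \<beta> y False m = X True m" for m
    using y unfolding weak_solution_def X_def by blast+
  have rb: "bounded_by (coef \<beta> r) (fun_bound \<beta> * (LINT x:{0..1}|lebesgue. norm (r x)))"
    by (rule coef_bounded_by[OF abs_int_continuous[OF r]])
  obtain B where X: "bounded_by X B"
    using bounded_by_add[OF coef_bounded_by[OF abs_int_mult_continuous[OF q yc(1)]] bounded_by_scale[OF rb, of "-1"]]
    by (auto simp: X_def)
  have cc: "coef \<beta> y t m = coef_of z u v X t m" for t m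
  proof (cases "m = n")
    case False
    then have "z - mu m \<noteq> 0" using disc_away_from_mu(1)[OF n_ge_1 z] by simp
    moreover from this have F: "coef \<beta> y False m = X False m / (z - mu m)"
      using E(1)[of m] by (simp add: field_simps)
    moreover have "(z - mu m) * coef \<beta> y True m = X True m + \<gamma> * of_nat m * coef \<beta> y False m"
      using E(2)[of m] by (simp add: algebra_simps)
    ultimately have "coef \<beta> y True m = (X True m + \<gamma> * of_nat m * (X False m / (z - mu m))) / (z - mu m)"
      by (metis nonzero_mult_div_cancel_left)
    then have "coef \<beta> y True m = X True m / (z - mu m) + \<gamma> * of_nat m * X False m / (z - mu m)\<^sup>2"
      by (simp add: add_divide_distrib power2_eq_square)
    with F False show ?thesis by (cases t) (simp_all add: coef_of_def)
  qed (simp add: coef_of_def u_def v_def)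
  have c: "coef \<beta> y = coef_of z u v X" by (intro ext cc)
  have series: "y x = (\<Sum>j. basis_term \<beta> (coef_of z u v X) j x)" if "x \<in> {0..1}" for x
  proof -
    have "summable (\<lambda>j. norm (coef \<beta> y False j) + norm (coef \<beta> y True j))"
      unfolding cc by (rule coef_of_summable[OF z X])
    from basis_expansion[OF \<beta> yc this that] show ?thesis unfolding c .
  qed
  then show "x \<in> {0..1} \<Longrightarrow> y x = (\<Sum>j. basis_term \<beta> (coef_of z u v X) j x)" .
  have "X t i = u * col False t i + v * col True t i + (-1) * coef \<beta> r t i + K z X t i" for t i
    unfolding X_def using coef_q_series[OF z X series, of t i] by (simp add: X_def)
  then have "X t i = solution z (\<lambda>t i. u * col False t i + v * col True t i + (-1) * coef \<beta> r t i) t i" for t i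
    by (rule solution_eqI[OF z bounded_by_add[OF bounded_by_add[OF bounded_by_scale[OF col_bounded] bounded_by_scale[OF col_bounded]] bounded_by_scale[OF rb]] X])
  then show Xs: "X t i = u * solution z (col False) t i + v * solution z (col True) t i - solution z (coef \<beta> r) t i" for t i
    unfolding solution_combination[OF z rb] .
  show 1: "D11 z * u + D12 z * v = - solution z (coef \<beta> r) False n"
    using E(1)[of n] Xs[of False n] by (simp add: D11_def D12_def u_def v_def algebra_simps)
  show 2: "D21 z * u + D22 z * v = - solution z (coef \<beta> r) True n"
    using E(2)[of n] Xs[of True n] by (simp add: D21_def D22_def u_def v_def algebra_simps)
  have "char_fun z * v = D11 z * (D21 z * u + D22 z * v) - D21 z * (D11 z * u + D12 z * v)"
    by (simp add: char_fun_def algebra_simps)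
  then show "char_fun z * v = rhs_functional z r"
    unfolding 1 2 by (simp add: rhs_functional_def)
qed

text \<open>The converse of the reduction: \<open>u\<close> is determined by the second equation, the residual by the Neumann series, and the
  series with the corresponding coefficients is the wanted function.\<close>

lemma weak_solution_exists:
  assumes z: "z \<in> disc n" and r: "continuous_on {0..1} r" and c: "char_fun z * c = rhs_functional z r"
  obtains y where "weak_solution z y r" "coef \<beta> y True n = c" "\<And>x. x \<notin> {0..1} \<Longrightarrow> y x = 0"
proof -
  have rb: "bounded_by (coef \<beta> r) (fun_bound \<beta> * (LINT x:{0..1}|lebesgue. norm (r x)))"
    by (rule coef_bounded_by[OF abs_int_continuous[OF r]])
  let ?s = "solution z (coef \<beta> r)"
  define u where "u = (- ?s True n - D22 z * c) / D21 z"
  have 2: "D21 z * u + D22 z * c = - ?s True n" using D21_nonzero[OF z] by (simp add: u_def)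
  \<comment> \<open>the scalar equation is what makes the first equation follow from the second\<close>
  have "D21 z * (D11 z * u + D12 z * c) = D11 z * (D21 z * u + D22 z * c) - char_fun z * c"
    by (simp add: char_fun_def algebra_simps)
  also have "\<dots> = D21 z * - ?s False n" unfolding 2 c by (simp add: rhs_functional_def)
  finally have 1: "D11 z * u + D12 z * c = - ?s False n" unfolding mult_left_cancel[OF D21_nonzero[OF z]] .
  define X where "X = solution z (\<lambda>t i. u * col False t i + c * col True t i + (-1) * coef \<beta> r t i)"
  note X0b = bounded_by_add[OF bounded_by_add[OF bounded_by_scale[OF col_bounded] bounded_by_scale[OF col_bounded]] bounded_by_scale[OF rb], of u False c True "-1"]
  obtain B where X: "bounded_by X B" using solution_bounded_by[OF z X0b] unfolding X_def by blast
  have Xs: "X t i = u * solution z (col False) t i + c * solution z (col True) t i - ?s t i" for t i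
    unfolding X_def by (rule solution_combination[OF z rb])
  have Xeq: "X t i = u * col False t i + c * col True t i + (-1) * coef \<beta> r t i + K z X t i" for t i
    unfolding X_def by (rule solution_eq[OF z X0b])
  define y where "y x = (if x \<in> {0..1} then \<Sum>j. basis_term \<beta> (coef_of z u c X) j x else 0)" for x
  have series: "y x = (\<Sum>j. basis_term \<beta> (coef_of z u c X) j x)" if "x \<in> {0..1}" for x
    using that by (simp add: y_def)
  have q: "coef \<beta> (\<lambda>x. q x * y x) t i - coef \<beta> r t i = X t i" for t i
  proof -
    have "coef \<beta> (\<lambda>x. q x * y x) t i = u * col False t i + c * col True t i + K z X t i"
      by (rule coef_q_series[OF z X series])
    then show ?thesis using Xeq[of t i] by simp
  qed
  note yc = basis_series_continuous[OF coef_of_summable[OF z X] series] basis_series_ends[OF coef_of_summable[OF z X] series]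
  have cT: "coef \<beta> y True m = coef_of z u c X True m" for m
    by (rule basis_series_coef[OF coef_of_summable[OF z X] series \<beta>]) simp_all
  have cF: "coef \<beta> y False m = coef_of z u c X False m" if "m \<noteq> 0" for m
    by (rule basis_series_coef[OF coef_of_summable[OF z X] series \<beta>]) (use that in simp_all)
  have F: "(z - mu m) * coef \<beta> y False m = X False m" for m
  proof (cases "m = 0")
    case True
    then show ?thesis using q[of False 0] by (simp only: coef_False_0) simp
  next
    case m: False
    show ?thesis
    proof (cases "m = n")
      case True
      have "(z - mu n) * u = X False n"
        unfolding Xs using 1 by (simp add: D11_def D12_def algebra_simps)
      then show ?thesis unfolding cF[OF m] using True by (simp add: coef_of_def)
    next
      case False
      then have "z - mu m \<noteq> 0" using disc_away_from_mu(1)[OF n_ge_1 z] by simp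
      then show ?thesis unfolding cF[OF m] using False by (simp add: coef_of_def)
    qed
  qed
  have T: "(z - mu m) * coef \<beta> y True m - \<gamma> * of_nat m * coef \<beta> y False m = X True m" for m
  proof (cases "m = n")
    case True
    have "(z - mu n) * c - \<gamma> * of_nat n * u = X True n"
      unfolding Xs using 2 by (simp add: D21_def D22_def algebra_simps)
    then show ?thesis unfolding cT using True n_ge_1 by (simp add: cF coef_of_def)
  next
    case False
    then have zm: "z - mu m \<noteq> 0" using disc_away_from_mu(1)[OF n_ge_1 z] by simp
    have f: "\<gamma> * of_nat m * coef \<beta> y False m = \<gamma> * of_nat m * (X False m / (z - mu m))"
      using F[of m] zm by (simp add: field_simps)
    define a where "a = z - mu m"
    show ?thesis
      unfolding cT f using False zm unfolding coef_of_def a_def[symmetric]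
      by (simp add: field_simps power2_eq_square)
  qed
  have "weak_solution z y r"
    unfolding weak_solution_def q using yc F T by blast
  moreover have "coef \<beta> y True n = c" unfolding cT by (simp add: coef_of_def)
  ultimately show ?thesis by (rule that) (auto simp: y_def)
qed

lemma rhs_functional_zero:
  assumes z: "z \<in> disc n" shows "rhs_functional z (\<lambda>x. 0) = 0"
proof -
  have "bounded_by (coef \<beta> (\<lambda>x. 0)) 0" by (simp add: bounded_by_def)
  from solution_bounded_by[OF z this] show ?thesis by (simp add: rhs_functional_def bounded_by_def)
qed

lemma rhs_functional_scale:
  assumes z: "z \<in> disc n" and r: "continuous_on {0..1} r"
  shows "rhs_functional z (\<lambda>x. a * r x) = a * rhs_functional z r"
proof -
  have "coef \<beta> (\<lambda>x. a * r x) = (\<lambda>t m. a * coef \<beta> r t m)"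
    by (intro ext) (simp add: mult.assoc)
  then show ?thesis
    unfolding rhs_functional_def
    by (simp add: solution_scale[OF z coef_bounded_by[OF abs_int_continuous[OF r]]] algebra_simps)
qed

lemma D_holomorphic: "D11 holomorphic_on disc n" "D21 holomorphic_on disc n"
  unfolding D11_def[abs_def] D21_def[abs_def]
  by (intro holomorphic_intros solution_holomorphic[OF col_bounded])+

lemma rhs_functional_holomorphic:
  assumes r: "continuous_on {0..1} r"
  shows "(\<lambda>z. rhs_functional z r) holomorphic_on disc n"
  unfolding rhs_functional_def[abs_def]
  by (intro holomorphic_intros D_holomorphic solution_holomorphic[OF coef_bounded_by[OF abs_int_continuous[OF r]]])

text \<open>For \<open>r = 0\<close> the residual is bounded by a multiple of \<open>\<bar>u\<bar> + \<bar>v\<bar>\<close>, and the part of \<open>y\<close> with indices other than \<open>n\<close>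
  inherits the small row sums.\<close>

lemma eigenfunction_estimate:
  assumes z: "z \<in> disc n" and y: "weak_solution z y (\<lambda>x. 0)" and x: "x \<in> {0..1}"
  defines "u \<equiv> coef \<beta> y False n" and "v \<equiv> coef \<beta> y True n"
  shows "norm (y x - v * cs n x) \<le> fun_bound \<beta> * norm u +
    fun_bound \<beta> * (2 * q_bound * (norm u + norm v) * (2 + norm \<gamma>)) * (2 * rho_sum / sqrt (real n))"
    and "D21 z * u + D22 z * v = 0"
proof -
  have c0: "bounded_by (coef \<beta> (\<lambda>x. 0)) 0" by (simp add: bounded_by_def)
  then have s0: "solution z (coef \<beta> (\<lambda>x. 0)) t i = 0" for t i
    using solution_bounded_by[OF z c0] by (simp add: bounded_by_def)
  note red = weak_solution_reduction[OF z y continuous_on_const, folded u_def v_def]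
  show "D21 z * u + D22 z * v = 0" using red(4) unfolding s0 by simp
  let ?X = "\<lambda>t i. coef \<beta> (\<lambda>x. q x * y x) t i - coef \<beta> (\<lambda>x. 0) t i"
  have X: "bounded_by ?X (2 * q_bound * (norm u + norm v))"
    unfolding bounded_by_def
  proof (intro allI)
    fix t i
    have "norm (u * solution z (col False) t i + v * solution z (col True) t i) \<le> norm u * (2 * q_bound) + norm v * (2 * q_bound)"
      by (rule norm_triangle_le)
         (unfold norm_mult, intro add_mono mult_left_mono bounded_byD[OF solution_bounded_by[OF z col_bounded]] norm_ge_zero)
    then show "norm (?X t i) \<le> 2 * q_bound * (norm u + norm v)"
      unfolding red(1)[of t i] s0 by (simp add: algebra_simps)
  qed
  have "norm (y x - (u * basis_fun \<beta> False n x + v * basis_fun \<beta> True n x)) \<le>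
    fun_bound \<beta> * (2 * q_bound * (norm u + norm v) * (2 + norm \<gamma>)) * (2 * rho_sum / sqrt (real n))"
    by (rule coef_of_tail[OF z X red(2) x])
  moreover have "norm (u * basis_fun \<beta> False n x) \<le> fun_bound \<beta> * norm u"
    unfolding norm_mult using mult_left_mono[OF norm_test_basis_le(2)[OF x, of \<beta> False n], of "norm u"] by (simp add: mult.commute)
  moreover have "norm (y x - v * cs n x) \<le> norm (y x - (u * basis_fun \<beta> False n x + v * basis_fun \<beta> True n x)) + norm (u * basis_fun \<beta> False n x)"
    using norm_triangle_ineq[of "y x - (u * basis_fun \<beta> False n x + v * basis_fun \<beta> True n x)" "u * basis_fun \<beta> False n x"]
    by (simp add: basis_fun_True)
  ultimately show "norm (y x - v * cs n x) \<le> fun_bound \<beta> * norm u +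
    fun_bound \<beta> * (2 * q_bound * (norm u + norm v) * (2 + norm \<gamma>)) * (2 * rho_sum / sqrt (real n))" by linarith
qed

lemma weak_solution_unique:
  assumes z: "z \<in> disc n" and y: "weak_solution z y (\<lambda>x. 0)" and v: "coef \<beta> y True n = 0" and x: "x \<in> {0..1}"
  shows "y x = 0"
proof -
  note e = eigenfunction_estimate[OF z y x, unfolded v]
  have "coef \<beta> y False n = 0" using e(2) D21_nonzero[OF z] by simp
  then show ?thesis using e(1) by simp
qed

lemma coef_path_weight:
  "coef_C q \<beta> z \<nu> m = path_weight z False \<nu> m False \<and> coef_M q \<beta> z \<nu> m = path_weight z False \<nu> m True"
  "coef_Ct q \<beta> z \<nu> m = path_weight z True \<nu> m False \<and> coef_Mt q \<beta> z \<nu> m = path_weight z True \<nu> m True"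
  by (induction m) (simp_all add: kern_coefs)

lemma inner01_col:
  "inner01 (\<lambda>x. q x * phi \<beta> n x) (sn i) = col False False i"
  "inner01 (\<lambda>x. q x * phi \<beta> n x) (phi_star \<beta> i) = col False True i"
  "inner01 (\<lambda>x. q x * cs n x) (sn i) = col True False i"
  "inner01 (\<lambda>x. q x * cs n x) (phi_star \<beta> i) = col True True i"
  by (simp_all add: inner01_sn[of _ _ \<beta>] inner01_phi_star col_def q_matrix_def basis_fun_def)

lemma terms_eq_iterates:
  assumes z: "z \<in> disc n"
  shows "alpha_term q \<beta> n m z = (K z ^^ m) (col False) False n"
    and "beta_term q \<beta> n m z = (K z ^^ m) (col True) False n"
    and "alpha_term' q \<beta> n m z = (K z ^^ m) (col True) True n"
    and "beta_term' q \<beta> n m z = (K z ^^ m) (col False) True n"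
  by (simp_all add: K_iterate_path_sum[OF z col_bounded] alpha_term_def beta_term_def alpha_term'_def beta_term'_def
      Let_def coef_path_weight inner01_col)

lemma char_eq_lhs_eq:
  assumes z: "z \<in> disc n"
  shows "char_eq_lhs q \<beta> n z = char_fun z"
proof -
  have s: "solution z (col a) t n = col a t n + (\<Sum>m. (K z ^^ Suc m) (col a) t n)" for a t
    unfolding solution_def
    using suminf_split_head[OF sums_summable[OF solution_sums[OF z col_bounded, of a t n]]] by simp
  show ?thesis
    unfolding char_eq_lhs_def char_fun_def D11_def D12_def D21_def D22_def s
      A_sum_def B_sum_def A_sum'_def B_sum'_def terms_eq_iterates[OF z]
      Q_def P_def P_star_def Q_star_def inner01_col
    by (simp add: algebra_simps)
qed

end

section \<open>Jordan chains and the order of a root\<close>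

lemma zorder_powerI:
  assumes "open V" "z \<in> V" "g holomorphic_on V" "g z \<noteq> 0" "\<And>w. w \<in> V \<Longrightarrow> F w = (w - z) ^ k * g w"
  shows "zorder F z = int k"
  by (rule zorder_eqI[OF assms(1-4)]) (simp add: assms(5))

lemma double_root_squareI:
  assumes V: "open V" "z \<in> V" and g: "g holomorphic_on V" "g z \<noteq> 0"
    and F: "\<And>w. w \<in> V \<Longrightarrow> F w = (w - z) ^ 2 * g w"
  shows "double_root F z"
proof -
  have "(\<lambda>w. (w - z) ^ 2 * g w) holomorphic_on V" by (intro holomorphic_intros g)
  then have "F holomorphic_on V" using holomorphic_cong[of V V F "\<lambda>w. (w - z) ^ 2 * g w"] F by simp
  then have "F analytic_on {z}" using V analytic_at by blast
  moreover have "\<forall>\<^sub>F w in at z. F w \<noteq> 0"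
  proof -
    have "isCont g z" using g(1) V by (metis continuous_on_eq_continuous_at holomorphic_on_imp_continuous_on)
    then have "\<forall>\<^sub>F w in at z. g w \<noteq> 0"
      using g(2) by (simp add: isCont_def tendsto_imp_eventually_ne)
    moreover have "\<forall>\<^sub>F w in at z. w \<in> V" using V by (simp add: eventually_at_in_open')
    moreover have "\<forall>\<^sub>F w in at z. w \<noteq> z" by (simp add: eventually_at_filter)
    ultimately show ?thesis by eventually_elim (simp add: F)
  qed
  then have "\<exists>\<^sub>F w in at z. F w \<noteq> 0" by (intro eventually_frequently) auto
  moreover have "zorder F z = 2" using zorder_powerI[OF V g F] by simp
  ultimately show ?thesis using F[OF V(2)] by (simp add: double_root_def)
qed

text \<open>If \<open>F\<close> were to vanish exactly to second order, the quotient of \<open>F\<close> by the square would have a nonzero limit.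
  Vanishing of \<open>F\<close> near \<open>z\<close> is excluded by the definition of a double root.\<close>

lemma not_double_root_cube:
  assumes V: "open V" "connected V" "z \<in> V" and g: "g holomorphic_on V"
    and F: "\<And>w. w \<in> V \<Longrightarrow> F w = (w - z) ^ 3 * g w"
  shows "\<not> double_root F z"
proof
  assume d: "double_root F z"
  have "(\<lambda>w. (w - z) ^ 3 * g w) holomorphic_on V" by (intro holomorphic_intros g)
  then have FV: "F holomorphic_on V" using holomorphic_cong[of V V F "\<lambda>w. (w - z) ^ 3 * g w"] F by simp
  have "\<exists>\<^sub>F w in at z. F w \<noteq> 0" using d by (simp add: double_root_def)
  moreover have "\<forall>\<^sub>F w in at z. w \<in> V" using V by (simp add: eventually_at_in_open')
  ultimately have nz: "\<exists>w\<in>V. F w \<noteq> 0"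
    by (metis (mono_tags, lifting) eventually_mono frequently_def)
  obtain r where r: "r > 0" "cball z r \<subseteq> V"
    and h: "zor_poly F z holomorphic_on cball z r"
      "\<And>w. w \<in> cball z r \<Longrightarrow> F w = zor_poly F z w * (w - z) ^ 2 \<and> zor_poly F z w \<noteq> 0"
    using zorder_exist_zero[OF FV V nz] d unfolding double_root_def by auto
  have lim1: "zor_poly F z \<midarrow>z\<rightarrow> zor_poly F z z"
    using h(1) r(1) by (metis ball_subset_cball centre_in_ball continuous_on_eq_continuous_at holomorphic_on_imp_continuous_on holomorphic_on_subset isCont_def open_ball)
  have lim2: "(\<lambda>w. (w - z) * g w) \<midarrow>z\<rightarrow> (z - z) * g z"
  proof -
    have "(\<lambda>w. (w - z) * g w) holomorphic_on V" by (intro holomorphic_intros g)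
    then show ?thesis using V by (metis (no_types, lifting) continuous_on_eq_continuous_at holomorphic_on_imp_continuous_on isCont_def)
  qed
  have eq: "\<forall>\<^sub>F w in at z. zor_poly F z w = (w - z) * g w"
  proof -
    have "\<forall>\<^sub>F w in at z. w \<in> ball z r" using r(1) by (intro eventually_at_in_open') auto
    moreover have "\<forall>\<^sub>F w in at z. w \<noteq> z" by (simp add: eventually_at_filter)
    ultimately show ?thesis
    proof eventually_elim
      case (elim w)
      then have "w \<in> V" "w \<in> cball z r" using r(2) by (auto intro: subsetD)
      then have "zor_poly F z w * (w - z) ^ 2 = (w - z) ^ 3 * g w" using h(2)[of w] F[of w] by metis
      also have "\<dots> = ((w - z) * g w) * (w - z) ^ 2" by (simp add: power3_eq_cube power2_eq_square)
      finally show ?case using elim by simp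
    qed
  qed
  have "zor_poly F z z = (z - z) * g z"
    by (rule LIM_unique[OF lim1 tendsto_cong[OF eq, THEN iffD2, OF lim2]])
  then show False using h(2)[of z] r(1) by simp
qed

lemma in_span_singleton_iff:
  "w \<in> module.span fun_scale {Y} \<longleftrightarrow> (\<exists>a. w = fun_scale a Y)"
proof -
  interpret V: vector_space fun_scale by (rule vector_space_fun_scale)
  show ?thesis by (auto simp: V.span_singleton)
qed

lemma in_span_insert_iff:
  "w \<in> module.span fun_scale (insert Z {Y}) \<longleftrightarrow> (\<exists>a b. \<forall>x. w x = a * Y x + b * Z x)"
proof -
  interpret V: vector_space fun_scale by (rule vector_space_fun_scale)
  have "w \<in> V.span (insert Z {Y}) \<longleftrightarrow> (\<exists>b a. w - fun_scale b Z = fun_scale a Y)"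
    by (simp only: V.span_breakdown_eq[of w Z "{Y}"] in_span_singleton_iff)
  also have "\<dots> \<longleftrightarrow> (\<exists>a b. \<forall>x. w x = a * Y x + b * Z x)"
    by (simp add: fun_eq_iff fun_scale_def diff_eq_eq) blast
  finally show ?thesis .
qed

context sturm
begin

lemma T1_ker_power_elements:
  assumes "w \<in> T1_ker_power q \<beta> z k"
  shows "continuous_on {0..1} w \<and> w 0 = w 1 \<and> (\<forall>x. x \<notin> {0..1} \<longrightarrow> w x = 0)"
proof (cases k)
  case 0
  then show ?thesis using assms by simp
next
  case (Suc l)
  then obtain w' where op: "T1_op q \<beta> w (\<lambda>x. z * w x + w' x)" and off: "\<forall>x. x \<notin> {0..1} \<longrightarrow> w x = 0"
    using assms by auto
  then have "w 0 = w 1" unfolding T1_op_def by auto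
  with T1_op_continuous[OF op] off show ?thesis by blast
qed

lemma T1_ker_power_Suc_iff:
  "y \<in> T1_ker_power q \<beta> z (Suc k) \<longleftrightarrow>
    (\<forall>x. x \<notin> {0..1} \<longrightarrow> y x = 0) \<and> (\<exists>w\<in>T1_ker_power q \<beta> z k. weak_solution z y w)"
  using T1_op_iff_weak_solution T1_ker_power_elements by auto

end

context sturm_large
begin

lemma weak_solution_difference_zero:
  assumes z: "z \<in> disc n"
    and y: "weak_solution z y r" "\<And>x. x \<notin> {0..1} \<Longrightarrow> y x = 0"
    and y': "weak_solution z y' r'" "\<And>x. x \<notin> {0..1} \<Longrightarrow> y' x = 0"
    and r: "continuous_on {0..1} r" "continuous_on {0..1} r'"
    and eq: "\<And>x. x \<in> {0..1} \<Longrightarrow> r x = a * r' x" "coef \<beta> y True n = a * coef \<beta> y' True n"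
  shows "y x = a * y' x"
proof (cases "x \<in> {0..1}")
  case True
  have "weak_solution z (\<lambda>x. 1 * y x + (- a) * y' x) (\<lambda>x. 1 * r x + (- a) * r' x)"
    by (rule weak_solution_lin[OF y(1) r(1) y'(1) r(2)])
  then have w: "weak_solution z (\<lambda>x. y x - a * y' x) (\<lambda>x. 0)"
    by (rule weak_solution_cong) (simp_all add: eq)
  have c: "continuous_on {0..1} y" "continuous_on {0..1} y'" using y(1) y'(1) by (simp_all add: weak_solution_def)
  have "coef \<beta> (\<lambda>x. y x - a * y' x) True n = 0"
    using coef_lin_continuous[OF c, of 1 "- a" True n] eq(2) by simp
  from weak_solution_unique[OF z w this True] show ?thesis by simp
qed (simp add: y y')

text \<open>A solution at \<open>z\<close> whose defect at \<open>w\<close> is a multiple of \<open>(w - z) ^ k\<close>, such as a polynomial in \<open>w - z\<close> built from a Jordan chain,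
  exhibits that power as a factor of \<open>char_fun\<close>.\<close>

lemma char_fun_from_family:
  assumes w: "w \<in> disc n" and y: "weak_solution z y r" and r: "continuous_on {0..1} r"
    and v: "coef \<beta> y True n = 1" and Y: "continuous_on {0..1} Y"
    and eq: "\<And>x. x \<in> {0..1} \<Longrightarrow> r x + (z - w) * y x = - ((w - z) ^ k) * Y x"
  shows "char_fun w = (w - z) ^ k * (- rhs_functional w Y)"
proof -
  have "weak_solution w y (\<lambda>x. - ((w - z) ^ k) * Y x)"
    by (rule weak_solution_cong[OF weak_solution_shift[OF y r]]) (simp_all only: eq)
  moreover have "continuous_on {0..1} (\<lambda>x. - ((w - z) ^ k) * Y x)"
    by (intro continuous_on_mult continuous_on_const Y)
  ultimately have "char_fun w = rhs_functional w (\<lambda>x. - ((w - z) ^ k) * Y x)"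
    using weak_solution_reduction(5)[OF w] v by fastforce
  also have "\<dots> = - ((w - z) ^ k) * rhs_functional w Y" by (rule rhs_functional_scale[OF w Y])
  finally show ?thesis by simp
qed

lemma eigenfunction_exists:
  assumes z: "z \<in> disc n" and F: "char_fun z = 0"
  obtains y where "weak_solution z y (\<lambda>x. 0)" "coef \<beta> y True n = 1" "\<And>x. x \<notin> {0..1} \<Longrightarrow> y x = 0"
  using weak_solution_exists[OF z continuous_on_const, of 1 0] F rhs_functional_zero[OF z] by auto

lemma T1_eigenvalue_iff:
  assumes z: "z \<in> disc n"
  shows "T1_eigenvalue q \<beta> z \<longleftrightarrow> char_fun z = 0"
proof
  assume "T1_eigenvalue q \<beta> z"
  then obtain y x where y: "T1_op q \<beta> y (\<lambda>x. z * y x)" and x: "x \<in> {0..1}" "y x \<noteq> 0"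
    by (auto simp: T1_eigenvalue_def T1_eigenfunction_def)
  have w: "weak_solution z y (\<lambda>x. 0)"
    using T1_op_iff_weak_solution[OF continuous_on_const, of y z 0] y by simp
  have "coef \<beta> y True n \<noteq> 0" using weak_solution_unique[OF z w _ x(1)] x(2) by blast
  moreover have "char_fun z * coef \<beta> y True n = 0"
    using weak_solution_reduction(5)[OF z w continuous_on_const] rhs_functional_zero[OF z] by simp
  ultimately show "char_fun z = 0" by simp
next
  assume "char_fun z = 0"
  from eigenfunction_exists[OF z this] obtain y where y: "weak_solution z y (\<lambda>x. 0)" "coef \<beta> y True n = 1" by blast
  have "T1_op q \<beta> y (\<lambda>x. z * y x)"
    using T1_op_iff_weak_solution[OF continuous_on_const, of y z 0] y(1) by simp
  moreover have "\<exists>x\<in>{0..1}. y x \<noteq> 0"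
  proof (rule ccontr)
    assume "\<not> (\<exists>x\<in>{0..1}. y x \<noteq> 0)"
    then have "coef \<beta> y True n = I01 (\<lambda>x. 0)" by (intro I01_cong) simp
    with y(2) show False by simp
  qed
  ultimately show "T1_eigenvalue q \<beta> z" by (auto simp: T1_eigenvalue_def T1_eigenfunction_def)
qed

lemma geometric_multiplicity_eq_1:
  assumes z: "z \<in> disc n" and F: "char_fun z = 0"
  shows "geometric_multiplicity q \<beta> z = 1"
proof -
  interpret V: vector_space fun_scale by (rule vector_space_fun_scale)
  obtain Y where Y: "weak_solution z Y (\<lambda>x. 0)" "coef \<beta> Y True n = 1" "\<And>x. x \<notin> {0..1} \<Longrightarrow> Y x = 0"
    using eigenfunction_exists[OF z F] by blast
  have "V.dim (T1_ker_power q \<beta> z 1) = 1"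
  proof (rule V.dim_unique)
    show "{Y} \<subseteq> T1_ker_power q \<beta> z 1" using Y T1_ker_power_Suc_iff[of Y z 0] by simp
    show "T1_ker_power q \<beta> z 1 \<subseteq> V.span {Y}"
    proof
      fix y assume "y \<in> T1_ker_power q \<beta> z 1"
      then have y: "weak_solution z y (\<lambda>x. 0)" "\<And>x. x \<notin> {0..1} \<Longrightarrow> y x = 0"
        using T1_ker_power_Suc_iff[of y z 0] by auto
      have "y x = coef \<beta> y True n * Y x" for x
        by (rule weak_solution_difference_zero[OF z y Y(1,3)]) (simp_all add: Y(2))
      then have "y = fun_scale (coef \<beta> y True n) Y" unfolding fun_scale_def by (rule ext)
      then show "y \<in> V.span {Y}" unfolding in_span_singleton_iff by (rule exI)
    qed
    have "Y \<noteq> 0" using Y(2) by auto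
    then show "V.independent {Y}" by simp
  qed simp
  then show ?thesis by (simp add: geometric_multiplicity_def)
qed

text \<open>Jordan chains \<open>Y0, Y1, Y2\<close> are built step by step. If the chain ends with \<open>Y0\<close> or \<open>Y1\<close>, it spans the
  generalized eigenspace and its length is the order of the root. If \<open>Y2\<close> exists, three independent vectors exclude the dimension
  \<open>2\<close>, also when the generalized eigenspace has infinite dimension (and \<open>dim\<close> is \<open>0\<close> by convention), and \<open>F\<close> is
  divisible by the third power.\<close>

lemma T1_double_eigenvalue_iff:
  assumes z: "z \<in> disc n" and F: "\<And>w. w \<in> disc n \<Longrightarrow> F w = char_fun w"
  shows "T1_double_eigenvalue q \<beta> z \<longleftrightarrow> double_root F z"
proof (cases "char_fun z = 0")
  case False
  then show ?thesis using T1_eigenvalue_iff[OF z] F[OF z] by (simp add: T1_double_eigenvalue_def double_root_def)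
next
  case F0: True
  interpret V: vector_space fun_scale by (rule vector_space_fun_scale)
  let ?v = "\<lambda>y. coef \<beta> y True n"
  let ?ker = "T1_ker_power q \<beta> z"
  have disc: "open (disc n)" "connected (disc n)" by (simp_all add: disc_def)
  have eigen: "T1_eigenvalue q \<beta> z" using T1_eigenvalue_iff[OF z] F0 by simp
  have ker1: "y \<in> ?ker 1" if "weak_solution z y (\<lambda>x. 0)" "\<And>x. x \<notin> {0..1} \<Longrightarrow> y x = 0" for y
    using that T1_ker_power_Suc_iff[of y z 0] by auto
  have solvable: "rhs_functional z r = 0" if "weak_solution z y r" "continuous_on {0..1} r" for y r
    using weak_solution_reduction(5)[OF z that] F0 by simp
  obtain Y0 where Y0: "weak_solution z Y0 (\<lambda>x. 0)" "?v Y0 = 1" and off0: "\<And>x. x \<notin> {0..1} \<Longrightarrow> Y0 x = 0"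
    using eigenfunction_exists[OF z F0] by blast
  have c0: "continuous_on {0..1} Y0" "Y0 0 = Y0 1" using Y0(1) by (simp_all add: weak_solution_def)
  have line: "y = fun_scale (?v y) Y0" if "weak_solution z y (\<lambda>x. 0)" "\<And>x. x \<notin> {0..1} \<Longrightarrow> y x = 0" for y
  proof -
    have "y x = ?v y * Y0 x" for x
      by (rule weak_solution_difference_zero[OF z that Y0(1) off0]) (simp_all add: Y0(2))
    then show ?thesis unfolding fun_scale_def by (rule ext)
  qed
  have Y0k: "Y0 \<in> ?ker 1" by (rule ker1[OF Y0(1) off0])
  have "Y0 \<noteq> 0" using Y0(2) by auto
  then have ind0: "V.independent {Y0}" by simp
  have F1: "F w = (w - z) ^ 1 * (- rhs_functional w Y0)" if w: "w \<in> disc n" for w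
    unfolding F[OF w] by (rule char_fun_from_family[OF w Y0(1) continuous_on_const Y0(2) c0(1)]) (simp add: algebra_simps)
  show ?thesis
  proof (cases "rhs_functional z Y0 = 0")
    case False
    have "zorder F z = 1"
      using zorder_powerI[OF disc(1) z _ _ F1] False rhs_functional_holomorphic[OF c0(1)]
      by (simp add: holomorphic_on_minus)
    then have "\<not> double_root F z" by (simp add: double_root_def)
    have sub: "?ker k \<subseteq> V.span {Y0}" for k
    proof (induction k)
      case 0
      show ?case using V.span_zero by (simp add: zero_fun_def)
    next
      case (Suc k)
      show ?case
      proof
        fix y assume "y \<in> ?ker (Suc k)"
        then obtain w where w: "w \<in> ?ker k" and y: "weak_solution z y w" and off: "\<And>x. x \<notin> {0..1} \<Longrightarrow> y x = 0"
          using T1_ker_power_Suc_iff[of y z k] by metis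
        obtain a where a: "w = fun_scale a Y0" using subsetD[OF Suc w] unfolding in_span_singleton_iff ..
        have "a * rhs_functional z Y0 = 0"
          using solvable[OF y] rhs_functional_scale[OF z c0(1), of a] c0(1)
          by (simp add: a fun_scale_def continuous_on_mult)
        then have "w = (\<lambda>x. 0)" using False by (simp add: a fun_scale_def)
        then have "weak_solution z y (\<lambda>x. 0)" using y by simp
        then have "y = fun_scale (?v y) Y0" by (rule line[OF _ off])
        then show "y \<in> V.span {Y0}" unfolding in_span_singleton_iff by (rule exI)
      qed
    qed
    have "V.dim (\<Union>k. ?ker k) = 1"
    proof (rule V.dim_unique)
      show "{Y0} \<subseteq> (\<Union>k. ?ker k)" using Y0k by blast
      show "(\<Union>k. ?ker k) \<subseteq> V.span {Y0}" using sub by blast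
    qed (use ind0 in simp_all)
    then have "algebraic_multiplicity q \<beta> z = 1" by (simp add: algebraic_multiplicity_def)
    then show ?thesis using \<open>\<not> double_root F z\<close> by (simp add: T1_double_eigenvalue_def)
  next
    case r0: True
    obtain Y1 where Y1: "weak_solution z Y1 Y0" "?v Y1 = 0" and off1: "\<And>x. x \<notin> {0..1} \<Longrightarrow> Y1 x = 0"
      using weak_solution_exists[OF z c0(1), of 0] r0 by auto
    have c1: "continuous_on {0..1} Y1" "Y1 0 = Y1 1" using Y1(1) by (simp_all add: weak_solution_def)
    have Y1k: "Y1 \<in> ?ker 2"
      using T1_ker_power_Suc_iff[of Y1 z 1] Y0k Y1(1) off1 by (auto simp: numeral_2_eq_2)
    have Y1n: "Y1 \<notin> V.span {Y0}"
    proof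
      assume "Y1 \<in> V.span {Y0}"
      then obtain a where a: "Y1 = fun_scale a Y0" unfolding in_span_singleton_iff ..
      then have "?v Y1 = a * ?v Y0" using I01_mult[of a "\<lambda>x. Y0 x * test_fun \<beta> True n x"] by (simp add: fun_scale_def mult.assoc)
      then have "a = 0" using Y1(2) Y0(2) by simp
      then have "weak_solution z (\<lambda>x. 0) Y0" using Y1(1) by (simp add: a fun_scale_def)
      then have "Y0 x = 0" for x using weak_solution_zero_rhs[OF _ c0] off0 by (cases "x \<in> {0..1}") auto
      then have "Y0 = 0" by auto
      with \<open>Y0 \<noteq> 0\<close> show False ..
    qed
    have "Y1 \<noteq> Y0" using Y0 Y1 by auto
    have ind1: "V.independent {Y1, Y0}"
      using ind0 Y1n V.span_superset[of "{Y0}"] by (auto simp: V.independent_insert)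
    \<comment> \<open>the polynomial in \<open>w - z\<close> formed from the chain \<open>Y0, Y1\<close>\<close>
    define family where "family w x = 1 * Y0 x + (w - z) * Y1 x" for w x
    have family: "weak_solution z (family w) (\<lambda>x. 1 * 0 + (w - z) * Y0 x)" for w
      unfolding family_def by (rule weak_solution_lin[OF Y0(1) continuous_on_const Y1(1) c0(1)])
    have vfamily: "?v (family w) = 1" for w
      unfolding family_def coef_lin_continuous[OF c0(1) c1(1)] Y0 Y1 by simp
    have cf: "continuous_on {0..1} (family w)" for w using family by (simp add: weak_solution_def)
    have cr: "continuous_on {0..1} (\<lambda>x. 1 * 0 + (w - z) * Y0 x)" for w by (intro continuous_intros c0)
    have F2: "F w = (w - z) ^ 2 * (- rhs_functional w Y1)" if w: "w \<in> disc n" for w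
      unfolding F[OF w] by (rule char_fun_from_family[OF w family[of w] cr[of w] vfamily[of w] c1(1)])
        (simp add: family_def algebra_simps power2_eq_square)
    show ?thesis
    proof (cases "rhs_functional z Y1 = 0")
      case False
      have "double_root F z"
        by (rule double_root_squareI[OF disc(1) z _ _ F2])
           (use False rhs_functional_holomorphic[OF c1(1)] in \<open>auto intro: holomorphic_on_minus\<close>)
      have sub: "?ker k \<subseteq> V.span {Y1, Y0}" for k
      proof (induction k)
        case 0
        show ?case using V.span_zero by (simp add: zero_fun_def)
      next
        case (Suc k)
        show ?case
        proof
          fix y assume "y \<in> ?ker (Suc k)"
          then obtain w where w: "w \<in> ?ker k" and y: "weak_solution z y w" and off: "\<And>x. x \<notin> {0..1} \<Longrightarrow> y x = 0"
            using T1_ker_power_Suc_iff[of y z k] by metis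
          have wc: "continuous_on {0..1} w" using T1_ker_power_elements[OF w] by blast
          obtain a b where wx: "\<forall>x. w x = a * Y0 x + b * Y1 x"
            using subsetD[OF Suc w] unfolding in_span_insert_iff by blast
          let ?y = "\<lambda>x. 1 * y x + (- a) * Y1 x"
          have "weak_solution z ?y (\<lambda>x. 1 * w x + (- a) * Y0 x)"
            by (rule weak_solution_lin[OF y wc Y1(1) c0(1)])
          then have y': "weak_solution z ?y (\<lambda>x. b * Y1 x)" by (simp add: wx)
          have "b * rhs_functional z Y1 = 0"
            using solvable[OF y'] rhs_functional_scale[OF z c1(1), of b] c1(1) by (simp add: continuous_on_mult)
          then have "weak_solution z ?y (\<lambda>x. 0)" using y' False by simp
          then have "?y = fun_scale (?v ?y) Y0" by (rule line) (simp add: off off1)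
          then obtain c where c: "?y = fun_scale c Y0" by (rule that)
          have "y x = c * Y0 x + a * Y1 x" for x
            using fun_cong[OF c, of x] by (simp add: fun_scale_def algebra_simps)
          then show "y \<in> V.span {Y1, Y0}" unfolding in_span_insert_iff by blast
        qed
      qed
      have "V.dim (\<Union>k. ?ker k) = 2"
      proof (rule V.dim_unique)
        show "{Y1, Y0} \<subseteq> (\<Union>k. ?ker k)" using Y0k Y1k by blast
        show "(\<Union>k. ?ker k) \<subseteq> V.span {Y1, Y0}" using sub by blast
      qed (use ind1 \<open>Y1 \<noteq> Y0\<close> in simp_all)
      then have "algebraic_multiplicity q \<beta> z = 2" by (simp add: algebraic_multiplicity_def)
      then show ?thesis using \<open>double_root F z\<close> eigen by (simp add: T1_double_eigenvalue_def)
    next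
      case r1: True
      obtain Y2 where Y2: "weak_solution z Y2 Y1" "?v Y2 = 0" and off2: "\<And>x. x \<notin> {0..1} \<Longrightarrow> Y2 x = 0"
        using weak_solution_exists[OF z c1(1), of 0] r1 by auto
      have c2: "continuous_on {0..1} Y2" using Y2(1) by (simp add: weak_solution_def)
      have Y2k: "Y2 \<in> ?ker 3"
        using T1_ker_power_Suc_iff[of Y2 z 2] Y1k Y2(1) off2 by (auto simp: numeral_3_eq_3 numeral_2_eq_2)
      have F3: "F w = (w - z) ^ 3 * (- rhs_functional w Y2)" if w: "w \<in> disc n" for w
      proof -
        let ?y = "\<lambda>x. 1 * family w x + (w - z) ^ 2 * Y2 x" and ?r = "\<lambda>x. 1 * (1 * 0 + (w - z) * Y0 x) + (w - z) ^ 2 * Y1 x"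
        have "weak_solution z ?y ?r" by (rule weak_solution_lin[OF family[of w] cr[of w] Y2(1) c1(1)])
        moreover have "?v ?y = 1" unfolding coef_lin_continuous[OF cf[of w] c2] vfamily[of w] Y2 by simp
        moreover have "continuous_on {0..1} ?r" by (intro continuous_intros c0 c1)
        ultimately show ?thesis
          unfolding F[OF w] by (intro char_fun_from_family[OF w _ _ _ c2])
            (auto simp: family_def algebra_simps power2_eq_square power3_eq_cube)
      qed
      have "\<not> double_root F z"
        by (rule not_double_root_cube[OF disc z _ F3])
           (use rhs_functional_holomorphic[OF c2] in \<open>auto intro: holomorphic_on_minus\<close>)
      have "Y2 \<notin> V.span {Y1, Y0}"
      proof
        assume "Y2 \<in> V.span {Y1, Y0}"
        then obtain a b where Y2x: "\<And>x. Y2 x = a * Y0 x + b * Y1 x" unfolding in_span_insert_iff by blast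
        have "?v Y2 = a * ?v Y0 + b * ?v Y1"
          unfolding Y2x by (rule coef_lin_continuous[OF c0(1) c1(1)])
        then have "a = 0" using Y0 Y1 Y2 by simp
        have "weak_solution z (\<lambda>x. 1 * Y2 x + (- b) * Y1 x) (\<lambda>x. 1 * Y1 x + (- b) * Y0 x)"
          by (rule weak_solution_lin[OF Y2(1) c1(1) Y1(1) c0(1)])
        then have w: "weak_solution z (\<lambda>x. 0) (\<lambda>x. Y1 x - b * Y0 x)" using \<open>a = 0\<close> by (simp add: Y2x)
        have "Y1 x = b * Y0 x" for x
        proof (cases "x \<in> {0..1}")
          case True
          have "continuous_on {0..1} (\<lambda>x. Y1 x - b * Y0 x)" by (intro continuous_intros c0 c1)
          then have "Y1 x - b * Y0 x = 0" by (rule weak_solution_zero_rhs[OF w _ _ True]) (simp add: c0 c1)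
          then show ?thesis by simp
        qed (simp add: off0 off1)
        then have "Y1 = fun_scale b Y0" by (auto simp: fun_scale_def)
        then show False using Y1n unfolding in_span_singleton_iff by blast
      qed
      moreover from this have "Y2 \<notin> {Y1, Y0}" using V.span_superset[of "{Y1, Y0}"] by blast
      ultimately have ind2: "V.independent {Y2, Y1, Y0}" using ind1 by (simp add: V.independent_insert)
      have card: "card {Y2, Y1, Y0} = 3"
        using \<open>Y2 \<notin> {Y1, Y0}\<close> \<open>Y1 \<noteq> Y0\<close> by simp
      have "V.dim (\<Union>k. ?ker k) \<noteq> 2"
      proof
        assume d: "V.dim (\<Union>k. ?ker k) = 2"
        obtain B where B: "(\<Union>k. ?ker k) \<subseteq> V.span B" "card B = V.dim (\<Union>k. ?ker k)"
          using V.basis_exists by blast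
        have "finite B" using B(2) d by (intro card_ge_0_finite) simp
        moreover have "{Y2, Y1, Y0} \<subseteq> V.span B" using B(1) Y0k Y1k Y2k by blast
        ultimately have "card {Y2, Y1, Y0} \<le> card B" using V.independent_span_bound[OF _ ind2] by blast
        then show False using card B(2) d by simp
      qed
      then have "algebraic_multiplicity q \<beta> z \<noteq> 2" by (simp add: algebraic_multiplicity_def)
      then show ?thesis using \<open>\<not> double_root F z\<close> by (simp add: T1_double_eigenvalue_def)
    qed
  qed
qed

end

section \<open>Asymptotics of the eigenfunctions\<close>

lemma cos_square_integral:
  assumes "1 \<le> n"
  shows "((\<lambda>x. (cos (2 * pi * real n * x))\<^sup>2) has_integral 1/2) {0..1}"
proof -
  let ?a = "2 * pi * real n"
  have a: "?a \<noteq> 0" using assms by simp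
  let ?F = "\<lambda>x. x / 2 + sin (2 * (?a * x)) / (4 * ?a)"
  have "((\<lambda>x. (cos (?a * x))\<^sup>2) has_integral (?F 1 - ?F 0)) {0..1}"
  proof (rule fundamental_theorem_of_calculus)
    fix x :: real
    have "(?F has_real_derivative 1 / 2 + cos (2 * (?a * x)) * (2 * ?a) / (4 * ?a)) (at x within {0..1})"
      by (rule derivative_eq_intros refl | use a in simp)+
    also have "1 / 2 + cos (2 * (?a * x)) * (2 * ?a) / (4 * ?a) = (cos (?a * x))\<^sup>2"
      using a unfolding cos_double_cos[of "?a * x"] by (simp add: field_simps)
    finally show "(?F has_vector_derivative (cos (?a * x))\<^sup>2) (at x within {0..1})"
      by (simp add: has_real_derivative_iff_has_vector_derivative)
  qed simp
  moreover have "sin (2 * (?a * 1)) = 0"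
  proof -
    have "sin (2 * pi * (2 * real n)) = 0" by (rule sin_integer_2pi) (simp add: Ints_mult)
    also have "2 * pi * (2 * real n) = 2 * (?a * 1)" by simp
    finally show ?thesis .
  qed
  ultimately show ?thesis by simp
qed

text \<open>The squares of \<open>\<bar>y\<bar>\<close> and \<open>\<bar>v cs n\<bar>\<close> differ by at most \<open>3 \<delta> \<bar>v\<bar>\<^sup>2\<close>, so \<open>1 - \<bar>v\<bar>\<^sup>2 / 2\<close> is of size \<open>\<delta>\<close>. The condition
  \<open>\<delta> \<le> 1 / 12\<close> is what turns this into \<open>\<bar>v\<bar> \<le> 2\<close>. The factor of modulus one rotates \<open>v\<close> to the positive axis.\<close>

lemma normalized_near_cosine:
  assumes n: "1 \<le> n" and y: "continuous_on {0..1} y" "L2_norm y = 1"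
    and near: "\<And>x. x \<in> {0..1} \<Longrightarrow> norm (y x - v * cs n x) \<le> \<delta> * norm v"
    and \<delta>: "\<delta> \<le> 1 / 12"
  shows "\<exists>c. norm c = 1 \<and>
    (\<forall>x\<in>{0..1}. norm (c * y x - of_real (sqrt 2 * cos (2 * pi * real n * x))) \<le> 26 * \<delta>)"
proof -
  let ?g = "\<lambda>x. (norm v)\<^sup>2 * (cos (2 * pi * real n * x))\<^sup>2"
  have \<delta>v: "0 \<le> \<delta> * norm v" by (rule order_trans[OF norm_ge_zero near[of 0]]) simp
  have y2: "continuous_on {0..1} (\<lambda>x. (norm (y x))\<^sup>2)" by (intro continuous_intros y)
  have "sqrt (integral {0..1} (\<lambda>x. (norm (y x))\<^sup>2)) = 1"
    using y(2) unfolding L2_norm_def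
    by (subst (asm) set_lebesgue_integral_eq_integral(2)) (auto intro!: absolutely_integrable_continuous_real y2)
  then have I: "integral {0..1} (\<lambda>x. (norm (y x))\<^sup>2) = 1" by simp
  have g: "(?g has_integral (norm v)\<^sup>2 * (1/2)) {0..1}"
    by (rule has_integral_mult_right[OF cos_square_integral[OF n]])
  have vpos: "v \<noteq> 0"
  proof
    assume "v = 0"
    then have "y x = 0" if "x \<in> {0..1}" for x using near[OF that] by simp
    note zero = this
    have "integral {0..1} (\<lambda>x. (norm (y x))\<^sup>2) = integral {0..1} (\<lambda>x::real. 0)"
      by (rule Henstock_Kurzweil_Integration.integral_cong) (simp add: zero)
    with I show False by simp
  qed
  then have \<delta>0: "0 \<le> \<delta>" using \<delta>v by (simp add: zero_le_mult_iff)
  have "norm ((norm (y x))\<^sup>2 - ?g x) \<le> 3 * \<delta> * (norm v)\<^sup>2" if x: "x \<in> {0..1}" for x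
  proof -
    let ?c = "norm (v * cs n x)"
    have c: "?c \<le> norm v" using mult_left_mono[OF norm_sn_cs_le(2)[of n x], of "norm v"] by (simp add: norm_mult)
    have d: "\<bar>norm (y x) - ?c\<bar> \<le> \<delta> * norm v" using near[OF x] norm_triangle_ineq3[of "y x" "v * cs n x"] by linarith
    have "\<delta> * norm v \<le> 1 * norm v" using \<delta> by (intro mult_right_mono) auto
    then have s: "norm (y x) + ?c \<le> 3 * norm v" using c d by linarith
    have "?g x = ?c\<^sup>2" by (simp add: norm_mult power_mult_distrib cs_def)
    then have "norm ((norm (y x))\<^sup>2 - ?g x) = \<bar>norm (y x) - ?c\<bar> * (norm (y x) + ?c)"
      by (simp add: power2_eq_square square_diff_square_factored abs_mult mult.commute)
    also have "\<dots> \<le> (\<delta> * norm v) * (3 * norm v)"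
      using d s \<delta>v by (intro mult_mono) auto
    finally show ?thesis by (simp add: power2_eq_square mult_ac)
  qed
  then have "norm (integral {0..1} (\<lambda>x. (norm (y x))\<^sup>2 - ?g x)) \<le> integral {0..1} (\<lambda>x::real. 3 * \<delta> * (norm v)\<^sup>2)"
    by (intro integral_norm_bound_integral integrable_diff integrable_continuous_real y2 continuous_intros)
  also have "integral {0..1} (\<lambda>x. (norm (y x))\<^sup>2 - ?g x) = 1 - (norm v)\<^sup>2 / 2"
    using integral_diff[OF integrable_continuous_real[OF y2] has_integral_integrable[OF g]] I integral_unique[OF g] by simp
  finally have main: "\<bar>1 - (norm v)\<^sup>2 / 2\<bar> \<le> 3 * \<delta> * (norm v)\<^sup>2" by simp
  have "3 * \<delta> * (norm v)\<^sup>2 \<le> 1/4 * (norm v)\<^sup>2" using \<delta> by (intro mult_right_mono) auto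
  then have v4: "(norm v)\<^sup>2 \<le> 2\<^sup>2" using main by simp
  then have v2: "norm v \<le> 2" by (rule power2_le_imp_le) simp
  have "3 * \<delta> * (norm v)\<^sup>2 \<le> 3 * \<delta> * 2\<^sup>2" by (rule mult_left_mono[OF v4]) (use \<delta>0 in simp)
  then have "\<bar>(norm v)\<^sup>2 - (sqrt 2)\<^sup>2\<bar> \<le> 24 * \<delta>" using main by (simp add: abs_minus_commute)
  then have prod: "\<bar>norm v - sqrt 2\<bar> * (norm v + sqrt 2) \<le> 24 * \<delta>"
    by (simp add: power2_eq_square square_diff_square_factored abs_mult mult.commute del: real_sqrt_mult_self)
  have "\<bar>norm v - sqrt 2\<bar> * 1 \<le> \<bar>norm v - sqrt 2\<bar> * (norm v + sqrt 2)"
  proof (rule mult_left_mono)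
    have "1 \<le> sqrt 2" by simp
    then show "1 \<le> norm v + sqrt 2" using norm_ge_zero[of v] by linarith
  qed simp
  from order_trans[OF this prod] have vs: "\<bar>norm v - sqrt 2\<bar> \<le> 24 * \<delta>" by simp
  define c where "c = cnj v / of_real (norm v)"
  have c1: "norm c = 1" using vpos by (simp add: c_def norm_divide)
  have cv: "c * v = of_real (norm v)"
    using vpos by (simp add: c_def mult.commute[of "cnj v"] complex_norm_square[symmetric] power2_eq_square)
  have "norm (c * y x - of_real (sqrt 2 * cos (2 * pi * real n * x))) \<le> 26 * \<delta>" if x: "x \<in> {0..1}" for x
  proof -
    have "c * y x - of_real (sqrt 2 * cos (2 * pi * real n * x)) = c * (y x - v * cs n x) + of_real (norm v - sqrt 2) * cs n x"
      using cv by (simp add: cs_def algebra_simps)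
    also have "norm \<dots> \<le> \<delta> * norm v + 24 * \<delta> * 1"
    proof (rule norm_triangle_le[OF add_mono])
      show "norm (c * (y x - v * cs n x)) \<le> \<delta> * norm v" using near[OF x] c1 by (simp add: norm_mult)
      show "norm (of_real (norm v - sqrt 2) * cs n x) \<le> 24 * \<delta> * 1"
        unfolding norm_mult norm_of_real by (rule mult_mono) (use vs norm_sn_cs_le(2) \<delta>0 in auto)
    qed
    also have "\<dots> \<le> \<delta> * 2 + 24 * \<delta>" using mult_left_mono[OF v2 \<delta>0] by simp
    finally show ?thesis by simp
  qed
  with c1 show ?thesis by blast
qed

context sturm
begin

text \<open>If \<open>\<bar>z - mu n\<bar> \<le> C * sqrt n\<close>, then \<open>u\<close> is at most \<open>sine_constant C / sqrt n\<close> times \<open>v\<close>, because \<open>D22 z\<close> is of order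
  \<open>sqrt n\<close> and \<open>D21 z\<close> of order \<open>n\<close>.\<close>

definition sine_constant :: "real \<Rightarrow> real" where
  "sine_constant C = 2 * (C + 2 * q_bound) / norm \<gamma>"

definition cosine_constant :: "real \<Rightarrow> real" where
  "cosine_constant C = fun_bound \<beta> * sine_constant C +
     fun_bound \<beta> * (2 * q_bound * (sine_constant C + 1) * (2 + norm \<gamma>)) * (2 * rho_sum)"

end

lemma (in sturm_large) eigenfunction_near_cosine:
  assumes z: "z \<in> disc n" "norm (z - mu n) \<le> C * sqrt (real n)"
    and y: "weak_solution z y (\<lambda>x. 0)" and x: "x \<in> {0..1}"
  shows "norm (y x - coef \<beta> y True n * cs n x) \<le> cosine_constant C / sqrt (real n) * norm (coef \<beta> y True n)"
proof -
  define u v where "u = coef \<beta> y False n" and "v = coef \<beta> y True n"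
  let ?r = "sqrt (real n)" and ?E = "sine_constant C"
  have r: "1 \<le> ?r" using n_ge_1 by simp
  have rr: "?r * ?r = real n" by simp
  have \<gamma>: "0 < norm \<gamma>" using gamma1_nonzero[OF \<beta>] by simp
  note est = eigenfunction_estimate[OF z(1) y x, folded u_def v_def]
  have "norm (solution z (col True) True n) \<le> 2 * q_bound"
    using bounded_byD[OF solution_bounded_by[OF z(1) col_bounded]] .
  also have "\<dots> \<le> 2 * q_bound * ?r" using mult_left_mono[OF r, of "2 * q_bound"] q_bound_nonneg by simp
  finally have "norm (D22 z) \<le> (C + 2 * q_bound) * ?r"
    unfolding D22_def using z(2) norm_triangle_ineq4[of "z - mu n" "solution z (col True) True n"]
    by (simp add: algebra_simps)
  moreover have "norm (D21 z) * norm u = norm (D22 z) * norm v"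
    using est(2) by (metis add_eq_0_iff norm_minus_cancel norm_mult)
  ultimately have "norm (D21 z) * norm u \<le> (C + 2 * q_bound) * ?r * norm v"
    by (simp add: mult_right_mono)
  moreover have "norm \<gamma> * real n / 2 * norm u \<le> norm (D21 z) * norm u"
    by (rule mult_right_mono[OF D21_lower[OF z(1)]]) simp
  ultimately have "norm \<gamma> * (?r * ?r) / 2 * norm u \<le> (C + 2 * q_bound) * ?r * norm v"
    unfolding rr by linarith
  moreover have "norm \<gamma> * (?r * ?r) / 2 * norm u = ?r * (norm \<gamma> * ?r / 2 * norm u)"
    "(C + 2 * q_bound) * ?r * norm v = ?r * ((C + 2 * q_bound) * norm v)"
    by (simp_all only: mult_ac times_divide_eq_left times_divide_eq_right)
  ultimately have "?r * (norm \<gamma> * ?r / 2 * norm u) \<le> ?r * ((C + 2 * q_bound) * norm v)" by (simp only:)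
  then have "norm \<gamma> * ?r / 2 * norm u \<le> (C + 2 * q_bound) * norm v"
    using r by (simp add: mult_le_cancel_left)
  then have u: "norm u \<le> ?E / ?r * norm v"
    using \<gamma> r by (simp add: sine_constant_def field_simps)
  have "0 \<le> C * ?r" by (rule order_trans[OF norm_ge_zero z(2)])
  then have "0 \<le> C" using r by (simp add: zero_le_mult_iff)
  then have E: "0 \<le> ?E" using q_bound_nonneg by (simp add: sine_constant_def)
  have "?E / ?r \<le> ?E" using E r by (simp add: divide_le_eq mult_le_cancel_left1)
  then have "?E / ?r * norm v \<le> ?E * norm v" by (intro mult_right_mono) auto
  then have uv: "norm u + norm v \<le> (?E + 1) * norm v" using u by (simp add: algebra_simps)
  have "norm (y x - v * cs n x) \<le> fun_bound \<beta> * norm u +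
    fun_bound \<beta> * (2 * q_bound * (norm u + norm v) * (2 + norm \<gamma>)) * (2 * rho_sum / ?r)" by (rule est(1))
  also have "\<dots> \<le> fun_bound \<beta> * (?E / ?r * norm v) +
    fun_bound \<beta> * (2 * q_bound * ((?E + 1) * norm v) * (2 + norm \<gamma>)) * (2 * rho_sum / ?r)"
    using u uv fun_bound_ge_1[of \<beta>] q_bound_nonneg rho_sum_nonneg r
    by (intro add_mono mult_left_mono mult_right_mono) auto
  also have "\<dots> = cosine_constant C / ?r * norm v"
    using r by (simp add: cosine_constant_def field_simps)
  finally show ?thesis unfolding v_def .
qed

theorem theorem1:
  fixes q :: "real \<Rightarrow> complex" and \<beta> :: complex
    and s :: "nat \<Rightarrow> nat" and ev :: "nat \<Rightarrow> nat \<Rightarrow> complex"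
  assumes "set_integrable lebesgue {0..1} q"
    and "(LINT x:{0..1}|lebesgue. q x) = 0"
    and "\<beta> \<noteq> 1" and "\<beta> \<noteq> -1"
    and "T1_eigenvalue_sequences q \<beta> s ev"
    and "\<And>j. j \<in> {1, 2} \<Longrightarrow>
           (\<lambda>n. cmod (ev n j - of_real ((2 * pi * real n)\<^sup>2))) \<in> O(\<lambda>n. real n powr (1/2))"
  shows
    "(\<forall>j\<in>{1, 2}.
        (\<exists>K N. \<forall>n\<ge>N.
           (\<forall>\<Psi>. T1_eigenfunction q \<beta> (ev n j) \<Psi> \<and> L2_norm \<Psi> = 1 \<longrightarrow>
              (\<exists>c. cmod c = 1 \<and>
                 (\<forall>x\<in>{0..1}.
                    cmod (c * \<Psi> x - of_real (sqrt 2 * cos (2 * pi * real n * x)))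
                      \<le> K * real n powr (-1/2))))) \<and>
        (\<exists>N. \<forall>n>N. geometric_multiplicity q \<beta> (ev n j) = 1)) \<and>
     (\<forall>\<^sub>F n in sequentially. \<forall>z\<in>U n.
        (T1_eigenvalue q \<beta> z \<longleftrightarrow> char_eq_lhs q \<beta> n z = 0) \<and>
        (T1_double_eigenvalue q \<beta> z \<longleftrightarrow> double_root (char_eq_lhs q \<beta> n) z))"
proof (intro conjI ballI)
  interpret sturm q \<beta> by unfold_locales fact+
  have U: "U n \<subseteq> disc n" if "1 \<le> n" for n
    using that by (auto simp: U_def disc_def dist_norm norm_minus_commute)
  show "\<forall>\<^sub>F n in sequentially. \<forall>z\<in>U n.
        (T1_eigenvalue q \<beta> z \<longleftrightarrow> char_eq_lhs q \<beta> n z = 0) \<and>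
        (T1_double_eigenvalue q \<beta> z \<longleftrightarrow> double_root (char_eq_lhs q \<beta> n) z)"
    using eventually_large
  proof eventually_elim
    case (elim n)
    interpret sturm_large q \<beta> n by unfold_locales fact
    show ?case
    proof
      fix z assume "z \<in> U n"
      then have z: "z \<in> disc n" using U[OF n_ge_1] by blast
      show "(T1_eigenvalue q \<beta> z \<longleftrightarrow> char_eq_lhs q \<beta> n z = 0) \<and>
        (T1_double_eigenvalue q \<beta> z \<longleftrightarrow> double_root (char_eq_lhs q \<beta> n) z)"
        using T1_eigenvalue_iff[OF z] char_eq_lhs_eq[OF z] T1_double_eigenvalue_iff[OF z char_eq_lhs_eq] by simp
    qed
  qed
  fix j :: nat assume j: "j \<in> {1, 2}"
  obtain C where C: "C > 0" and "\<forall>\<^sub>F n in sequentially. norm (cmod (ev n j - of_real ((2 * pi * real n)\<^sup>2))) \<le> C * norm (real n powr (1/2))"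
    using landau_o.bigE[OF assms(6)[OF j]] by blast
  then have ev: "\<forall>\<^sub>F n in sequentially. cmod (ev n j - mu n) \<le> C * sqrt (real n)"
    by (simp add: mu_def powr_half_sqrt)
  have sqrt_large: "\<forall>\<^sub>F n in sequentially. B \<le> sqrt (real n)" for B
    using filterlim_compose[OF sqrt_at_top filterlim_real_sequentially] unfolding filterlim_at_top by (rule spec)
  \<comment> \<open>the bound \<open>12 * cosine_constant C\<close> supplies the smallness of \<open>\<delta>\<close> in \<open>normalized_near_cosine\<close>\<close>
  define good where "good n \<longleftrightarrow> large n \<and> ev n j \<in> disc n \<and> cmod (ev n j - mu n) \<le> C * sqrt (real n) \<and>
    12 * cosine_constant C \<le> sqrt (real n) \<and> s j \<le> n" for n
  have "\<forall>\<^sub>F n in sequentially. good n"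
    using eventually_large ev sqrt_large[of C] sqrt_large[of "12 * cosine_constant C"] eventually_ge_at_top[of "s j"]
  proof eventually_elim
    case (elim n)
    have n: "1 \<le> n" using elim(1) by (simp add: large_def)
    have "C * sqrt (real n) \<le> sqrt (real n) * sqrt (real n)" using elim(3) by (intro mult_right_mono) auto
    then have "ev n j \<in> U n" using elim(2) by (simp add: U_def)
    then have "ev n j \<in> disc n" using U[OF n] by blast
    with elim show ?case by (simp add: good_def)
  qed
  then obtain N where N: "\<And>n. n \<ge> N \<Longrightarrow> good n" unfolding eventually_sequentially by blast
  show "\<exists>N. \<forall>n>N. geometric_multiplicity q \<beta> (ev n j) = 1"
  proof (intro exI allI impI)
    fix n assume "n > N"
    then have g: "good n" using N by simp
    interpret sturm_large q \<beta> n by unfold_locales (use g in \<open>simp add: good_def\<close>)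
    have z: "ev n j \<in> disc n" using g by (simp add: good_def)
    have "T1_eigenvalue q \<beta> (ev n j)" using assms(5) j g by (auto simp: T1_eigenvalue_sequences_def good_def)
    then show "geometric_multiplicity q \<beta> (ev n j) = 1"
      using geometric_multiplicity_eq_1[OF z] T1_eigenvalue_iff[OF z] by simp
  qed
  show "\<exists>K N. \<forall>n\<ge>N. (\<forall>\<Psi>. T1_eigenfunction q \<beta> (ev n j) \<Psi> \<and> L2_norm \<Psi> = 1 \<longrightarrow>
              (\<exists>c. cmod c = 1 \<and>
                 (\<forall>x\<in>{0..1}.
                    cmod (c * \<Psi> x - of_real (sqrt 2 * cos (2 * pi * real n * x)))
                      \<le> K * real n powr (-1/2))))"
  proof (rule exI[of _ "26 * cosine_constant C"], rule exI[of _ N], intro allI impI)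
    fix n \<Psi> assume "n \<ge> N" and \<Psi>: "T1_eigenfunction q \<beta> (ev n j) \<Psi> \<and> L2_norm \<Psi> = 1"
    then have g: "good n" using N by simp
    interpret sturm_large q \<beta> n by unfold_locales (use g in \<open>simp add: good_def\<close>)
    have z: "ev n j \<in> disc n" "cmod (ev n j - mu n) \<le> C * sqrt (real n)" using g by (simp_all add: good_def)
    have w: "weak_solution (ev n j) \<Psi> (\<lambda>x. 0)"
      using T1_op_iff_weak_solution[OF continuous_on_const, of \<Psi> "ev n j" 0] \<Psi> by (simp add: T1_eigenfunction_def)
    then have c: "continuous_on {0..1} \<Psi>" by (simp add: weak_solution_def)
    have "cosine_constant C / sqrt (real n) \<le> 1 / 12"
      using g n_ge_1 by (simp add: good_def divide_le_eq)
    from normalized_near_cosine[OF n_ge_1 c conjunct2[OF \<Psi>] eigenfunction_near_cosine[OF z w] this]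
    show "\<exists>c. cmod c = 1 \<and>
                 (\<forall>x\<in>{0..1}.
                    cmod (c * \<Psi> x - of_real (sqrt 2 * cos (2 * pi * real n * x)))
                      \<le> (26 * cosine_constant C) * real n powr (-1/2))"
      using n_ge_1 powr_minus_divide[of "real n" "1/2"] by (simp add: powr_half_sqrt)
  qed
qed

end
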